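(* Let $p>1$ and $N>2p$, let $V\in C(\mathbb{R}^N,\mathbb{R})$ satisfy (V1), (V2), (V3), and let $f$ satisfy (F1), (F2) (conditions listed in the context). Then there exists $\Lambda_0>0$ such that for each $\lambda>\Lambda_0$ the problem $$\Delta_p^2 u-\Delta_p u+\lambda V(x)|u|^{p-2}u=f(x,u),\quad x\in\mathbb{R}^N,\qquad u\in W^{2,p}(\mathbb{R}^N),$$ has at least one nontrivial (that is, not identically zero) solution $u_\lambda$.
   Context: Here $\Delta_p^2u=\Delta(|\Delta u|^{p-2}\Delta u)$ and $\Delta_pu=\nabla\cdot(|\nabla u|^{p-2}\nabla u)$. Conditions: (V1) $V(x)\ge 0$ on $\mathbb{R}^N$. (V2) There exists $b>0$ such that $V_b=\{x\in\mathbb{R}^N: V(x)<b\}$ is nonempty and has finite Lebesgue measure. (V3) $\Omega=\operatorname{int}V^{-1}(0)$ is nonempty and has smooth boundary, with $\overline{\Omega}=V^{-1}(0)$. (F1) $f\in C(\mathbb{R}^N\times\mathbb{R},\mathbb{R})$ and there exist constants $1<\gamma_1<\gamma_2<\cdots<\gamma_m<p$ and functions $\xi_i\in L^{\frac{p}{p-\gamma_i}}(\mathbb{R}^N,\mathbb{R}^+)$, $1\le i\le m$, such that $|f(x,u)|\le\sum_{i=1}^m\gamma_i\xi_i(x)|u|^{\gamma_i-1}$ for all $(x,u)\in\mathbb{R}^N\times\mathbb{R}$. (F2) There exist constants $\eta,\delta>0$ and $\gamma_0\in(1,p)$ such that $F(x,u)\ge\eta|u|^{\gamma_0}$ for all $x\in\Omega$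 and all $u\in\mathbb{R}$ with $|u|\le\delta$, where $F(x,u)=\int_0^uf(x,s)\,ds$. $W^{2,p}(\mathbb{R}^N)=\{u\in L^p(\mathbb{R}^N): |\nabla u|,\Delta u\in L^p(\mathbb{R}^N)\}$. For $\lambda>0$, $E_\lambda=\{u\in W^{2,p}(\mathbb{R}^N):\int_{\mathbb{R}^N}(|\Delta u|^p+|\nabla u|^p+\lambda V(x)|u|^p)\,dx<\infty\}$. Solutions are understood in the weak sense: $u\in E_\lambda$ is a solution if for all $v\in E_\lambda$ $$\int_{\mathbb{R}^N}\big(|\Delta u|^{p-2}\Delta u\,\Delta v+|\nabla u|^{p-2}\nabla u\cdot\nabla v+\lambda V(x)|u|^{p-2}uv\big)\,dx=\int_{\mathbb{R}^N}f(x,u)v\,dx.$$ *)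

theory Defs
  imports "HOL-Analysis.Analysis"
begin

definition pderiv_dir :: "'a::euclidean_space \<Rightarrow> ('a \<Rightarrow> real) \<Rightarrow> 'a \<Rightarrow> real" where
  "pderiv_dir b \<phi> x = frechet_derivative \<phi> (at x) b"

definition laplacian :: "('a::euclidean_space \<Rightarrow> real) \<Rightarrow> 'a \<Rightarrow> real" where
  "laplacian \<phi> x = (\<Sum>b\<in>Basis. pderiv_dir b (pderiv_dir b \<phi>) x)"

primrec C_k :: "nat \<Rightarrow> ('a::euclidean_space \<Rightarrow> real) \<Rightarrow> bool" where
  "C_k 0 \<phi> \<longleftrightarrow> continuous_on UNIV \<phi>"
| "C_k (Suc k) \<phi> \<longleftrightarrow> (\<forall>x. \<phi> differentiable (at x)) \<and> (\<forall>b\<in>Basis. C_k k (pderiv_dir b \<phi>))"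

definition smooth :: "('a::euclidean_space \<Rightarrow> real) \<Rightarrow> bool" where
  "smooth \<phi> \<longleftrightarrow> (\<forall>k. C_k k \<phi>)"

definition test_function :: "('a::euclidean_space \<Rightarrow> real) \<Rightarrow> bool" where
  "test_function \<phi> \<longleftrightarrow> smooth \<phi> \<and> compact (closure {x. \<phi> x \<noteq> 0})"

text \<open>Elements of function spaces are represented by Lebesgue measurable functions defined
  everywhere; functions that agree almost everywhere are not identified.\<close>

definition Lp :: "real \<Rightarrow> ('a::euclidean_space \<Rightarrow> 'b::euclidean_space) set" where
  "Lp p = {u. u \<in> borel_measurable lebesgue \<and> integrable lebesgue (\<lambda>x. norm (u x) powr p)}"

definition locally_integrable :: "('a::euclidean_space \<Rightarrow> 'b::euclidean_space) \<Rightarrow> bool" where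
  "locally_integrable u \<longleftrightarrow> (\<forall>K. compact K \<longrightarrow> set_integrable lebesgue K u)"

definition has_weak_gradient :: "('a::euclidean_space \<Rightarrow> real) \<Rightarrow> ('a \<Rightarrow> 'a) \<Rightarrow> bool" where
  "has_weak_gradient u g \<longleftrightarrow> locally_integrable u \<and> locally_integrable g \<and>
     (\<forall>\<phi>. test_function \<phi> \<longrightarrow> (\<forall>b\<in>Basis.
        (\<integral>x. u x * pderiv_dir b \<phi> x \<partial>lebesgue) = - (\<integral>x. (g x \<bullet> b) * \<phi> x \<partial>lebesgue)))"

definition has_weak_laplacian :: "('a::euclidean_space \<Rightarrow> real) \<Rightarrow> ('a \<Rightarrow> real) \<Rightarrow> bool" where
  "has_weak_laplacian u w \<longleftrightarrow> locally_integrable u \<and> locally_integrable w \<and>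
     (\<forall>\<phi>. test_function \<phi> \<longrightarrow>
        (\<integral>x. u x * laplacian \<phi> x \<partial>lebesgue) = (\<integral>x. w x * \<phi> x \<partial>lebesgue))"

text \<open>Weak derivatives are unique up to null sets, so the choices below do not affect any
  integral. They are meaningful only if a weak derivative exists, as it does on
  \<open>W2p\<close>.\<close>

definition weak_grad :: "('a::euclidean_space \<Rightarrow> real) \<Rightarrow> 'a \<Rightarrow> 'a" where
  "weak_grad u = (SOME g. has_weak_gradient u g)"

definition weak_lap :: "('a::euclidean_space \<Rightarrow> real) \<Rightarrow> 'a \<Rightarrow> real" where
  "weak_lap u = (SOME w. has_weak_laplacian u w)"

definition W2p :: "real \<Rightarrow> ('a::euclidean_space \<Rightarrow> real) set" where
  "W2p p = {u \<in> Lp p. (\<exists>g. has_weak_gradient u g \<and> g \<in> Lp p) \<and>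
                      (\<exists>w. has_weak_laplacian u w \<and> w \<in> Lp p)}"

definition E_space :: "real \<Rightarrow> real \<Rightarrow> ('a::euclidean_space \<Rightarrow> real) \<Rightarrow> ('a \<Rightarrow> real) set" where
  "E_space p lam V = {u \<in> W2p p. integrable lebesgue
     (\<lambda>x. \<bar>weak_lap u x\<bar> powr p + norm (weak_grad u x) powr p + lam * V x * \<bar>u x\<bar> powr p)}"

text \<open>The Bochner integral of a non-integrable function is 0, so integrability of both
  integrands is demanded explicitly. The convention \<open>0 powr a = 0\<close> gives the usual value 0
  to \<open>\<bar>t\<bar> powr (p - 2) * t\<close> at \<open>t = 0\<close>, also for \<open>p < 2\<close>.\<close>

definition weak_solution ::
    "real \<Rightarrow> real \<Rightarrow> ('a::euclidean_space \<Rightarrow> real) \<Rightarrow> ('a \<Rightarrow> real \<Rightarrow> real) \<Rightarrow> ('a \<Rightarrow> real) \<Rightarrow> bool" where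
  "weak_solution p lam V f u \<longleftrightarrow> u \<in> E_space p lam V \<and>
     (\<forall>v \<in> E_space p lam V.
        let lhs = (\<lambda>x. \<bar>weak_lap u x\<bar> powr (p - 2) * weak_lap u x * weak_lap v x
              + norm (weak_grad u x) powr (p - 2) * (weak_grad u x \<bullet> weak_grad v x)
              + lam * V x * \<bar>u x\<bar> powr (p - 2) * u x * v x);
            rhs = (\<lambda>x. f x (u x) * v x)
        in integrable lebesgue lhs \<and> integrable lebesgue rhs \<and>
           (\<integral>x. lhs x \<partial>lebesgue) = (\<integral>x. rhs x \<partial>lebesgue))"

text \<open>Near each boundary point, and in suitably rotated coordinates, the set is the part above
  the graph of a smooth function. The unit vector \<open>e\<close> is the vertical axis; \<open>h\<close> is
  evaluated only on the hyperplane orthogonal to \<open>e\<close>, and every smooth function on that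
  hyperplane extends to the whole space by composition with the projection.\<close>

definition smooth_boundary :: "'a::euclidean_space set \<Rightarrow> bool" where
  "smooth_boundary S \<longleftrightarrow> (\<forall>x0 \<in> frontier S. \<exists>r>0. \<exists>e h. norm e = 1 \<and> smooth h \<and>
     S \<inter> ball x0 r = {y \<in> ball x0 r. h (y - (y \<bullet> e) *\<^sub>R e) < y \<bullet> e})"

definition Omega :: "('a::euclidean_space \<Rightarrow> real) \<Rightarrow> 'a set" where
  "Omega V = interior (V -` {0})"

definition cond_V1 :: "('a::euclidean_space \<Rightarrow> real) \<Rightarrow> bool" where
  "cond_V1 V \<longleftrightarrow> (\<forall>x. V x \<ge> 0)"

definition cond_V2 :: "('a::euclidean_space \<Rightarrow> real) \<Rightarrow> bool" where
  "cond_V2 V \<longleftrightarrow> (\<exists>b>0. {x. V x < b} \<noteq> {} \<and> {x. V x < b} \<in> lmeasurable)"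

definition cond_V3 :: "('a::euclidean_space \<Rightarrow> real) \<Rightarrow> bool" where
  "cond_V3 V \<longleftrightarrow> Omega V \<noteq> {} \<and> smooth_boundary (Omega V) \<and> closure (Omega V) = V -` {0}"

definition cond_F1 :: "real \<Rightarrow> ('a::euclidean_space \<Rightarrow> real \<Rightarrow> real) \<Rightarrow> bool" where
  "cond_F1 p f \<longleftrightarrow> continuous_on UNIV (\<lambda>(x, t). f x t) \<and>
     (\<exists>(m::nat) (\<gamma> :: nat \<Rightarrow> real) (\<xi> :: nat \<Rightarrow> 'a \<Rightarrow> real).
        m \<ge> 1 \<and> strict_mono_on {1..m} \<gamma> \<and>
        (\<forall>i\<in>{1..m}. 1 < \<gamma> i \<and> \<gamma> i < p \<and> \<xi> i \<in> Lp (p / (p - \<gamma> i)) \<and> (\<forall>x. \<xi> i x \<ge> 0)) \<and>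
        (\<forall>x t. \<bar>f x t\<bar> \<le> (\<Sum>i=1..m. \<gamma> i * \<xi> i x * \<bar>t\<bar> powr (\<gamma> i - 1))))"

text \<open>The interval integral is oriented: for \<open>t < 0\<close> it is minus the integral over
  \<open>(t, 0)\<close>.\<close>

definition primitive :: "('a \<Rightarrow> real \<Rightarrow> real) \<Rightarrow> 'a \<Rightarrow> real \<Rightarrow> real" where
  "primitive f x t = (LBINT s=ereal 0..ereal t. f x s)"

definition cond_F2 ::
    "real \<Rightarrow> ('a::euclidean_space \<Rightarrow> real) \<Rightarrow> ('a \<Rightarrow> real \<Rightarrow> real) \<Rightarrow> bool" where
  "cond_F2 p V f \<longleftrightarrow> (\<exists>\<eta> \<delta> \<gamma>0. \<eta> > 0 \<and> \<delta> > 0 \<and> 1 < \<gamma>0 \<and> \<gamma>0 < p \<and>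
     (\<forall>x \<in> Omega V. \<forall>t. \<bar>t\<bar> \<le> \<delta> \<longrightarrow> primitive f x t \<ge> \<eta> * \<bar>t\<bar> powr \<gamma>0))"

end

theory Submission
  imports Defs "HOL-Complex_Analysis.Great_Picard"
begin

text \<open>The solution is a global minimiser of the action
  \<open>\<Phi>(u)/p - \<integral> F(x, u) dx\<close>, where \<open>\<Phi>(u) = \<integral> \<bar>\<Delta>u\<bar>\<^sup>p + \<bar>\<nabla>u\<bar>\<^sup>p + \<lambda> V \<bar>u\<bar>\<^sup>p dx\<close>. The weak
  equation is the vanishing of its directional derivatives (\<open>Euler_Lagrange\<close>), and the minimiser is not
  zero because small multiples of a bump inside \<open>\<Omega>\<close> have negative action (\<open>negative_action\<close>).

  The action is coercive: the growth of \<open>F\<close> is of lower order than \<open>\<bar>u\<bar>\<^sup>p\<close>, and \<open>\<Phi>\<close> controls the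
  \<open>L\<^sup>p\<close> norm. On \<open>{V \<ge> b}\<close> this control comes from the potential. On the set of finite measure
  \<open>{V < b}\<close> it comes from a Poincare inequality (\<open>Poincare_finite_measure\<close>), whose only source is the
  bound \<open>\<parallel>u(\<cdot> + h) - u\<parallel>\<^sub>p \<le> \<bar>h\<bar> \<parallel>\<nabla>u\<parallel>\<^sub>p\<close> on translates (\<open>translation_estimate\<close>). The same bound yields
  local compactness (\<open>Rellich\<close>): a minimising sequence has a subsequence that is Cauchy in \<open>L\<^sup>p\<close> on
  each ball. The nonlinear term is continuous along such sequences, since its growth bound has
  integrable tails (\<open>primitive_integral_close\<close>).

  The convergence is in fact strong. At two late members of the sequence and at their midpoint the
  nonlinear term is almost the same, and the action at the midpoint is not below the infimum. Hence the convexity gap of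
  \<open>\<Phi>\<close> at the two members tends to zero, and by uniform convexity the sequence is Cauchy with respect
  to \<open>\<Phi>\<close> (\<open>minimising_sequence_Cauchy\<close>). Completeness of \<open>L\<^sup>p\<close> and Fatou's lemma provide the minimiser.

  All estimates are carried out for Borel functions and the Borel-Lebesgue measure, where Fubini's
  theorem and translations are available. The fundamental lemma of the calculus of variations makes
  weak derivatives unique, which connects the chosen weak derivatives of the definitions with the Borel
  representatives.\<close>

section \<open>Test functions\<close>

lemma pderiv_dir_eqI:
  assumes "(f has_derivative D) (at x)"
  shows "pderiv_dir b f x = D b"
  using frechet_derivative_at[OF assms] by (simp add: pderiv_dir_def)

lemma C_k_Suc_imp: "C_k (Suc k) f \<Longrightarrow> C_k k f"
proof (induction k arbitrary: f)
  case 0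
  then show ?case
    by (auto simp: continuous_on_eq_continuous_at intro: differentiable_imp_continuous_within)
next
  case (Suc k)
  then show ?case by (metis C_k.simps(2))
qed

lemma C_k_add: "C_k k f \<Longrightarrow> C_k k g \<Longrightarrow> C_k k (\<lambda>x. f x + g x)"
proof (induction k arbitrary: f g)
  case 0
  then show ?case by (auto intro: continuous_intros)
next
  case (Suc k)
  have d: "f differentiable at x" "g differentiable at x" for x
    using Suc.prems by auto
  have "pderiv_dir b (\<lambda>x. f x + g x) = (\<lambda>x. pderiv_dir b f x + pderiv_dir b g x)" for b
    using pderiv_dir_eqI[OF has_derivative_add[OF d[unfolded frechet_derivative_works]]]
    by (auto simp: fun_eq_iff pderiv_dir_def)
  then show ?case using Suc by auto
qed

lemma pderiv_dir_mult:
  assumes "\<And>x. f differentiable at x" "\<And>x. g differentiable at x"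
  shows "pderiv_dir b (\<lambda>x. f x * g x) = (\<lambda>x. f x * pderiv_dir b g x + pderiv_dir b f x * g x)"
    "(\<lambda>x. f x * g x) differentiable at x"
proof -
  have d: "(f has_derivative frechet_derivative f (at x)) (at x)"
      "(g has_derivative frechet_derivative g (at x)) (at x)" for x
    using assms by (simp_all flip: frechet_derivative_works)
  show "pderiv_dir b (\<lambda>x. f x * g x) = (\<lambda>x. f x * pderiv_dir b g x + pderiv_dir b f x * g x)"
    using pderiv_dir_eqI[OF has_derivative_mult[OF d]] by (auto simp: fun_eq_iff pderiv_dir_def)
  show "(\<lambda>x. f x * g x) differentiable at x"
    using has_derivative_mult[OF d[of x]] differentiableI by blast
qed

lemma C_k_mult: "C_k k f \<Longrightarrow> C_k k g \<Longrightarrow> C_k k (\<lambda>x. f x * g x)"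
proof (induction k arbitrary: f g)
  case 0
  then show ?case by (auto intro: continuous_intros)
next
  case (Suc k)
  have "C_k k (\<lambda>x. f x * pderiv_dir b g x + pderiv_dir b f x * g x)" if "b \<in> Basis" for b
    using Suc that by (intro C_k_add Suc.IH C_k_Suc_imp[of k f] C_k_Suc_imp[of k g]) auto
  then show ?case using Suc.prems pderiv_dir_mult[of f g] by simp
qed

lemma C_k_const: "C_k k (\<lambda>x. c)"
proof (induction k arbitrary: c)
  case (Suc k)
  have "pderiv_dir b (\<lambda>x::'a. c) = (\<lambda>x. 0)" for b
    by (auto simp: fun_eq_iff pderiv_dir_def)
  then show ?case using Suc by simp
qed simp

lemma pderiv_dir_translate:
  assumes "\<And>x. f differentiable at x"
  shows "pderiv_dir b (\<lambda>x. f (x + h)) = (\<lambda>x. pderiv_dir b f (x + h))"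
    "(\<lambda>x. f (x + h)) differentiable at x"
proof -
  have "((\<lambda>x. f (x + h)) has_derivative frechet_derivative f (at (x + h))) (at x)" for x
  proof -
    have "(f has_derivative frechet_derivative f (at (x + h))) (at (x + h))"
      using assms frechet_derivative_works by blast
    then have "(f \<circ> (\<lambda>x. x + h) has_derivative frechet_derivative f (at (x + h)) \<circ> (\<lambda>x. x)) (at x)"
      by (intro diff_chain_at) (auto intro!: derivative_eq_intros)
    then show ?thesis by (simp add: o_def)
  qed
  then show "pderiv_dir b (\<lambda>x. f (x + h)) = (\<lambda>x. pderiv_dir b f (x + h))"
    "(\<lambda>x. f (x + h)) differentiable at x"
    by (fastforce simp: fun_eq_iff pderiv_dir_def[of b f] intro: pderiv_dir_eqI differentiableI)+
qed

lemma C_k_translate: "C_k k f \<Longrightarrow> C_k k (\<lambda>x. f (x + h))"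
proof (induction k arbitrary: f)
  case 0
  then show ?case by (auto intro!: continuous_on_compose2[where g=f and t=UNIV] continuous_intros)
next
  case (Suc k)
  then show ?case using pderiv_dir_translate[of f] by simp
qed

lemma C_k_prod: "finite A \<Longrightarrow> (\<And>i. i \<in> A \<Longrightarrow> C_k k (f i)) \<Longrightarrow> C_k k (\<lambda>x. \<Prod>i\<in>A. f i x)"
  by (induction A rule: finite_induct) (auto intro: C_k_mult C_k_const)

lemma smooth_differentiable: "smooth f \<Longrightarrow> f differentiable at x"
  unfolding smooth_def by (metis C_k.simps(2))

lemma smooth_continuous: "smooth f \<Longrightarrow> continuous_on S f"
  unfolding smooth_def by (metis C_k.simps(1) continuous_on_subset subset_UNIV)

lemma smooth_pderiv_dir: "smooth f \<Longrightarrow> b \<in> Basis \<Longrightarrow> smooth (pderiv_dir b f)"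
  unfolding smooth_def by (metis C_k.simps(2))

lemma smooth_mult: "smooth f \<Longrightarrow> smooth g \<Longrightarrow> smooth (\<lambda>x. f x * g x)"
  unfolding smooth_def by (auto intro: C_k_mult)

lemma smooth_translate: "smooth f \<Longrightarrow> smooth (\<lambda>x. f (x + h))"
  unfolding smooth_def by (auto intro: C_k_translate)

lemma smooth_has_derivative:
  assumes "smooth f"
  shows "(f has_derivative (\<lambda>h. \<Sum>b\<in>Basis. (h \<bullet> b) * pderiv_dir b f x)) (at x)"
proof -
  have D: "(f has_derivative frechet_derivative f (at x)) (at x)"
    using smooth_differentiable[OF assms] frechet_derivative_works by blast
  then interpret bounded_linear "frechet_derivative f (at x)"
    by (rule has_derivative_bounded_linear)
  have "frechet_derivative f (at x) h = (\<Sum>b\<in>Basis. (h \<bullet> b) * pderiv_dir b f x)" for h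
    by (subst euclidean_representation[of h, symmetric], subst sum)
       (simp add: scale pderiv_dir_def)
  then show ?thesis using D by presburger
qed

lemma test_functionI_support:
  assumes "smooth \<phi>" "bounded S" "\<And>x. x \<notin> S \<Longrightarrow> \<phi> x = 0"
  shows "test_function \<phi>"
  unfolding test_function_def using assms
  by (auto simp: compact_closure intro: bounded_subset)

lemma test_function_bounds:
  assumes "test_function \<phi>"
  obtains B R where "B > 0" "R > 0" "\<And>x. \<bar>\<phi> x\<bar> \<le> B" "\<And>x. norm x > R \<Longrightarrow> \<phi> x = 0"
proof -
  let ?K = "closure {x. \<phi> x \<noteq> 0}"
  have K: "compact ?K" and c: "continuous_on ?K \<phi>"
    using assms by (auto simp: test_function_def smooth_continuous)
  obtain R where R: "R > 0" "\<And>x. x \<in> ?K \<Longrightarrow> norm x \<le> R"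
    using compact_imp_bounded[OF K] bounded_pos by metis
  obtain B where B: "B > 0" "\<And>y. y \<in> \<phi> ` ?K \<Longrightarrow> norm y \<le> B"
    using compact_imp_bounded[OF compact_continuous_image[OF c K]] bounded_pos by metis
  have "\<bar>\<phi> x\<bar> \<le> B" for x
    using B closure_subset[of "{x. \<phi> x \<noteq> 0}"] by (cases "\<phi> x = 0") auto
  moreover have "\<phi> x = 0" if "norm x > R" for x
    using R(2)[of x] that closure_subset[of "{x. \<phi> x \<noteq> 0}"] by fastforce
  ultimately show thesis using that B(1) R(1) by blast
qed

lemma test_function_smooth: "test_function \<phi> \<Longrightarrow> smooth \<phi>"
  by (simp add: test_function_def)

lemma test_function_measurable [measurable_dest]:
  "test_function \<phi> \<Longrightarrow> \<phi> \<in> borel_measurable borel"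
  by (simp add: borel_measurable_continuous_onI smooth_continuous test_function_def)

lemma pderiv_dir_outside:
  fixes \<phi> :: "'a::euclidean_space \<Rightarrow> real"
  assumes "\<And>x. norm x > R \<Longrightarrow> \<phi> x = 0" "norm x > R"
  shows "pderiv_dir b \<phi> x = 0"
proof -
  have "(\<phi> has_derivative (\<lambda>h. 0)) (at x)"
    by (rule has_derivative_transform_within_open[of "\<lambda>x. 0" _ _ _ "- cball 0 R"])
       (use assms in auto)
  then show ?thesis using pderiv_dir_eqI by fastforce
qed

lemma test_function_pderiv_dir:
  assumes "test_function \<phi>" "b \<in> Basis"
  shows "test_function (pderiv_dir b \<phi>)"
proof -
  obtain B R where R: "\<And>x. norm x > R \<Longrightarrow> \<phi> x = 0"
    using test_function_bounds[OF assms(1)] by metis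
  show ?thesis
  proof (rule test_functionI_support[OF _ bounded_cball])
    show "smooth (pderiv_dir b \<phi>)"
      by (rule smooth_pderiv_dir[OF test_function_smooth[OF assms(1)] assms(2)])
    show "pderiv_dir b \<phi> x = 0" if "x \<notin> cball 0 R" for x
      using pderiv_dir_outside[of R \<phi> x b, OF R] that by simp
  qed
qed

lemma test_function_mult:
  assumes "test_function \<phi>" "smooth \<psi>"
  shows "test_function (\<lambda>x. \<phi> x * \<psi> x)"
proof -
  obtain B R where R: "\<And>x. norm x > R \<Longrightarrow> \<phi> x = 0"
    using test_function_bounds[OF assms(1)] by metis
  show ?thesis
    by (rule test_functionI_support[where S="cball 0 R"])
       (use assms R in \<open>auto intro: smooth_mult test_function_smooth\<close>)
qed

lemma test_function_translate:
  assumes "test_function \<phi>"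
  shows "test_function (\<lambda>x. \<phi> (x + h))"
proof -
  obtain B R where R: "\<And>x. norm x > R \<Longrightarrow> \<phi> x = 0"
    using test_function_bounds[OF assms(1)] by metis
  show ?thesis
    by (rule test_functionI_support[where S="cball (-h) R"])
       (use assms R in \<open>auto intro: smooth_translate test_function_smooth simp: dist_norm norm_minus_commute add.commute\<close>)
qed

text \<open>The functions \<open>q (1/t) exp (-1/t)\<close> with a polynomial \<open>q\<close>, continued by \<open>0\<close>
  to \<open>t \<le> 0\<close>, are closed under differentiation; that is why the basic one, with \<open>q = 1\<close>,
  is smooth.\<close>

definition flat_exp :: "real poly \<Rightarrow> real \<Rightarrow> real" where
  "flat_exp q t = (if t > 0 then poly q (1 / t) * exp (- (1 / t)) else 0)"

lemma poly_exp_tendsto_0: "((\<lambda>y. poly q y * exp (- y)) \<longlongrightarrow> 0) at_top" for q :: "real poly"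
proof -
  have "((\<lambda>y. \<Sum>i\<le>degree q. coeff q i * (y ^ i / exp y)) \<longlongrightarrow> (\<Sum>i\<le>degree q. coeff q i * 0)) at_top"
    by (intro tendsto_intros tendsto_power_div_exp_0)
  then show ?thesis
    by (simp add: poly_altdef sum_distrib_right exp_minus divide_inverse mult.assoc)
qed

lemma flat_exp_has_derivative:
  "(flat_exp q has_real_derivative flat_exp ([:0, 0, 1:] * (q - pderiv q)) t) (at t)"
proof (cases t "0::real" rule: linorder_cases)
  case less
  have "((\<lambda>_. 0) has_real_derivative 0) (at t)" by simp
  then have "(flat_exp q has_real_derivative 0) (at t)"
    by (rule has_field_derivative_transform_within_open[where S="{..<0}"])
       (use less in \<open>auto simp: flat_exp_def\<close>)
  then show ?thesis using less by (simp add: flat_exp_def)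
next
  case greater
  let ?g = "\<lambda>t. poly q (1 / t) * exp (- (1 / t))"
  have "(?g has_real_derivative
      poly q (1 / t) * (exp (- (1 / t)) * (1 / t\<^sup>2)) + poly (pderiv q) (1 / t) * (- (1 / t\<^sup>2)) * exp (- (1 / t))) (at t)"
    using greater
    by (auto intro!: derivative_eq_intros DERIV_chain2[OF poly_DERIV] simp: power2_eq_square)
  then have "(flat_exp q has_real_derivative
      poly q (1 / t) * (exp (- (1 / t)) * (1 / t\<^sup>2)) + poly (pderiv q) (1 / t) * (- (1 / t\<^sup>2)) * exp (- (1 / t))) (at t)"
    by (rule has_field_derivative_transform_within_open[where S="{0<..}"])
       (use greater in \<open>auto simp: flat_exp_def\<close>)
  moreover have "poly q (1 / t) * (exp (- (1 / t)) * (1 / t\<^sup>2)) + poly (pderiv q) (1 / t) * (- (1 / t\<^sup>2)) * exp (- (1 / t))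
      = flat_exp ([:0, 0, 1:] * (q - pderiv q)) t"
    using greater by (simp add: flat_exp_def field_simps power2_eq_square)
  ultimately show ?thesis by simp
next
  case equal
  have "((\<lambda>t. flat_exp q t / t) \<longlongrightarrow> 0) (at_right 0)"
  proof -
    have "((\<lambda>t::real. poly ([:0, 1:] * q) (inverse t) * exp (- inverse t)) \<longlongrightarrow> 0) (at_right 0)"
      using filterlim_compose[OF poly_exp_tendsto_0[of "[:0, 1:] * q"] filterlim_inverse_at_top_right] by simp
    then show ?thesis
      by (rule Lim_transform_eventually)
         (auto simp: flat_exp_def eventually_at_right_field divide_inverse intro!: exI[of _ 1])
  qed
  moreover have "((\<lambda>t. flat_exp q t / t) \<longlongrightarrow> 0) (at_left 0)"
    by (rule Lim_transform_eventually[OF tendsto_const])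
       (auto simp: flat_exp_def eventually_at_left_field intro!: exI[of _ "-1"])
  ultimately have "((\<lambda>t. flat_exp q t / t) \<longlongrightarrow> 0) (at 0)"
    by (simp add: filterlim_split_at)
  then show ?thesis using equal by (simp add: has_field_derivative_iff flat_exp_def)
qed

lemma C_k_flat_exp_affine: "C_k k (\<lambda>x. flat_exp q (x \<bullet> e + d))"
proof (induction k arbitrary: q)
  case 0
  have "isCont (flat_exp q) t" for t
    using flat_exp_has_derivative DERIV_isCont by blast
  then have "continuous_on UNIV (flat_exp q)" by (simp add: continuous_on_eq_continuous_at)
  then show ?case
    by (auto intro!: continuous_on_compose2[where g="flat_exp q" and t=UNIV] continuous_intros)
next
  case (Suc k)
  let ?q = "[:0, 0, 1:] * (q - pderiv q)"
  have D: "((\<lambda>x. flat_exp q (x \<bullet> e + d)) has_derivative (\<lambda>h. flat_exp ?q (x \<bullet> e + d) * (h \<bullet> e))) (at x)" for x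
  proof -
    have "(flat_exp q has_derivative (\<lambda>y. flat_exp ?q (x \<bullet> e + d) * y)) (at (x \<bullet> e + d))"
      using flat_exp_has_derivative[of q "x \<bullet> e + d"] by (simp add: has_field_derivative_def)
    then have "(flat_exp q \<circ> (\<lambda>x. x \<bullet> e + d) has_derivative
        (\<lambda>y. flat_exp ?q (x \<bullet> e + d) * y) \<circ> (\<lambda>h. h \<bullet> e)) (at x)"
      by (intro diff_chain_at) (auto intro!: derivative_eq_intros)
    then show ?thesis by (simp add: o_def)
  qed
  have "pderiv_dir b (\<lambda>x. flat_exp q (x \<bullet> e + d)) = (\<lambda>x. flat_exp ?q (x \<bullet> e + d) * (b \<bullet> e))" for b
    using pderiv_dir_eqI[OF D] by (auto simp: fun_eq_iff)
  moreover have "(\<lambda>x. flat_exp q (x \<bullet> e + d)) differentiable at x" for x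
    using D differentiableI by blast
  ultimately show ?case by (auto intro!: C_k_mult C_k_const Suc.IH)
qed

lemma flat_exp_1:
  "flat_exp 1 t \<ge> 0" "flat_exp 1 t \<le> 1" "flat_exp 1 t > 0 \<longleftrightarrow> t > 0" "t \<le> 0 \<Longrightarrow> flat_exp 1 t = 0"
  by (auto simp: flat_exp_def)

lemma flat_exp_1_scaled_tendsto:
  "(\<lambda>n. flat_exp 1 (real (Suc n) * t)) \<longlonglongrightarrow> (if t > 0 then 1 else 0)"
proof (cases "t > 0")
  case True
  have "(\<lambda>n. exp (- (inverse (real (Suc n)) * (1 / t)))) \<longlonglongrightarrow> exp (- (0 * (1 / t)))"
    by (intro tendsto_intros LIMSEQ_inverse_real_of_nat)
  moreover have "t + t * real n > 0" for n using True by (simp add: add_pos_nonneg)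
  ultimately show ?thesis using True by (simp add: flat_exp_def field_simps)
qed (simp add: flat_exp_def zero_less_mult_iff)

definition box_bump :: "'a::euclidean_space \<Rightarrow> 'a \<Rightarrow> nat \<Rightarrow> 'a \<Rightarrow> real" where
  "box_bump a c n x = (\<Prod>b\<in>Basis. flat_exp 1 (real (Suc n) * (x \<bullet> b - a \<bullet> b))
                                 * flat_exp 1 (real (Suc n) * (c \<bullet> b - x \<bullet> b)))"

lemma box_bump_bounds:
  "0 \<le> box_bump a c n x" "box_bump a c n x \<le> 1" "x \<in> box a c \<Longrightarrow> box_bump a c n x > 0"
  unfolding box_bump_def
  by (auto intro!: prod_nonneg prod_le_1 prod_pos mult_le_one mult_pos_pos simp: flat_exp_1 mem_box)

lemma box_bump_outside: "x \<notin> box a c \<Longrightarrow> box_bump a c n x = 0"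
proof -
  assume "x \<notin> box a c"
  then obtain b where b: "b \<in> Basis" "x \<bullet> b - a \<bullet> b \<le> 0 \<or> c \<bullet> b - x \<bullet> b \<le> 0"
    by (auto simp: mem_box not_less)
  then have "flat_exp 1 (real (Suc n) * (x \<bullet> b - a \<bullet> b)) = 0 \<or> flat_exp 1 (real (Suc n) * (c \<bullet> b - x \<bullet> b)) = 0"
    by (metis flat_exp_1(4) mult_nonneg_nonpos of_nat_0_le_iff)
  with b(1) show ?thesis unfolding box_bump_def by (intro prod_zero) auto
qed

lemma box_bump_tendsto:
  fixes x :: "'a::euclidean_space"
  shows "(\<lambda>n. box_bump a c n x) \<longlonglongrightarrow> indicator (box a c) x"
proof -
  have "(\<lambda>n. box_bump a c n x) \<longlonglongrightarrow>
      (\<Prod>b\<in>Basis. (if 0 < x \<bullet> b - a \<bullet> b then 1 else 0) * (if 0 < c \<bullet> b - x \<bullet> b then 1 else 0))"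
    unfolding box_bump_def by (intro tendsto_intros flat_exp_1_scaled_tendsto)
  also have "(\<Prod>b\<in>Basis. (if 0 < x \<bullet> b - a \<bullet> b then 1 else 0) * (if 0 < c \<bullet> b - x \<bullet> b then 1 else 0))
      = (indicator (box a c) x :: real)"
  proof (cases "x \<in> box a c")
    case False
    then obtain b where "b \<in> Basis" "\<not> 0 < x \<bullet> b - a \<bullet> b \<or> \<not> 0 < c \<bullet> b - x \<bullet> b"
      by (auto simp: mem_box)
    with False show ?thesis by (auto intro!: prod_zero)
  qed (auto simp: mem_box)
  finally show ?thesis .
qed

lemma test_function_box_bump: "test_function (box_bump a c n)"
proof (rule test_functionI_support[OF _ bounded_box box_bump_outside])
  have "C_k k (\<lambda>x. flat_exp 1 (real (Suc n) * (x \<bullet> b - a \<bullet> b)) * flat_exp 1 (real (Suc n) * (c \<bullet> b - x \<bullet> b)))" for k b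
    using C_k_mult[OF C_k_flat_exp_affine[of k 1 "real (Suc n) *\<^sub>R b" "- (real (Suc n) * (a \<bullet> b))"]
        C_k_flat_exp_affine[of k 1 "- (real (Suc n) *\<^sub>R b)" "real (Suc n) * (c \<bullet> b)"]]
    by (simp add: algebra_simps)
  then show "smooth (box_bump a c n)"
    unfolding smooth_def box_bump_def by (auto intro!: C_k_prod)
qed

section \<open>Local integrability and the fundamental lemma\<close>

text \<open>Balls exhaust the space and every compact set lies in one of them, so they can replace compact sets.\<close>

definition loc_integrable :: "('a::euclidean_space \<Rightarrow> 'b::euclidean_space) \<Rightarrow> bool" where
  "loc_integrable u \<longleftrightarrow> u \<in> borel_measurable borel \<and>
     (\<forall>R. integrable lborel (\<lambda>x. indicator (cball 0 R) x *\<^sub>R u x))"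

lemma loc_integrable_measurable: "loc_integrable u \<Longrightarrow> u \<in> borel_measurable borel"
  by (simp add: loc_integrable_def)

lemma loc_integrable_diff:
  assumes "loc_integrable u" "loc_integrable v"
  shows "loc_integrable (\<lambda>x. u x - v x)"
  using assms unfolding loc_integrable_def by (auto simp: scaleR_diff_right)

lemma loc_integrable_inner:
  assumes "loc_integrable u"
  shows "loc_integrable (\<lambda>x. u x \<bullet> b)"
  unfolding loc_integrable_def
proof (intro conjI allI)
  show "(\<lambda>x. u x \<bullet> b) \<in> borel_measurable borel"
    using loc_integrable_measurable[OF assms] by auto
  show "integrable lborel (\<lambda>x. indicator (cball 0 R) x *\<^sub>R (u x \<bullet> b))" for R
    using integrable_inner_left[of b lborel "\<lambda>x. indicator (cball 0 R) x *\<^sub>R u x"] assms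
    by (simp add: loc_integrable_def)
qed

lemma integrable_bounded_support:
  fixes u :: "'a::euclidean_space \<Rightarrow> real"
  assumes u: "loc_integrable u" and \<phi>: "\<phi> \<in> borel_measurable borel"
    and B: "\<And>x. \<bar>\<phi> x\<bar> \<le> B" and R: "\<And>x. norm x > R \<Longrightarrow> \<phi> x = 0"
  shows "integrable lborel (\<lambda>x. u x * \<phi> x)"
proof (rule Bochner_Integration.integrable_bound)
  show "integrable lborel (\<lambda>x. B * (indicator (cball 0 R) x *\<^sub>R u x))"
    using u by (intro integrable_mult_right) (simp add: loc_integrable_def)
  show "(\<lambda>x. u x * \<phi> x) \<in> borel_measurable lborel"
    using \<phi> loc_integrable_measurable[OF u] by auto
  have "\<bar>u x\<bar> * \<bar>\<phi> x\<bar> \<le> \<bar>B\<bar> * \<bar>indicator (cball 0 R) x * u x\<bar>" for x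
    using mult_left_mono[OF B[of x], of "\<bar>u x\<bar>"] B[of x] R[of x]
    by (cases "norm x > R") (auto simp: mult.commute)
  then show "AE x in lborel. norm (u x * \<phi> x) \<le> norm (B * (indicator (cball 0 R) x *\<^sub>R u x))"
    by (simp add: abs_mult)
qed

lemma integrable_times_test:
  fixes u :: "'a::euclidean_space \<Rightarrow> real"
  assumes "loc_integrable u" "test_function \<phi>"
  shows "integrable lborel (\<lambda>x. u x * \<phi> x)"
  using test_function_bounds[OF assms(2)] integrable_bounded_support assms
  by (metis test_function_measurable)

lemma loc_integrable_continuous:
  fixes u :: "'a::euclidean_space \<Rightarrow> 'b::euclidean_space"
  assumes "continuous_on UNIV u"
  shows "loc_integrable u"
  unfolding loc_integrable_def
proof (intro conjI allI)
  show "u \<in> borel_measurable borel" using assms by (rule borel_measurable_continuous_onI)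
  show "integrable lborel (\<lambda>x. indicator (cball 0 R) x *\<^sub>R u x)" for R
    by (rule borel_integrable_compact[OF compact_cball continuous_on_subset[OF assms]]) auto
qed

lemma integrable_test:
  assumes "test_function \<phi>"
  shows "integrable lborel \<phi>"
  using integrable_times_test[OF loc_integrable_continuous[of "\<lambda>_. 1"] assms] by simp

text \<open>Test functions converge boundedly to the indicator of each box, and boxes generate the
  Borel sets.\<close>

lemma fundamental_lemma:
  fixes w :: "'a::euclidean_space \<Rightarrow> real"
  assumes w: "loc_integrable w"
    and z: "\<And>\<phi>. test_function \<phi> \<Longrightarrow> (\<integral>x. w x * \<phi> x \<partial>lborel) = 0"
  shows "AE x in lborel. w x = 0"
proof -
  have m[measurable]: "w \<in> borel_measurable borel" using w loc_integrable_measurable by blast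
  have int_R: "integrable lborel (\<lambda>x. indicator (cball 0 R) x * w x)" for R
    using w by (simp add: loc_integrable_def)
  have box: "(\<integral>x. w x * indicator (box a c) x \<partial>lborel) = 0" for a c
  proof -
    obtain R where R: "box a c \<subseteq> cball 0 R"
      by (meson ball_subset_cball bounded_box bounded_subset_ballD order_trans)
    have "(\<lambda>n. \<integral>x. w x * box_bump a c n x \<partial>lborel) \<longlonglongrightarrow> (\<integral>x. w x * indicator (box a c) x \<partial>lborel)"
    proof (rule integral_dominated_convergence[where w="\<lambda>x. \<bar>indicator (cball 0 R) x * w x\<bar>"])
      show "AE x in lborel. (\<lambda>n. w x * box_bump a c n x) \<longlonglongrightarrow> w x * indicator (box a c) x"
        by (intro AE_I2 tendsto_intros box_bump_tendsto)
      show "AE x in lborel. norm (w x * box_bump a c n x) \<le> \<bar>indicator (cball 0 R) x * w x\<bar>" for n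
      proof (rule AE_I2)
        fix x
        show "norm (w x * box_bump a c n x) \<le> \<bar>indicator (cball 0 R) x * w x\<bar>"
          using R box_bump_bounds(1,2)[of a c n x] box_bump_outside[of x a c n]
          by (cases "x \<in> box a c") (auto simp: abs_mult mult_left_le subset_iff)
      qed
      show "(\<lambda>x. w x * box_bump a c n x) \<in> borel_measurable lborel" for n
        using test_function_measurable[OF test_function_box_bump[of a c n]] by simp
      show "integrable lborel (\<lambda>x. \<bar>indicator (cball 0 R) x * w x\<bar>)"
        using int_R by (rule integrable_abs)
    qed simp
    then show ?thesis using z[OF test_function_box_bump] by (simp add: LIMSEQ_const_iff)
  qed
  \<comment> \<open>On a bounded box \<open>w\<close> is integrable, so the sets on which its integral vanishes form a Dynkin system.\<close>
  have "AE x in lborel. indicator (box (- (real n *\<^sub>R One)) (real n *\<^sub>R One)) x * w x = 0" for n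
  proof -
    define B where "B = (box (- (real n *\<^sub>R One)) (real n *\<^sub>R One) :: 'a set)"
    let ?w = "\<lambda>x. indicator B x * w x"
    obtain R where R: "B \<subseteq> cball 0 R"
      unfolding B_def by (meson ball_subset_cball bounded_box bounded_subset_ballD order_trans)
    have [measurable]: "B \<in> sets borel" by (simp add: B_def)
    have iw: "integrable lborel ?w"
      by (rule Bochner_Integration.integrable_bound[OF int_R[of R]])
         (use R in \<open>auto intro!: AE_I2 simp: indicator_def subset_iff\<close>)
    have si: "set_integrable lborel A ?w" if "A \<in> sets borel" for A
      using that integrable_mult_indicator[OF _ iw, of A] by (simp add: set_integrable_def)
    have "set_lebesgue_integral lborel A ?w = 0"
      if "A \<in> sigma_sets UNIV (range (\<lambda>(a, b). box a b :: 'a set))" for A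
    proof (rule sigma_sets_induct_disjoint[OF _ _ that, of "\<lambda>A. set_lebesgue_integral lborel A ?w = 0"])
      have sets: "A \<in> sets borel" if "A \<in> sigma_sets UNIV (range (\<lambda>(a, b). box a b :: 'a set))" for A
        using that by (simp add: borel_eq_box)
      show "Int_stable (range (\<lambda>(a, b). box a b :: 'a set))"
        by (auto simp: Int_stable_def box_Int_box)
      show "set_lebesgue_integral lborel A ?w = 0" if rng: "A \<in> range (\<lambda>(a, b). box a b)" for A
      proof -
        obtain a b where A: "A = box a b" using rng by auto
        obtain a' b' where "box a b \<inter> B = box a' b'" unfolding B_def box_Int_box by blast
        then have "(\<lambda>x. indicator A x *\<^sub>R ?w x) = (\<lambda>x. w x * indicator (box a' b') x)"
          unfolding A by (auto simp: indicator_def fun_eq_iff)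
        then show ?thesis unfolding set_lebesgue_integral_def by (simp only: box)
      qed
      show "set_lebesgue_integral lborel (UNIV - A) ?w = 0"
        if "A \<in> sigma_sets UNIV (range (\<lambda>(a, b). box a b))" "set_lebesgue_integral lborel A ?w = 0" for A
      proof -
        have "set_lebesgue_integral lborel (UNIV - A) ?w
            = (\<integral>x. ?w x - indicator A x *\<^sub>R ?w x \<partial>lborel)"
          unfolding set_lebesgue_integral_def by (rule Bochner_Integration.integral_cong) (auto simp: indicator_def)
        also have "\<dots> = (\<integral>x. ?w x \<partial>lborel) - (\<integral>x. indicator A x *\<^sub>R ?w x \<partial>lborel)"
          using iw si[OF sets[OF that(1)]] by (intro Bochner_Integration.integral_diff) (auto simp: set_integrable_def)
        also have "(\<integral>x. ?w x \<partial>lborel) = 0" using box by (simp add: B_def mult.commute)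
        finally show ?thesis using that(2) by (simp add: set_lebesgue_integral_def)
      qed
      show "set_lebesgue_integral lborel (\<Union>i. A i) ?w = 0"
        if "disjoint_family A" "range A \<subseteq> sigma_sets UNIV (range (\<lambda>(a, b). box a b))"
          "\<And>i. set_lebesgue_integral lborel (A i) ?w = 0" for A :: "nat \<Rightarrow> 'a set"
      proof -
        have [measurable]: "A i \<in> sets borel" for i using that(2) sets by auto
        show ?thesis
          by (subst lebesgue_integral_countable_add)
             (use that in \<open>auto simp: disjoint_family_on_def intro!: si\<close>)
      qed
    qed (auto simp: set_lebesgue_integral_def)
    then have "set_lebesgue_integral lborel A ?w = 0" if "A \<in> sets lborel" for A
      using that by (simp add: borel_eq_box)
    then show ?thesis using sigma_finite_measure.density_zero[OF sigma_finite_lborel iw] by (simp add: B_def)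
  qed
  then have "AE x in lborel. \<forall>n. indicator (box (- (real n *\<^sub>R One)) (real n *\<^sub>R One)) x * w x = 0"
    by (rule AE_all_countable[THEN iffD2, OF allI])
  then show ?thesis
  proof (rule AE_mp, intro AE_I2 impI)
    fix x :: 'a assume *: "\<forall>n. indicator (box (- (real n *\<^sub>R One)) (real n *\<^sub>R One)) x * w x = 0"
    obtain n where "x \<in> box (- (real n *\<^sub>R One)) (real n *\<^sub>R One)"
      using UN_box_eq_UNIV by blast
    then show "w x = 0" using * by (metis indicator_simps(1) mult_1)
  qed
qed

section \<open>Integration by parts\<close>

lemma lborel_integral_translate:
  fixes f :: "'a::euclidean_space \<Rightarrow> 'b::{banach, second_countable_topology}"
  assumes "f \<in> borel_measurable borel"
  shows "(\<integral>x. f (x + h) \<partial>lborel) = (\<integral>x. f x \<partial>lborel)"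
    "integrable lborel (\<lambda>x. f (x + h)) \<longleftrightarrow> integrable lborel f"
proof -
  have "(\<lambda>x. x + h) = (+) h" by (auto simp: add.commute)
  then have d: "lborel = distr lborel borel (\<lambda>x. x + h)" using lborel_distr_plus[of h] by simp
  show "(\<integral>x. f (x + h) \<partial>lborel) = (\<integral>x. f x \<partial>lborel)"
    by (subst (2) d) (use assms in \<open>simp add: integral_distr\<close>)
  show "integrable lborel (\<lambda>x. f (x + h)) \<longleftrightarrow> integrable lborel f"
    by (subst (2) d) (use assms in \<open>simp add: integrable_distr_eq\<close>)
qed

lemma lborel_nn_integral_translate:
  assumes "f \<in> borel_measurable borel"
  shows "(\<integral>\<^sup>+x. f (x + h :: 'a::euclidean_space) \<partial>lborel) = (\<integral>\<^sup>+x. f x \<partial>lborel)"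
proof -
  have "(\<lambda>x. x + h) = (+) h" by (auto simp: add.commute)
  then have d: "lborel = distr lborel borel (\<lambda>x::'a. x + h)" using lborel_distr_plus[of h] by simp
  show ?thesis
    by (subst (2) d) (use assms in \<open>simp add: nn_integral_distr\<close>)
qed

lemma test_function_lipschitz:
  assumes "test_function \<phi>"
  obtains L where "L > 0" "\<And>x y. \<bar>\<phi> x - \<phi> y\<bar> \<le> L * norm (x - y)"
proof -
  have "\<forall>b\<in>Basis. \<exists>B>0. \<forall>x. \<bar>pderiv_dir b \<phi> x\<bar> \<le> B"
    using test_function_bounds[OF test_function_pderiv_dir[OF assms]] by metis
  then obtain B where B: "\<And>b x. b \<in> Basis \<Longrightarrow> \<bar>pderiv_dir b \<phi> x\<bar> \<le> B b" "\<And>b. b \<in> Basis \<Longrightarrow> B b > 0"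
    by metis
  let ?L = "\<Sum>b\<in>Basis. B b"
  have "norm (\<phi> x - \<phi> y) \<le> ?L * norm (x - y)" for x y
  proof (rule differentiable_bound[of UNIV \<phi> "\<lambda>x h. \<Sum>b\<in>Basis. (h \<bullet> b) * pderiv_dir b \<phi> x"])
    fix x
    show "(\<phi> has_derivative (\<lambda>h. \<Sum>b\<in>Basis. (h \<bullet> b) * pderiv_dir b \<phi> x)) (at x)"
      by (rule smooth_has_derivative[OF test_function_smooth[OF assms]])
    show "onorm (\<lambda>h. \<Sum>b\<in>Basis. (h \<bullet> b) * pderiv_dir b \<phi> x) \<le> ?L"
    proof (rule onorm_le)
      fix h
      have "\<bar>\<Sum>b\<in>Basis. (h \<bullet> b) * pderiv_dir b \<phi> x\<bar> \<le> (\<Sum>b\<in>Basis. norm h * B b)"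
        by (rule order_trans[OF sum_abs sum_mono])
           (auto simp: abs_mult intro!: mult_mono B Basis_le_norm)
      then show "norm (\<Sum>b\<in>Basis. (h \<bullet> b) * pderiv_dir b \<phi> x) \<le> ?L * norm h"
        by (simp add: sum_distrib_left mult.commute)
    qed
  qed auto
  moreover have "?L > 0" using B(2) by (intro sum_pos) auto
  ultimately show thesis using that by auto
qed

text \<open>The derivative is a limit of difference quotients, whose integrals vanish by translation
  invariance.\<close>

lemma integral_pderiv_dir_eq_0:
  fixes \<phi> :: "'a::euclidean_space \<Rightarrow> real"
  assumes \<phi>: "test_function \<phi>" and b: "b \<in> Basis"
  shows "(\<integral>x. pderiv_dir b \<phi> x \<partial>lborel) = 0"
proof -
  have [measurable]: "\<phi> \<in> borel_measurable borel" using \<phi> by (rule test_function_measurable)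
  have [measurable]: "pderiv_dir b \<phi> \<in> borel_measurable borel"
    using test_function_pderiv_dir[OF \<phi> b] by (rule test_function_measurable)
  obtain L where L: "L > 0" "\<And>x y. \<bar>\<phi> x - \<phi> y\<bar> \<le> L * norm (x - y)"
    using test_function_lipschitz[OF \<phi>] by blast
  obtain B R where R: "R > 0" "\<And>x. norm x > R \<Longrightarrow> \<phi> x = 0"
    using test_function_bounds[OF \<phi>] by metis
  define t where "t n = 1 / real (Suc n)" for n
  have t: "t n > 0" "t n \<le> 1" for n by (auto simp: t_def divide_simps)
  have t0: "t \<longlonglongrightarrow> 0"
    unfolding t_def using LIMSEQ_inverse_real_of_nat by (simp add: inverse_eq_divide)
  have "(\<lambda>n. \<integral>x. (\<phi> (x + t n *\<^sub>R b) - \<phi> x) / t n \<partial>lborel) \<longlonglongrightarrow> (\<integral>x. pderiv_dir b \<phi> x \<partial>lborel)"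
  proof (rule integral_dominated_convergence[where w="\<lambda>x. indicator (cball 0 (R + 1)) x *\<^sub>R L"])
    have "(\<lambda>n. (\<phi> (x + t n *\<^sub>R b) - \<phi> x) / t n) \<longlonglongrightarrow> pderiv_dir b \<phi> x" for x
    proof -
      have "((\<lambda>s. \<phi> (x + s *\<^sub>R b)) has_derivative (\<lambda>s. \<Sum>b'\<in>Basis. ((s *\<^sub>R b) \<bullet> b') * pderiv_dir b' \<phi> x)) (at 0)"
      proof -
        have "(\<phi> \<circ> (\<lambda>s. x + s *\<^sub>R b) has_derivative
            (\<lambda>h. \<Sum>b\<in>Basis. (h \<bullet> b) * pderiv_dir b \<phi> (x + 0 *\<^sub>R b)) \<circ> (\<lambda>s. s *\<^sub>R b)) (at 0)"
          by (intro diff_chain_at) (use smooth_has_derivative[OF test_function_smooth[OF \<phi>], of x] in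
            \<open>auto intro!: derivative_eq_intros\<close>)
        then show ?thesis by (simp add: o_def)
      qed
      moreover have "(\<Sum>b'\<in>Basis. ((s *\<^sub>R b) \<bullet> b') * pderiv_dir b' \<phi> x) = pderiv_dir b \<phi> x * s" for s
        using b by (simp add: inner_Basis if_distrib if_distribR mult.commute cong: if_cong)
      ultimately have "((\<lambda>s. \<phi> (x + s *\<^sub>R b)) has_real_derivative pderiv_dir b \<phi> x) (at 0)"
        by (simp add: has_field_derivative_def)
      then have "((\<lambda>s. (\<phi> (x + s *\<^sub>R b) - \<phi> x) / s) \<longlongrightarrow> pderiv_dir b \<phi> x) (at 0)"
        by (simp add: has_field_derivative_iff)
      moreover have "filterlim t (at 0) sequentially"
        using t0 t(1) by (intro filterlim_atI) (auto intro!: always_eventually simp: less_imp_neq[symmetric])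
      ultimately show ?thesis by (rule filterlim_compose)
    qed
    then show "AE x in lborel. (\<lambda>n. (\<phi> (x + t n *\<^sub>R b) - \<phi> x) / t n) \<longlonglongrightarrow> pderiv_dir b \<phi> x" by auto
    show "AE x in lborel. norm ((\<phi> (x + t n *\<^sub>R b) - \<phi> x) / t n) \<le> indicator (cball 0 (R + 1)) x *\<^sub>R L" for n
    proof (rule AE_I2)
      fix x
      have tb: "norm (t n *\<^sub>R b) = t n" using b t[of n] by simp
      show "norm ((\<phi> (x + t n *\<^sub>R b) - \<phi> x) / t n) \<le> indicator (cball 0 (R + 1)) x *\<^sub>R L"
      proof (cases "norm x \<le> R + 1")
        case True
        then show ?thesis using L(2)[of "x + t n *\<^sub>R b" x] tb t[of n] by (simp add: divide_simps)
      next
        case False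
        moreover have "norm (x + t n *\<^sub>R b) > R"
          using False tb t[of n] norm_diff_ineq[of x "t n *\<^sub>R b"] by linarith
        ultimately show ?thesis using R by simp
      qed
    qed
    show "integrable lborel (\<lambda>x. indicator (cball 0 (R + 1)) x *\<^sub>R L)"
      by (rule borel_integrable_compact) auto
  qed auto
  moreover have "(\<integral>x. (\<phi> (x + t n *\<^sub>R b) - \<phi> x) / t n \<partial>lborel) = 0" for n
    using lborel_integral_translate[of \<phi> "t n *\<^sub>R b"] integrable_test[OF \<phi>] by simp
  ultimately show ?thesis by (simp only: LIMSEQ_const_iff)
qed

lemma test_function_integral_by_parts:
  assumes \<phi>: "test_function \<phi>" and \<psi>: "test_function \<psi>" and b: "b \<in> Basis"
  shows "(\<integral>x. \<phi> x * pderiv_dir b \<psi> x \<partial>lborel) = - (\<integral>x. pderiv_dir b \<phi> x * \<psi> x \<partial>lborel)"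
proof -
  have i: "integrable lborel (\<lambda>x. \<phi> x * pderiv_dir b \<psi> x)" "integrable lborel (\<lambda>x. pderiv_dir b \<phi> x * \<psi> x)"
    by (intro integrable_test test_function_mult test_function_pderiv_dir test_function_smooth \<phi> \<psi> b)+
  have "(\<integral>x. pderiv_dir b (\<lambda>x. \<phi> x * \<psi> x) x \<partial>lborel) = 0"
    by (intro integral_pderiv_dir_eq_0 test_function_mult test_function_smooth \<phi> \<psi> b)
  then show ?thesis
    using i pderiv_dir_mult(1)[OF smooth_differentiable smooth_differentiable, of \<phi> \<psi> b,
        OF test_function_smooth[OF \<phi>] test_function_smooth[OF \<psi>]]
    by simp
qed

section \<open>Powers and Jensen's inequality\<close>

lemma powr_tangent_strict:
  fixes s c p :: real
  assumes "p > 1" "s \<ge> 0" "c \<ge> 0" "s \<noteq> c"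
  shows "c powr p + p * c powr (p - 1) * (s - c) < s powr p"
proof -
  have mvt: "\<exists>\<xi>. a < \<xi> \<and> \<xi> < b \<and> b powr p - a powr p = (b - a) * (p * \<xi> powr (p - 1))"
    if "0 \<le> a" "a < b" for a b :: real
  proof -
    have d: "((\<lambda>x. x powr p) has_real_derivative p * x powr (p - 1)) (at x)" if "a < x" for x
      using that \<open>0 \<le> a\<close> by (auto intro!: derivative_eq_intros)
    have "\<exists>l z. a < z \<and> z < b \<and> DERIV (\<lambda>x. x powr p) z :> l \<and> b powr p - a powr p = (b - a) * l"
    proof (rule MVT[OF that(2)])
      show "continuous_on {a..b} (\<lambda>x. x powr p)"
        using that assms by (intro continuous_on_powr') (auto intro: continuous_intros)
    qed (use d real_differentiable_def in blast)
    then show ?thesis using d DERIV_unique by metis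
  qed
  show ?thesis
  proof (cases "c < s")
    case True
    then obtain \<xi> where \<xi>: "c < \<xi>" "s powr p - c powr p = (s - c) * (p * \<xi> powr (p - 1))"
      using mvt[of c s] assms by auto
    have "c powr (p - 1) < \<xi> powr (p - 1)" using \<xi> assms by (intro powr_less_mono2) auto
    then have "p * c powr (p - 1) * (s - c) < p * \<xi> powr (p - 1) * (s - c)"
      using True assms by (intro mult_strict_right_mono) auto
    then show ?thesis using \<xi>(2) by (simp add: mult_ac)
  next
    case False
    then obtain \<xi> where \<xi>: "s < \<xi>" "\<xi> < c" "c powr p - s powr p = (c - s) * (p * \<xi> powr (p - 1))"
      using mvt[of s c] assms by auto
    have "\<xi> powr (p - 1) < c powr (p - 1)" using \<xi> assms by (intro powr_less_mono2) auto
    then have "p * \<xi> powr (p - 1) * (c - s) < p * c powr (p - 1) * (c - s)"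
      using False assms by (intro mult_strict_right_mono) auto
    then show ?thesis using \<xi>(3) by (simp add: algebra_simps)
  qed
qed

lemma powr_tangent:
  fixes s c p :: real
  assumes "p > 1" "s \<ge> 0" "c \<ge> 0"
  shows "c powr p + p * c powr (p - 1) * (s - c) \<le> s powr p"
  using powr_tangent_strict[OF assms] by (cases "s = c") auto

lemma powr_add_le:
  fixes a b p :: real
  assumes "p > 0" "a \<ge> 0" "b \<ge> 0"
  shows "(a + b) powr p \<le> 2 powr p * (a powr p + b powr p)"
proof -
  have "(a + b) powr p \<le> (2 * max a b) powr p"
    using assms by (intro powr_mono2) auto
  also have "\<dots> = 2 powr p * max a b powr p" using assms by (simp add: powr_mult)
  also have "max a b powr p \<le> a powr p + b powr p" by (auto simp: max_def)
  finally show ?thesis by simp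
qed

lemma norm_add_powr_le:
  fixes a b :: "'a::real_normed_vector"
  assumes "p > 0"
  shows "norm (a + b) powr p \<le> 2 powr p * (norm a powr p + norm b powr p)"
  by (rule order_trans[OF powr_mono2[OF _ _ norm_triangle_ineq] powr_add_le]) (use assms in auto)

lemma norm_diff_powr_le:
  fixes a b :: "'a::real_normed_vector"
  assumes "p > 0"
  shows "norm (a - b) powr p \<le> 2 powr p * (norm a powr p + norm b powr p)"
  using norm_add_powr_le[OF assms, of a "-b"] by simp

text \<open>Integrate the tangent line inequality at the mean value.\<close>

lemma Jensen_powr:
  fixes v :: "'a \<Rightarrow> 'b::{banach, second_countable_topology}"
  assumes p: "p > 1" and v: "v \<in> borel_measurable M" and A: "A \<in> sets M"
    and m: "emeasure M A = ennreal m" "m > 0"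
  shows "ennreal (norm (\<integral>x. indicator A x *\<^sub>R v x \<partial>M) powr p)
    \<le> ennreal (m powr (p - 1)) * (\<integral>\<^sup>+x. indicator A x * ennreal (norm (v x) powr p) \<partial>M)"
proof -
  note [measurable] = v A
  let ?N = "\<integral>\<^sup>+x. indicator A x * ennreal (norm (v x) powr p) \<partial>M"
  consider "\<not> integrable M (\<lambda>x. indicator A x *\<^sub>R v x)" | "?N = \<infinity>"
    | "integrable M (\<lambda>x. indicator A x *\<^sub>R v x)" "?N < \<infinity>"
    using top.not_eq_extremum[of ?N] by (auto simp: infinity_ennreal_def)
  then show ?thesis
  proof cases
    case 1
    then show ?thesis by (simp add: not_integrable_integral_eq)
  next
    case 2
    have "0 < m powr (p - 1)" using m by simp
    with 2 show ?thesis by (simp add: ennreal_mult_top)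
  next
    case 3
    let ?s = "\<lambda>x. norm (v x)"
    have i1: "integrable M (\<lambda>x. indicator A x * ?s x)"
      using integrable_norm[OF 3(1)] by simp
    have N_eq: "?N = (\<integral>\<^sup>+x. ennreal (indicator A x * ?s x powr p) \<partial>M)"
      by (intro nn_integral_cong) (auto simp: indicator_def)
    have i2: "integrable M (\<lambda>x. indicator A x * ?s x powr p)"
      using 3(2) unfolding N_eq by (intro integrableI_nonneg) auto
    have iA: "integrable M (indicator A :: 'a \<Rightarrow> real)" using m by (simp add: integrable_indicator_iff)
    have mA: "measure M A = m" using m by (simp add: measure_def)
    define c where "c = (\<integral>x. indicator A x * ?s x \<partial>M) / m"
    have c0: "c \<ge> 0" unfolding c_def using m by (intro divide_nonneg_pos Bochner_Integration.integral_nonneg) auto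
    have "(\<integral>x. c powr p * indicator A x + p * c powr (p - 1) * (indicator A x * ?s x - c * indicator A x) \<partial>M)
        \<le> (\<integral>x. indicator A x * ?s x powr p \<partial>M)"
    proof (rule integral_mono)
      show "c powr p * indicator A x + p * c powr (p - 1) * (indicator A x * ?s x - c * indicator A x)
          \<le> indicator A x * ?s x powr p" for x
        using powr_tangent[OF p _ c0, of "?s x"] by (auto simp: indicator_def)
    qed (use i1 i2 iA in auto)
    also have "(\<integral>x. c powr p * indicator A x + p * c powr (p - 1) * (indicator A x * ?s x - c * indicator A x) \<partial>M)
        = c powr p * m + p * c powr (p - 1) * (c * m - c * m)"
      using i1 iA mA m A by (simp add: c_def)
    finally have *: "c powr p * m \<le> (\<integral>x. indicator A x * ?s x powr p \<partial>M)" by simp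
    have "norm (\<integral>x. indicator A x *\<^sub>R v x \<partial>M) \<le> c * m"
      using integral_norm_bound[of M "\<lambda>x. indicator A x *\<^sub>R v x"] m by (simp add: c_def)
    then have "norm (\<integral>x. indicator A x *\<^sub>R v x \<partial>M) powr p \<le> (c * m) powr p"
      using p by (intro powr_mono2) auto
    also have "\<dots> = m powr (p - 1) * (c powr p * m)"
      using m c0 by (simp add: powr_mult powr_diff)
    also have "\<dots> \<le> m powr (p - 1) * (\<integral>x. indicator A x * ?s x powr p \<partial>M)"
      using * by (intro mult_left_mono) auto
    finally have "ennreal (norm (\<integral>x. indicator A x *\<^sub>R v x \<partial>M) powr p)
        \<le> ennreal (m powr (p - 1)) * ennreal (\<integral>x. indicator A x * ?s x powr p \<partial>M)"
      by (subst ennreal_mult[symmetric]) (auto intro!: Bochner_Integration.integral_nonneg ennreal_leI)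
    also have "ennreal (\<integral>x. indicator A x * ?s x powr p \<partial>M) = ?N"
      unfolding N_eq using i2 by (intro nn_integral_eq_integral[symmetric]) auto
    finally show ?thesis .
  qed
qed

section \<open>Translates of functions with a weak gradient\<close>

text \<open>The counterpart of \<open>has_weak_gradient\<close> for Borel functions and the Borel-Lebesgue measure.\<close>

definition weak_gradient :: "('a::euclidean_space \<Rightarrow> real) \<Rightarrow> ('a \<Rightarrow> 'a) \<Rightarrow> bool" where
  "weak_gradient u g \<longleftrightarrow> loc_integrable u \<and> loc_integrable g \<and>
     (\<forall>\<phi>. test_function \<phi> \<longrightarrow> (\<forall>b\<in>Basis.
        (\<integral>x. u x * pderiv_dir b \<phi> x \<partial>lborel) = - (\<integral>x. (g x \<bullet> b) * \<phi> x \<partial>lborel)))"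

definition weak_laplacian :: "('a::euclidean_space \<Rightarrow> real) \<Rightarrow> ('a \<Rightarrow> real) \<Rightarrow> bool" where
  "weak_laplacian u w \<longleftrightarrow> loc_integrable u \<and> loc_integrable w \<and>
     (\<forall>\<phi>. test_function \<phi> \<longrightarrow>
        (\<integral>x. u x * laplacian \<phi> x \<partial>lborel) = (\<integral>x. w x * \<phi> x \<partial>lborel))"

lemma test_function_sum:
  assumes "finite I" "\<And>i. i \<in> I \<Longrightarrow> test_function (\<phi> i)"
  shows "test_function (\<lambda>x. \<Sum>i\<in>I. \<phi> i x)"
  using assms
proof (induction I rule: finite_induct)
  case empty
  have "smooth (\<lambda>x. 0)" by (simp add: smooth_def C_k_const)
  then show ?case by (simp add: test_function_def)
next
  case (insert i I)
  let ?f = "\<lambda>x. \<Sum>i\<in>I. \<phi> i x"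
  obtain B R where R: "\<And>x. norm x > R \<Longrightarrow> \<phi> i x = 0"
    using test_function_bounds[of "\<phi> i"] insert by (metis insertI1)
  obtain B' R' where R': "\<And>x. norm x > R' \<Longrightarrow> ?f x = 0"
    using test_function_bounds[of ?f] insert by (metis insertI2)
  have "test_function (\<lambda>x. \<phi> i x + ?f x)"
  proof (rule test_functionI_support[of _ "cball 0 (max R R')"])
    show "smooth (\<lambda>x. \<phi> i x + ?f x)"
      using insert by (auto simp: smooth_def test_function_def intro: C_k_add)
  qed (use R R' in auto)
  with insert show ?case by simp
qed

lemma test_function_scale:
  assumes "test_function \<phi>"
  shows "test_function (\<lambda>x. c * \<phi> x)"
  using test_function_mult[OF assms, of "\<lambda>_. c"]
  by (simp add: mult.commute smooth_def C_k_const)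

text \<open>This justifies Fubini for the variable \<open>t\<close> along a segment and the space variable. For each \<open>t\<close> the two
  integrands differ by a translation in \<open>x\<close>, and the first has a majorant independent of \<open>t\<close> in \<open>[0, 1]\<close>.\<close>

lemma integrable_segment_product:
  fixes k \<psi> :: "'a::euclidean_space \<Rightarrow> real"
  assumes k: "loc_integrable k" and [measurable]: "\<psi> \<in> borel_measurable borel"
    and B: "\<And>x. \<bar>\<psi> x\<bar> \<le> B" and R: "\<And>x. norm x > R \<Longrightarrow> \<psi> x = 0"
  shows "integrable (lborel \<Otimes>\<^sub>M lborel) (\<lambda>(t::real, x). indicator {0..1} t * (k x * \<psi> (x - t *\<^sub>R h)))" (is ?A)
    and "integrable (lborel \<Otimes>\<^sub>M lborel) (\<lambda>(t::real, x). indicator {0..1} t * (k (x + t *\<^sub>R h) * \<psi> x))" (is ?B)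
proof -
  have [measurable]: "k \<in> borel_measurable borel" using k by (rule loc_integrable_measurable)
  have [measurable]: "cball (0::'a) r \<in> sets borel" for r by simp
  define W where "W x = \<bar>indicator (cball 0 (R + norm h)) x * (\<bar>B\<bar> * k x)\<bar>" for x
  have iW: "integrable lborel W"
  proof -
    have "integrable lborel (\<lambda>x. \<bar>B\<bar> * (indicator (cball 0 (R + norm h)) x * k x))"
      using k by (intro integrable_mult_right) (simp add: loc_integrable_def)
    then show ?thesis unfolding W_def by (intro integrable_abs) (simp add: mult_ac)
  qed
  have [measurable]: "W \<in> borel_measurable borel" unfolding W_def by measurable
  have le: "\<bar>k x * \<psi> (x - t *\<^sub>R h)\<bar> \<le> W x" if "t \<in> {0..1}" for x t
  proof (cases "norm x \<le> R + norm h")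
    case True
    moreover have "\<bar>k x\<bar> * \<bar>\<psi> (x - t *\<^sub>R h)\<bar> \<le> \<bar>k x\<bar> * \<bar>B\<bar>"
      using B[of "x - t *\<^sub>R h"] by (intro mult_left_mono) auto
    ultimately show ?thesis by (simp add: W_def abs_mult mult.commute)
  next
    case False
    have "norm (t *\<^sub>R h) \<le> norm h" using that by (auto intro: mult_left_le_one_le)
    then have "norm (x - t *\<^sub>R h) > R" using False norm_triangle_ineq2[of x "t *\<^sub>R h"] by linarith
    then show ?thesis using R by (simp add: W_def)
  qed
  have fin: "(\<integral>\<^sup>+t. (\<integral>\<^sup>+x. ennreal (norm (indicator {0..1} t * (k x * \<psi> (x - t *\<^sub>R h)))) \<partial>lborel) \<partial>lborel) < \<infinity>"
  proof -
    have "(\<integral>\<^sup>+t. (\<integral>\<^sup>+x. ennreal (norm (indicator {0..1} t * (k x * \<psi> (x - t *\<^sub>R h)))) \<partial>lborel) \<partial>lborel)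
        \<le> (\<integral>\<^sup>+t. indicator {0..1::real} t * (\<integral>\<^sup>+x. ennreal (W x) \<partial>lborel) \<partial>lborel)"
    proof (rule nn_integral_mono)
      fix t :: real
      show "(\<integral>\<^sup>+x. ennreal (norm (indicator {0..1} t * (k x * \<psi> (x - t *\<^sub>R h)))) \<partial>lborel)
          \<le> indicator {0..1} t * (\<integral>\<^sup>+x. ennreal (W x) \<partial>lborel)"
        using le[of t] by (cases "t \<in> {0..1}") (auto intro!: nn_integral_mono ennreal_leI)
    qed
    also have "\<dots> = (\<integral>\<^sup>+x. ennreal (W x) \<partial>lborel)"
      by (simp add: nn_integral_multc)
    also have "\<dots> < \<infinity>" using iW by (subst nn_integral_eq_integral) (auto simp: W_def)
    finally show ?thesis .
  qed
  show ?A
  proof (rule integrableI_bounded)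
    show "(\<lambda>(t::real, x). indicator {0..1} t * (k x * \<psi> (x - t *\<^sub>R h))) \<in> borel_measurable (lborel \<Otimes>\<^sub>M lborel)"
      by measurable
    show "(\<integral>\<^sup>+z. ennreal (norm (case z of (t::real, x) \<Rightarrow> indicator {0..1} t * (k x * \<psi> (x - t *\<^sub>R h)))) \<partial>(lborel \<Otimes>\<^sub>M lborel)) < \<infinity>"
      by (subst lborel.nn_integral_fst[symmetric]) (use fin in auto)
  qed
  show ?B
  proof (rule integrableI_bounded)
    show "(\<lambda>(t::real, x). indicator {0..1} t * (k (x + t *\<^sub>R h) * \<psi> x)) \<in> borel_measurable (lborel \<Otimes>\<^sub>M lborel)"
      by measurable
    have "(\<integral>\<^sup>+x. ennreal (norm (indicator {0..1} t * (k (x + t *\<^sub>R h) * \<psi> x))) \<partial>lborel)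
        = (\<integral>\<^sup>+x. ennreal (norm (indicator {0..1} t * (k x * \<psi> (x - t *\<^sub>R h)))) \<partial>lborel)" for t :: real
      using lborel_nn_integral_translate[of "\<lambda>x. ennreal (norm (indicator {0..1} t * (k x * \<psi> (x - t *\<^sub>R h))))" "t *\<^sub>R h"]
      by simp
    then show "(\<integral>\<^sup>+z. ennreal (norm (case z of (t::real, x) \<Rightarrow> indicator {0..1} t * (k (x + t *\<^sub>R h) * \<psi> x))) \<partial>(lborel \<Otimes>\<^sub>M lborel)) < \<infinity>"
      by (subst lborel.nn_integral_fst[symmetric]) (use fin in auto)
  qed
qed

lemma loc_integrable_translate:
  assumes "loc_integrable u"
  shows "loc_integrable (\<lambda>x. u (x + h))"
proof -
  have [measurable]: "u \<in> borel_measurable borel" using assms by (rule loc_integrable_measurable)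
  have [measurable]: "cball (0::'a) r \<in> sets borel" for r by simp
  have "integrable lborel (\<lambda>x. indicator (cball 0 R) x *\<^sub>R u (x + h))" for R
  proof -
    have "integrable lborel (\<lambda>x. indicator (cball 0 R) (x - h) *\<^sub>R u x)"
    proof (rule Bochner_Integration.integrable_bound)
      show "integrable lborel (\<lambda>x. indicator (cball 0 (R + norm h)) x *\<^sub>R u x)"
        using assms by (simp add: loc_integrable_def)
      have "indicat_real (cball 0 R) (x - h) \<le> indicator (cball 0 (R + norm h)) x" for x
        using norm_triangle_ineq2[of x h] by (auto simp: indicator_def)
      then show "AE x in lborel. norm (indicat_real (cball 0 R) (x - h) *\<^sub>R u x)
          \<le> norm (indicat_real (cball 0 (R + norm h)) x *\<^sub>R u x)"
        by (auto intro!: mult_right_mono)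
    qed measurable
    then show ?thesis
      using lborel_integral_translate(2)[of "\<lambda>x. indicator (cball 0 R) (x - h) *\<^sub>R u x" h] by simp
  qed
  then show ?thesis by (simp add: loc_integrable_def)
qed

text \<open>Tested against \<open>\<phi>\<close>, the difference of \<open>u\<close> is carried over to \<open>\<phi>\<close>, where the fundamental
  theorem of calculus holds classically; the weak gradient brings the derivative back to \<open>u\<close>.\<close>

lemma weak_gradient_segment:
  fixes u :: "'a::euclidean_space \<Rightarrow> real"
  assumes "weak_gradient u g"
  shows "AE x in lborel. u (x + h) - u x = (\<integral>t. indicator {0..1::real} t * (g (x + t *\<^sub>R h) \<bullet> h) \<partial>lborel)"
proof -
  have u: "loc_integrable u" and g: "loc_integrable g"
    and ibp: "\<And>\<phi> b. test_function \<phi> \<Longrightarrow> b \<in> Basis \<Longrightarrow>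
      (\<integral>x. u x * pderiv_dir b \<phi> x \<partial>lborel) = - (\<integral>x. (g x \<bullet> b) * \<phi> x \<partial>lborel)"
    using assms by (auto simp: weak_gradient_def)
  define k where "k x = g x \<bullet> h" for x
  have k: "loc_integrable k" unfolding k_def using g by (rule loc_integrable_inner)
  have [measurable]: "u \<in> borel_measurable borel" "k \<in> borel_measurable borel"
    using u k by (auto dest: loc_integrable_measurable)
  define I where "I x = (\<integral>t. indicator {0..1::real} t * k (x + t *\<^sub>R h) \<partial>lborel)" for x
  have I_mult: "I x * c = (\<integral>t. indicator {0..1::real} t * (k (x + t *\<^sub>R h) * c) \<partial>lborel)" for x c
    by (simp add: I_def flip: mult.assoc)
  have I_int: "integrable lborel (\<lambda>x. I x * \<psi> x)"
    and I_swap: "(\<integral>x. I x * \<psi> x \<partial>lborel) = (\<integral>t. indicator {0..1::real} t * (\<integral>x. k (x + t *\<^sub>R h) * \<psi> x \<partial>lborel) \<partial>lborel)"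
    if [measurable]: "\<psi> \<in> borel_measurable borel"
      and "\<And>x. \<bar>\<psi> x\<bar> \<le> B" "\<And>x. norm x > R \<Longrightarrow> \<psi> x = 0" for \<psi> B R
  proof -
    note P = integrable_segment_product(2)[OF k that, where h=h]
    show "integrable lborel (\<lambda>x. I x * \<psi> x)"
      using lborel_pair.integrable_snd[OF P] by (simp add: I_mult)
    show "(\<integral>x. I x * \<psi> x \<partial>lborel) = (\<integral>t. indicator {0..1::real} t * (\<integral>x. k (x + t *\<^sub>R h) * \<psi> x \<partial>lborel) \<partial>lborel)"
      using lborel_pair.Fubini_integral[OF P] by (simp add: I_mult)
  qed
  have [measurable]: "I \<in> borel_measurable borel" unfolding I_def by measurable
  have I: "loc_integrable I"
    unfolding loc_integrable_def
  proof (intro conjI allI)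
    fix R
    have "integrable lborel (\<lambda>x. I x * indicator (cball 0 R) x)"
      by (rule I_int[where B=1 and R=R]) (auto split: split_indicator intro!: borel_measurable_indicator)
    then show "integrable lborel (\<lambda>x. indicator (cball 0 R) x *\<^sub>R I x)"
      by (simp add: mult.commute)
  qed measurable
  have "AE x in lborel. u (x + h) - u x - I x = 0"
  proof (rule fundamental_lemma)
    show "loc_integrable (\<lambda>x. u (x + h) - u x - I x)"
      by (intro loc_integrable_diff loc_integrable_translate u I)
    fix \<phi> :: "'a \<Rightarrow> real" assume \<phi>: "test_function \<phi>"
    note [measurable] = test_function_measurable[OF \<phi>]
    define D where "D x = (\<Sum>b\<in>Basis. (h \<bullet> b) * pderiv_dir b \<phi> x)" for x
    have D: "test_function D" unfolding D_def
      by (intro test_function_sum test_function_scale test_function_pderiv_dir \<phi>) auto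
    note [measurable] = test_function_measurable[OF D]
    obtain B R where BR: "\<And>x. \<bar>\<phi> x\<bar> \<le> B" "\<And>x. norm x > R \<Longrightarrow> \<phi> x = 0"
      using test_function_bounds[OF \<phi>] by metis
    obtain B' R' where BR': "\<And>x. \<bar>D x\<bar> \<le> B'" "\<And>x. norm x > R' \<Longrightarrow> D x = 0"
      using test_function_bounds[OF D] by metis
    have \<phi>h: "test_function (\<lambda>x. \<phi> (x - y))" for y using test_function_translate[OF \<phi>, of "-y"] by simp
    have ftc: "\<phi> (x - h) - \<phi> x = - (\<integral>t. indicator {0..1::real} t * D (x - t *\<^sub>R h) \<partial>lborel)" for x
    proof -
      have "((\<lambda>t. \<phi> (x - t *\<^sub>R h)) has_vector_derivative - D (x - t *\<^sub>R h)) (at t within {0..1})" for t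
      proof -
        have "(\<phi> \<circ> (\<lambda>t. x - t *\<^sub>R h) has_derivative
            (\<lambda>v. \<Sum>b\<in>Basis. (v \<bullet> b) * pderiv_dir b \<phi> (x - t *\<^sub>R h)) \<circ> (\<lambda>s. - (s *\<^sub>R h))) (at t)"
          by (intro diff_chain_at smooth_has_derivative[OF test_function_smooth[OF \<phi>]])
             (auto intro!: derivative_eq_intros)
        then have "((\<lambda>t. \<phi> (x - t *\<^sub>R h)) has_derivative (\<lambda>s. s *\<^sub>R - D (x - t *\<^sub>R h))) (at t)"
          by (simp add: o_def D_def sum_distrib_left sum_negf mult.assoc)
        then show ?thesis
          unfolding has_vector_derivative_def by (rule has_derivative_at_withinI)
      qed
      moreover have "continuous_on {0..1} (\<lambda>t. - D (x - t *\<^sub>R h))"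
        by (intro continuous_intros continuous_on_compose2[OF smooth_continuous[OF test_function_smooth[OF D], of UNIV]]) auto
      ultimately have "(\<integral>t. indicator {0..1} t *\<^sub>R - D (x - t *\<^sub>R h) \<partial>lborel)
          = \<phi> (x - 1 *\<^sub>R h) - \<phi> (x - 0 *\<^sub>R h)"
        by (intro integral_FTC_atLeastAtMost) auto
      then show ?thesis by simp
    qed
    have ibp_h: "(\<integral>x. u x * D (x - y) \<partial>lborel) = - (\<integral>x. k x * \<phi> (x - y) \<partial>lborel)" for y
    proof -
      have p: "pderiv_dir b (\<lambda>x. \<phi> (x - y)) = (\<lambda>x. pderiv_dir b \<phi> (x - y))" for b
        using pderiv_dir_translate(1)[OF smooth_differentiable[OF test_function_smooth[OF \<phi>]], of b "-y"] by simp
      have "(\<integral>x. u x * D (x - y) \<partial>lborel)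
          = (\<integral>x. (\<Sum>b\<in>Basis. (h \<bullet> b) * (u x * pderiv_dir b (\<lambda>x. \<phi> (x - y)) x)) \<partial>lborel)"
        by (simp add: D_def p sum_distrib_left mult_ac)
      also have "\<dots> = (\<Sum>b\<in>Basis. (h \<bullet> b) * (\<integral>x. u x * pderiv_dir b (\<lambda>x. \<phi> (x - y)) x \<partial>lborel))"
        by (subst Bochner_Integration.integral_sum)
           (auto intro!: integrable_mult_right integrable_times_test u test_function_pderiv_dir \<phi>h)
      also have "\<dots> = - (\<Sum>b\<in>Basis. (h \<bullet> b) * (\<integral>x. (g x \<bullet> b) * \<phi> (x - y) \<partial>lborel))"
        by (simp add: ibp[OF \<phi>h] sum_negf)
      also have "(\<Sum>b\<in>Basis. (h \<bullet> b) * (\<integral>x. (g x \<bullet> b) * \<phi> (x - y) \<partial>lborel))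
          = (\<integral>x. (\<Sum>b\<in>Basis. (h \<bullet> b) * ((g x \<bullet> b) * \<phi> (x - y))) \<partial>lborel)"
        by (subst Bochner_Integration.integral_sum)
           (auto intro!: integrable_mult_right integrable_times_test loc_integrable_inner g \<phi>h)
      also have "(\<lambda>x. \<Sum>b\<in>Basis. (h \<bullet> b) * ((g x \<bullet> b) * \<phi> (x - y))) = (\<lambda>x. k x * \<phi> (x - y))"
        by (auto simp: fun_eq_iff k_def euclidean_inner[of "g _" h] sum_distrib_left mult_ac)
      finally show ?thesis .
    qed
    have shift: "(\<integral>x. v (x + y) * \<phi> x \<partial>lborel) = (\<integral>x. v x * \<phi> (x - y) \<partial>lborel)"
      if [measurable]: "v \<in> borel_measurable borel" for v y
      using lborel_integral_translate(1)[of "\<lambda>x. v x * \<phi> (x - y)" y] by simp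
    note P = integrable_segment_product(1)[OF u test_function_measurable[OF D] BR', where h=h]
    have "(\<integral>x. (u (x + h) - u x) * \<phi> x \<partial>lborel) = (\<integral>x. u x * (\<phi> (x - h) - \<phi> x) \<partial>lborel)"
      using shift[of u h] integrable_times_test[OF u \<phi>] integrable_times_test[OF u \<phi>h[of h]]
        integrable_times_test[OF loc_integrable_translate[OF u] \<phi>, of h]
      by (simp add: left_diff_distrib right_diff_distrib)
    also have "\<dots> = - (\<integral>x. (\<integral>t. indicator {0..1::real} t * (u x * D (x - t *\<^sub>R h)) \<partial>lborel) \<partial>lborel)"
      by (simp add: ftc mult.left_commute[of "indicator _ _"])
    also have "\<dots> = - (\<integral>t. indicator {0..1::real} t * (\<integral>x. u x * D (x - t *\<^sub>R h) \<partial>lborel) \<partial>lborel)"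
      using lborel_pair.Fubini_integral[OF P] by simp
    also have "\<dots> = (\<integral>t. indicator {0..1::real} t * (\<integral>x. k x * \<phi> (x - t *\<^sub>R h) \<partial>lborel) \<partial>lborel)"
      by (simp add: ibp_h)
    also have "\<dots> = (\<integral>x. I x * \<phi> x \<partial>lborel)"
      by (simp add: I_swap[OF test_function_measurable[OF \<phi>] BR] shift)
    finally have "(\<integral>x. (u (x + h) - u x) * \<phi> x \<partial>lborel) = (\<integral>x. I x * \<phi> x \<partial>lborel)" .
    moreover have "integrable lborel (\<lambda>x. (u (x + h) - u x) * \<phi> x)" "integrable lborel (\<lambda>x. I x * \<phi> x)"
      by (intro integrable_times_test loc_integrable_diff loc_integrable_translate u I \<phi>)+
    ultimately show "(\<integral>x. (u (x + h) - u x - I x) * \<phi> x \<partial>lborel) = 0"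
      by (simp add: left_diff_distrib[of "_ - _"])
  qed
  then show ?thesis by (simp add: I_def k_def)
qed

text \<open>By Jensen the \<open>p\<close>-th power of the average of \<open>g \<bullet> h\<close> along the segment is at most the average of the
  powers, and each translate of \<open>g\<close> has the same integral.\<close>

lemma translation_estimate:
  fixes u :: "'a::euclidean_space \<Rightarrow> real"
  assumes wg: "weak_gradient u g" and p: "p > 1"
  shows "(\<integral>\<^sup>+x. ennreal (\<bar>u (x + h) - u x\<bar> powr p) \<partial>lborel)
    \<le> ennreal (norm h powr p) * (\<integral>\<^sup>+x. ennreal (norm (g x) powr p) \<partial>lborel)"
proof -
  have [measurable]: "g \<in> borel_measurable borel"
    using wg by (auto simp: weak_gradient_def dest: loc_integrable_measurable)
  have "(\<integral>\<^sup>+x. ennreal (\<bar>u (x + h) - u x\<bar> powr p) \<partial>lborel)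
      \<le> (\<integral>\<^sup>+x. (\<integral>\<^sup>+t. indicator {0..1::real} t * ennreal (\<bar>g (x + t *\<^sub>R h) \<bullet> h\<bar> powr p) \<partial>lborel) \<partial>lborel)"
  proof (rule nn_integral_mono_AE)
    show "AE x in lborel. ennreal (\<bar>u (x + h) - u x\<bar> powr p)
        \<le> (\<integral>\<^sup>+t. indicator {0..1::real} t * ennreal (\<bar>g (x + t *\<^sub>R h) \<bullet> h\<bar> powr p) \<partial>lborel)"
      using weak_gradient_segment[OF wg, of h]
    proof (rule AE_mp, intro AE_I2 impI)
      fix x assume "u (x + h) - u x = (\<integral>t. indicator {0..1::real} t * (g (x + t *\<^sub>R h) \<bullet> h) \<partial>lborel)"
      then show "ennreal (\<bar>u (x + h) - u x\<bar> powr p)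
          \<le> (\<integral>\<^sup>+t. indicator {0..1::real} t * ennreal (\<bar>g (x + t *\<^sub>R h) \<bullet> h\<bar> powr p) \<partial>lborel)"
        using Jensen_powr[OF p, of "\<lambda>t. g (x + t *\<^sub>R h) \<bullet> h" lborel "{0..1}" 1] by simp
    qed
  qed
  also have "\<dots> = (\<integral>\<^sup>+t. (\<integral>\<^sup>+x. indicator {0..1::real} t * ennreal (\<bar>g (x + t *\<^sub>R h) \<bullet> h\<bar> powr p) \<partial>lborel) \<partial>lborel)"
    by (rule lborel_pair.Fubini'[symmetric]) measurable
  also have "\<dots> = (\<integral>\<^sup>+t. indicator {0..1::real} t * (\<integral>\<^sup>+x. ennreal (\<bar>g x \<bullet> h\<bar> powr p) \<partial>lborel) \<partial>lborel)"
    by (simp add: nn_integral_cmult lborel_nn_integral_translate[of "\<lambda>x. ennreal (\<bar>g x \<bullet> h\<bar> powr p)"])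
  also have "\<dots> = (\<integral>\<^sup>+x. ennreal (\<bar>g x \<bullet> h\<bar> powr p) \<partial>lborel)"
    by (simp add: nn_integral_multc)
  also have "\<dots> \<le> (\<integral>\<^sup>+x. ennreal (norm h powr p) * ennreal (norm (g x) powr p) \<partial>lborel)"
  proof (rule nn_integral_mono)
    fix x
    have "\<bar>g x \<bullet> h\<bar> powr p \<le> (norm (g x) * norm h) powr p"
      using p by (intro powr_mono2 Cauchy_Schwarz_ineq2) auto
    then show "ennreal (\<bar>g x \<bullet> h\<bar> powr p) \<le> ennreal (norm h powr p) * ennreal (norm (g x) powr p)"
      by (simp add: powr_mult mult.commute flip: ennreal_mult)
  qed
  also have "\<dots> = ennreal (norm h powr p) * (\<integral>\<^sup>+x. ennreal (norm (g x) powr p) \<partial>lborel)"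
    by (simp add: nn_integral_cmult)
  finally show ?thesis .
qed

section \<open>A Poincare inequality relative to a set of finite measure\<close>

text \<open>The mass of \<open>u\<close> on a set of finite measure is compared with the mass on the translates of that
  set by the vectors of a much larger ball; on average only half of the total mass can be seen there,
  and the difference is paid for by the gradient.\<close>

lemma Poincare_finite_measure:
  fixes A :: "'a::euclidean_space set"
  assumes A[measurable]: "A \<in> sets borel" and fin: "emeasure lborel A < \<infinity>" and p: "p > 1"
  obtains C where "C > 0" "\<And>u g. weak_gradient u g \<Longrightarrow> integrable lborel (\<lambda>x. \<bar>u x\<bar> powr p) \<Longrightarrow>
    integrable lborel (\<lambda>x. norm (g x) powr p) \<Longrightarrow>
    (\<integral>x. \<bar>u x\<bar> powr p \<partial>lborel)
      \<le> C * ((\<integral>x. norm (g x) powr p \<partial>lborel) + (\<integral>x. indicator (- A) x * \<bar>u x\<bar> powr p \<partial>lborel))"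
proof -
  define mA where "mA = measure lborel A"
  have mA: "emeasure lborel A = ennreal mA" "mA \<ge> 0"
    using fin by (auto simp: mA_def emeasure_eq_ennreal_measure)
  define \<omega> where "\<omega> = unit_ball_vol (real DIM('a))"
  have \<omega>: "\<omega> > 0" unfolding \<omega>_def by simp
  \<comment> \<open>The ball is so large that \<open>2 \<cdot> 2\<^sup>p\<close> times the measure of \<open>A\<close> is at most its volume.\<close>
  define R where "R = 1 + 2 * 2 powr p * mA / \<omega>"
  have R: "R \<ge> 1" using mA \<omega> by (simp add: R_def)
  define m where "m = \<omega> * R ^ DIM('a)"
  define B where "B = ball (0::'a) R"
  have [measurable]: "B \<in> sets borel" by (simp add: B_def)
  have mB: "emeasure lborel B = ennreal m"
    unfolding B_def m_def \<omega>_def using R by (intro emeasure_ball) auto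
  have "R \<le> R ^ DIM('a)" using R self_le_power[of R "DIM('a)"] by simp
  then have "m \<ge> \<omega> * R" unfolding m_def using \<omega> by simp
  moreover have "\<omega> * R = \<omega> + 2 * 2 powr p * mA" using \<omega> by (simp add: R_def distrib_left)
  moreover have "0 \<le> 2 * 2 powr p * mA" using mA by simp
  ultimately have m: "m \<ge> 2 * 2 powr p * mA" "m > 0" using \<omega> by linarith+
  show thesis
  proof (rule that)
    show "2 + 2 * 2 powr p * R powr p > 0" by (simp add: add_pos_nonneg)
    fix u :: "'a \<Rightarrow> real" and g
    assume wg: "weak_gradient u g" and iu: "integrable lborel (\<lambda>x. \<bar>u x\<bar> powr p)"
      and ig: "integrable lborel (\<lambda>x. norm (g x) powr p)"
    have [measurable]: "u \<in> borel_measurable borel" "g \<in> borel_measurable borel"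
      using wg by (auto simp: weak_gradient_def dest: loc_integrable_measurable)
    let ?U = "\<integral>x. \<bar>u x\<bar> powr p \<partial>lborel" and ?G = "\<integral>x. norm (g x) powr p \<partial>lborel"
    let ?UA = "\<integral>x. indicator A x * \<bar>u x\<bar> powr p \<partial>lborel"
    have iA: "integrable lborel (\<lambda>x. indicator A x * \<bar>u x\<bar> powr p)"
      and iAc: "integrable lborel (\<lambda>x. indicator (- A) x * \<bar>u x\<bar> powr p)"
      using integrable_mult_indicator[OF _ iu, of A] integrable_mult_indicator[OF _ iu, of "- A"] by auto
    have U: "(\<integral>\<^sup>+x. ennreal (\<bar>u x\<bar> powr p) \<partial>lborel) = ennreal ?U"
      by (rule nn_integral_eq_integral[OF iu]) auto
    have G: "(\<integral>\<^sup>+x. ennreal (norm (g x) powr p) \<partial>lborel) = ennreal ?G"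
      by (rule nn_integral_eq_integral[OF ig]) auto
    have UA: "(\<integral>\<^sup>+x. ennreal (indicator A x * \<bar>u x\<bar> powr p) \<partial>lborel) = ennreal ?UA"
      by (rule nn_integral_eq_integral[OF iA]) auto
    have nn: "?U \<ge> 0" "?G \<ge> 0" "?UA \<ge> 0" by (auto intro!: Bochner_Integration.integral_nonneg)
    have "ennreal (m * ?UA) = ennreal m * (\<integral>\<^sup>+x. ennreal (indicator A x * \<bar>u x\<bar> powr p) \<partial>lborel)"
      using m nn by (subst UA) (simp add: ennreal_mult)
    also have "\<dots> = (\<integral>\<^sup>+x. ennreal m * ennreal (indicator A x * \<bar>u x\<bar> powr p) \<partial>lborel)"
      by (rule nn_integral_cmult[symmetric]) measurable
    also have "\<dots> = (\<integral>\<^sup>+x. (\<integral>\<^sup>+y. indicator B y * ennreal (indicator A x * \<bar>u x\<bar> powr p) \<partial>lborel) \<partial>lborel)"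
      by (intro nn_integral_cong, subst nn_integral_multc) (simp_all add: mB)
    also have "\<dots> \<le> (\<integral>\<^sup>+x. (\<integral>\<^sup>+y. ennreal (2 powr p) * (indicator A x * ennreal (\<bar>u (x + y)\<bar> powr p)
        + indicator B y * ennreal (\<bar>u (x + y) - u x\<bar> powr p)) \<partial>lborel) \<partial>lborel)"
    proof (intro nn_integral_mono)
      fix x y
      have "\<bar>u x\<bar> powr p \<le> 2 powr p * (\<bar>u (x + y)\<bar> powr p + \<bar>u (x + y) - u x\<bar> powr p)"
        using norm_diff_powr_le[of p "u (x + y)" "u (x + y) - u x"] p by simp
      then have "ennreal (\<bar>u x\<bar> powr p)
          \<le> ennreal (2 powr p) * (ennreal (\<bar>u (x + y)\<bar> powr p) + ennreal (\<bar>u (x + y) - u x\<bar> powr p))"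
        by (simp flip: ennreal_plus ennreal_mult)
      then show "indicator B y * ennreal (indicator A x * \<bar>u x\<bar> powr p)
          \<le> ennreal (2 powr p) * (indicator A x * ennreal (\<bar>u (x + y)\<bar> powr p)
            + indicator B y * ennreal (\<bar>u (x + y) - u x\<bar> powr p))"
        by (auto simp: indicator_def)
    qed
    also have "\<dots> = ennreal (2 powr p) * ((\<integral>\<^sup>+x. (\<integral>\<^sup>+y. indicator A x * ennreal (\<bar>u (x + y)\<bar> powr p) \<partial>lborel) \<partial>lborel)
        + (\<integral>\<^sup>+x. (\<integral>\<^sup>+y. indicator B y * ennreal (\<bar>u (x + y) - u x\<bar> powr p) \<partial>lborel) \<partial>lborel))"
      by (simp add: nn_integral_cmult nn_integral_add)
    also have "(\<integral>\<^sup>+x. (\<integral>\<^sup>+y. indicator A x * ennreal (\<bar>u (x + y)\<bar> powr p) \<partial>lborel) \<partial>lborel) = ennreal (mA * ?U)"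
    proof -
      have "(\<integral>\<^sup>+y. ennreal (\<bar>u (x + y)\<bar> powr p) \<partial>lborel) = ennreal ?U" for x
        using lborel_nn_integral_translate[of "\<lambda>y. ennreal (\<bar>u y\<bar> powr p)" x] U by (simp add: add.commute)
      then show ?thesis using mA nn by (simp add: nn_integral_cmult nn_integral_multc ennreal_mult)
    qed
    also have "(\<integral>\<^sup>+x. (\<integral>\<^sup>+y. indicator B y * ennreal (\<bar>u (x + y) - u x\<bar> powr p) \<partial>lborel) \<partial>lborel)
        = (\<integral>\<^sup>+y. (\<integral>\<^sup>+x. indicator B y * ennreal (\<bar>u (x + y) - u x\<bar> powr p) \<partial>lborel) \<partial>lborel)"
      by (rule lborel_pair.Fubini'[symmetric]) measurable
    also have "\<dots> \<le> (\<integral>\<^sup>+y. indicator B y * ennreal (R powr p * ?G) \<partial>lborel)"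
    proof (rule nn_integral_mono)
      fix y
      show "(\<integral>\<^sup>+x. indicator B y * ennreal (\<bar>u (x + y) - u x\<bar> powr p) \<partial>lborel)
          \<le> indicator B y * ennreal (R powr p * ?G)"
      proof (cases "y \<in> B")
        case True
        then have "norm y powr p \<le> R powr p" using p by (intro powr_mono2) (auto simp: B_def)
        then have "norm y powr p * ?G \<le> R powr p * ?G" using nn by (intro mult_right_mono) auto
        then have "ennreal (norm y powr p) * ennreal ?G \<le> ennreal (R powr p * ?G)"
          using nn by (simp flip: ennreal_mult)
        then show ?thesis
          using order_trans[OF translation_estimate[OF wg p, of y, unfolded G]] True by simp
      qed simp
    qed
    also have "\<dots> = ennreal (m * (R powr p * ?G))"
      using m nn by (simp add: nn_integral_multc mB ennreal_mult)
    finally have "ennreal (m * ?UA) \<le> ennreal (2 powr p) * (ennreal (mA * ?U) + ennreal (m * (R powr p * ?G)))"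
      by (simp add: mult_left_mono add_left_mono)
    then have "m * ?UA \<le> 2 powr p * (mA * ?U + m * (R powr p * ?G))"
      using nn mA m by (simp flip: ennreal_plus ennreal_mult)
    moreover have "2 powr p * (mA * ?U) \<le> m / 2 * ?U"
      using mult_right_mono[OF m(1) nn(1)] by simp
    ultimately have "m * ?UA \<le> m * (?U / 2 + 2 powr p * R powr p * ?G)"
      by (simp add: algebra_simps)
    then have "?UA \<le> ?U / 2 + 2 powr p * R powr p * ?G" using m by simp
    moreover have "?U = ?UA + (\<integral>x. indicator (- A) x * \<bar>u x\<bar> powr p \<partial>lborel)"
      by (subst Bochner_Integration.integral_add[OF iA iAc, symmetric])
         (auto intro!: Bochner_Integration.integral_cong simp: indicator_def)
    ultimately have "?U \<le> 2 * (2 powr p * R powr p * ?G) + 2 * (\<integral>x. indicator (- A) x * \<bar>u x\<bar> powr p \<partial>lborel)"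
      by linarith
    also have "\<dots> \<le> (2 + 2 * 2 powr p * R powr p) * (?G + (\<integral>x. indicator (- A) x * \<bar>u x\<bar> powr p \<partial>lborel))"
    proof -
      have "(\<integral>x. indicator (- A) x * \<bar>u x\<bar> powr p \<partial>lborel) \<ge> 0"
        by (auto intro!: Bochner_Integration.integral_nonneg)
      then show ?thesis using nn by (simp add: algebra_simps)
    qed
    finally show "?U \<le> (2 + 2 * 2 powr p * R powr p) * (?G + (\<integral>x. indicator (- A) x * \<bar>u x\<bar> powr p \<partial>lborel))" .
  qed
qed

section \<open>Local compactness\<close>

definition ball_average :: "real \<Rightarrow> ('a::euclidean_space \<Rightarrow> real) \<Rightarrow> 'a \<Rightarrow> real" where
  "ball_average \<delta> v x = (\<integral>y. indicator (ball 0 \<delta>) y * v (x + y) \<partial>lborel) / measure lborel (ball (0::'a) \<delta>)"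

lemma ball_measure_pos: "\<delta> > 0 \<Longrightarrow> measure lborel (ball (0::'a::euclidean_space) \<delta>) > 0"
  using content_ball_pos[of \<delta> "0::'a"] by simp

lemma ball_Jensen:
  fixes f :: "'a::euclidean_space \<Rightarrow> real"
  assumes p: "p > 1" and \<delta>: "\<delta> > 0" and f: "f \<in> borel_measurable borel"
  defines "m \<equiv> measure lborel (ball (0::'a) \<delta>)"
  shows "ennreal (\<bar>(\<integral>y. indicator (ball 0 \<delta>) y * f y \<partial>lborel) / m\<bar> powr p)
    \<le> ennreal (1 / m) * (\<integral>\<^sup>+y. indicator (ball 0 \<delta>) y * ennreal (\<bar>f y\<bar> powr p) \<partial>lborel)"
proof -
  have m: "m > 0" unfolding m_def by (rule ball_measure_pos[OF \<delta>])
  have e: "emeasure lborel (ball (0::'a) \<delta>) = ennreal m"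
    unfolding m_def by (rule emeasure_eq_ennreal_measure) (use emeasure_lborel_ball_finite[of "0::'a" \<delta>] in auto)
  let ?I = "\<integral>y. indicator (ball 0 \<delta>) y * f y \<partial>lborel"
  have "ennreal (\<bar>?I / m\<bar> powr p) = ennreal (m powr (-p)) * ennreal (\<bar>?I\<bar> powr p)"
    using m by (simp add: abs_divide powr_divide powr_minus_divide flip: ennreal_mult)
  also have "\<dots> \<le> ennreal (m powr (-p)) * (ennreal (m powr (p - 1)) *
      (\<integral>\<^sup>+y. indicator (ball 0 \<delta>) y * ennreal (\<bar>f y\<bar> powr p) \<partial>lborel))"
    using Jensen_powr[OF p, of f lborel "ball 0 \<delta>" m] e m f by (intro mult_left_mono) auto
  also have "\<dots> = ennreal (m powr (-p) * m powr (p - 1)) *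
      (\<integral>\<^sup>+y. indicator (ball 0 \<delta>) y * ennreal (\<bar>f y\<bar> powr p) \<partial>lborel)"
    by (simp add: ennreal_mult mult.assoc)
  also have "m powr (-p) * m powr (p - 1) = 1 / m"
    using m by (simp add: powr_minus_divide powr_diff)
  finally show ?thesis .
qed

lemma loc_integrable_ball:
  fixes v :: "'a::euclidean_space \<Rightarrow> real"
  assumes "loc_integrable v"
  shows "integrable lborel (\<lambda>y. indicator (ball 0 \<delta>) y * v (x + y))"
proof -
  have "integrable lborel (\<lambda>y. v (y + x) * indicator (ball 0 \<delta>) y)"
    by (rule integrable_bounded_support[where B=1 and R=\<delta>, OF loc_integrable_translate[OF assms]])
       (auto split: split_indicator intro!: borel_measurable_indicator)
  then show ?thesis by (simp add: mult.commute add.commute)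
qed

lemma ball_average_measurable:
  fixes v :: "'a::euclidean_space \<Rightarrow> real"
  assumes [measurable]: "v \<in> borel_measurable borel"
  shows "ball_average \<delta> v \<in> borel_measurable borel"
proof -
  have [measurable]: "ball (0::'a) \<delta> \<in> sets borel" by simp
  show ?thesis unfolding ball_average_def[abs_def] by measurable
qed

text \<open>The error at \<open>x\<close> is the average over the ball of the differences \<open>v (x + y) - v x\<close>, each of which is
  controlled by the gradient.\<close>

lemma ball_average_error:
  fixes v :: "'a::euclidean_space \<Rightarrow> real"
  assumes wg: "weak_gradient v g" and p: "p > 1" and \<delta>: "\<delta> > 0"
  shows "(\<integral>\<^sup>+x. ennreal (\<bar>v x - ball_average \<delta> v x\<bar> powr p) \<partial>lborel)
    \<le> ennreal (\<delta> powr p) * (\<integral>\<^sup>+x. ennreal (norm (g x) powr p) \<partial>lborel)"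
proof -
  have v: "loc_integrable v" using wg by (simp add: weak_gradient_def)
  have [measurable]: "v \<in> borel_measurable borel" using v by (rule loc_integrable_measurable)
  define B where "B = ball (0::'a) \<delta>"
  have [measurable]: "B \<in> sets borel" by (simp add: B_def)
  define m where "m = measure lborel B"
  have m: "m > 0" unfolding m_def B_def by (rule ball_measure_pos[OF \<delta>])
  have e: "emeasure lborel B = ennreal m"
    unfolding m_def B_def by (rule emeasure_eq_ennreal_measure) (use emeasure_lborel_ball_finite[of "0::'a" \<delta>] in auto)
  let ?G = "\<integral>\<^sup>+x. ennreal (norm (g x) powr p) \<partial>lborel"
  have "(\<integral>\<^sup>+x. ennreal (\<bar>v x - ball_average \<delta> v x\<bar> powr p) \<partial>lborel)
      \<le> (\<integral>\<^sup>+x. ennreal (1 / m) * (\<integral>\<^sup>+y. indicator B y * ennreal (\<bar>v (x + y) - v x\<bar> powr p) \<partial>lborel) \<partial>lborel)"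
  proof (rule nn_integral_mono)
    fix x
    have "integrable lborel (\<lambda>y. indicator B y * v x)" using e m
      by (intro integrable_mult_left) (simp add: integrable_indicator_iff)
    then have "(\<integral>y. indicator B y * (v (x + y) - v x) \<partial>lborel)
        = (\<integral>y. indicator B y * v (x + y) \<partial>lborel) - m * v x"
      using loc_integrable_ball[OF v, of \<delta> x] by (simp add: right_diff_distrib m_def B_def)
    then have "\<bar>v x - ball_average \<delta> v x\<bar> = \<bar>(\<integral>y. indicator B y * (v (x + y) - v x) \<partial>lborel) / m\<bar>"
      using m by (simp add: ball_average_def m_def B_def diff_divide_distrib abs_minus_commute)
    then show "ennreal (\<bar>v x - ball_average \<delta> v x\<bar> powr p)
        \<le> ennreal (1 / m) * (\<integral>\<^sup>+y. indicator B y * ennreal (\<bar>v (x + y) - v x\<bar> powr p) \<partial>lborel)"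
      using ball_Jensen[OF p \<delta>, of "\<lambda>y. v (x + y) - v x"] by (simp add: B_def m_def)
  qed
  also have "\<dots> = ennreal (1 / m) * (\<integral>\<^sup>+x. (\<integral>\<^sup>+y. indicator B y * ennreal (\<bar>v (x + y) - v x\<bar> powr p) \<partial>lborel) \<partial>lborel)"
    by (rule nn_integral_cmult) measurable
  also have "(\<integral>\<^sup>+x. (\<integral>\<^sup>+y. indicator B y * ennreal (\<bar>v (x + y) - v x\<bar> powr p) \<partial>lborel) \<partial>lborel)
      = (\<integral>\<^sup>+y. (\<integral>\<^sup>+x. indicator B y * ennreal (\<bar>v (x + y) - v x\<bar> powr p) \<partial>lborel) \<partial>lborel)"
    by (rule lborel_pair.Fubini'[symmetric]) measurable
  also have "\<dots> \<le> (\<integral>\<^sup>+y. indicator B y * (ennreal (\<delta> powr p) * ?G) \<partial>lborel)"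
  proof (rule nn_integral_mono)
    fix y
    show "(\<integral>\<^sup>+x. indicator B y * ennreal (\<bar>v (x + y) - v x\<bar> powr p) \<partial>lborel) \<le> indicator B y * (ennreal (\<delta> powr p) * ?G)"
    proof (cases "y \<in> B")
      case True
      then have "norm y powr p \<le> \<delta> powr p" using p by (intro powr_mono2) (auto simp: B_def)
      then have "ennreal (norm y powr p) * ?G \<le> ennreal (\<delta> powr p) * ?G"
        by (intro mult_right_mono ennreal_leI) auto
      then show ?thesis
        using translation_estimate[OF wg p, of y] True by (auto intro: order_trans)
    qed simp
  qed
  also have "\<dots> = ennreal m * (ennreal (\<delta> powr p) * ?G)"
    by (simp add: nn_integral_multc e)
  finally have "(\<integral>\<^sup>+x. ennreal (\<bar>v x - ball_average \<delta> v x\<bar> powr p) \<partial>lborel)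
      \<le> ennreal (1 / m) * (ennreal m * (ennreal (\<delta> powr p) * ?G))"
    by (simp add: mult_left_mono)
  also have "\<dots> = ennreal (1 / m * m) * (ennreal (\<delta> powr p) * ?G)"
    using m by (subst ennreal_mult) (auto simp: mult.assoc)
  finally show ?thesis using m by simp
qed

lemma ball_average_bound:
  fixes v :: "'a::euclidean_space \<Rightarrow> real"
  assumes [measurable]: "v \<in> borel_measurable borel" and p: "p > 1" and \<delta>: "\<delta> > 0" and M: "M \<ge> 0"
    and le: "(\<integral>\<^sup>+x. ennreal (\<bar>v x\<bar> powr p) \<partial>lborel) \<le> ennreal M"
  shows "\<bar>ball_average \<delta> v x\<bar> powr p \<le> M / measure lborel (ball (0::'a) \<delta>)"
proof -
  let ?m = "measure lborel (ball (0::'a) \<delta>)"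
  have m: "?m > 0" by (rule ball_measure_pos[OF \<delta>])
  have "ennreal (\<bar>ball_average \<delta> v x\<bar> powr p)
      \<le> ennreal (1 / ?m) * (\<integral>\<^sup>+y. indicator (ball 0 \<delta>) y * ennreal (\<bar>v (x + y)\<bar> powr p) \<partial>lborel)"
    using ball_Jensen[OF p \<delta>, of "\<lambda>y. v (x + y)"] by (simp add: ball_average_def)
  also have "\<dots> \<le> ennreal (1 / ?m) * (\<integral>\<^sup>+y. ennreal (\<bar>v (y + x)\<bar> powr p) \<partial>lborel)"
    by (intro mult_left_mono nn_integral_mono) (auto simp: indicator_def add.commute)
  also have "\<dots> \<le> ennreal (1 / ?m) * ennreal M"
    using le by (subst lborel_nn_integral_translate[of "\<lambda>y. ennreal (\<bar>v y\<bar> powr p)"]) (auto intro: mult_left_mono)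
  finally show ?thesis using m M by (simp flip: ennreal_mult)
qed

text \<open>The average at \<open>x'\<close> is the average at \<open>x\<close> of a translate, so the bound on translates applies once more.\<close>

lemma ball_average_equicontinuous:
  fixes v :: "'a::euclidean_space \<Rightarrow> real"
  assumes wg: "weak_gradient v g" and p: "p > 1" and \<delta>: "\<delta> > 0" and M: "M \<ge> 0"
    and le: "(\<integral>\<^sup>+x. ennreal (norm (g x) powr p) \<partial>lborel) \<le> ennreal M"
  shows "\<bar>ball_average \<delta> v x - ball_average \<delta> v x'\<bar> powr p
    \<le> norm (x - x') powr p * (M / measure lborel (ball (0::'a) \<delta>))"
proof -
  have v: "loc_integrable v" using wg by (simp add: weak_gradient_def)
  have [measurable]: "v \<in> borel_measurable borel" using v by (rule loc_integrable_measurable)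
  let ?m = "measure lborel (ball (0::'a) \<delta>)"
  have m: "?m > 0" by (rule ball_measure_pos[OF \<delta>])
  have "ball_average \<delta> v x - ball_average \<delta> v x'
      = (\<integral>y. indicator (ball 0 \<delta>) y * (v (x + y) - v (x' + y)) \<partial>lborel) / ?m"
    using loc_integrable_ball[OF v, of \<delta> x] loc_integrable_ball[OF v, of \<delta> x']
    by (simp add: right_diff_distrib ball_average_def diff_divide_distrib)
  then have "ennreal (\<bar>ball_average \<delta> v x - ball_average \<delta> v x'\<bar> powr p)
      \<le> ennreal (1 / ?m) * (\<integral>\<^sup>+y. indicator (ball 0 \<delta>) y * ennreal (\<bar>v (x + y) - v (x' + y)\<bar> powr p) \<partial>lborel)"
    using ball_Jensen[OF p \<delta>, of "\<lambda>y. v (x + y) - v (x' + y)"] by simp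
  also have "\<dots> \<le> ennreal (1 / ?m) * (\<integral>\<^sup>+y. ennreal (\<bar>v ((y + x') + (x - x')) - v (y + x')\<bar> powr p) \<partial>lborel)"
    by (intro mult_left_mono nn_integral_mono) (auto simp: indicator_def algebra_simps)
  also have "\<dots> = ennreal (1 / ?m) * (\<integral>\<^sup>+y. ennreal (\<bar>v (y + (x - x')) - v y\<bar> powr p) \<partial>lborel)"
    by (subst lborel_nn_integral_translate[of "\<lambda>y. ennreal (\<bar>v (y + (x - x')) - v y\<bar> powr p)"]) auto
  also have "\<dots> \<le> ennreal (1 / ?m) * (ennreal (norm (x - x') powr p) * ennreal M)"
    by (intro mult_left_mono order_trans[OF translation_estimate[OF wg p]] le) auto
  also have "\<dots> = ennreal (norm (x - x') powr p * (M / ?m))"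
    using m M by (simp flip: ennreal_mult)
  finally show ?thesis using m M by simp
qed

text \<open>The ball averages of the sequence are uniformly close to it and
  equicontinuous, so a diagonal subsequence for which they converge on a dense set does it.\<close>

lemma Rellich:
  fixes u :: "nat \<Rightarrow> 'a::euclidean_space \<Rightarrow> real"
  assumes wg: "\<And>n. weak_gradient (u n) (g n)" and p: "p > 1" and M: "M \<ge> 0"
    and uM: "\<And>n. (\<integral>\<^sup>+x. ennreal (\<bar>u n x\<bar> powr p) \<partial>lborel) \<le> ennreal M"
    and gM: "\<And>n. (\<integral>\<^sup>+x. ennreal (norm (g n x) powr p) \<partial>lborel) \<le> ennreal M"
  obtains r :: "nat \<Rightarrow> nat" where "strict_mono r"
    "\<And>R \<epsilon>. \<epsilon> > 0 \<Longrightarrow> \<exists>N. \<forall>i\<ge>N. \<forall>j\<ge>N.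
      (\<integral>\<^sup>+x. indicator (cball 0 R) x * ennreal (\<bar>u (r i) x - u (r j) x\<bar> powr p) \<partial>lborel) \<le> ennreal \<epsilon>"
proof -
  have um[measurable]: "u n \<in> borel_measurable borel" for n
    using wg by (auto simp: weak_gradient_def dest: loc_integrable_measurable)
  define d where "d k = 1 / real (Suc k)" for k
  have d: "d k > 0" for k by (simp add: d_def)
  define m where "m k = measure lborel (ball (0::'a) (d k))" for k
  have m: "m k > 0" for k unfolding m_def by (rule ball_measure_pos[OF d])
  define J where "J k n = ball_average (d k) (u n)" for k n
  have [measurable]: "J k n \<in> borel_measurable borel" for k n
    unfolding J_def by (rule ball_average_measurable) measurable
  \<comment> \<open>A bound for \<open>\<bar>J k n x\<bar>\<close>, as \<open>M / m k\<close> bounds its \<open>p\<close>-th power.\<close>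
  define c where "c k = 1 + M / m k" for k
  have c: "c k \<ge> 1" for k using M m[of k] by (simp add: c_def)
  have Jc: "\<bar>J k n x\<bar> \<le> c k" for k n x
  proof (cases "\<bar>J k n x\<bar> \<le> 1")
    case False
    then have "\<bar>J k n x\<bar> powr 1 \<le> \<bar>J k n x\<bar> powr p" using p by (intro powr_mono) auto
    also have "\<dots> \<le> M / m k"
      unfolding J_def m_def by (rule ball_average_bound[OF um p d M uM])
    finally show ?thesis using False by (simp add: c_def)
  qed (use c[of k] in auto)
  \<comment> \<open>Equicontinuity, with a Lipschitz constant that depends on \<open>k\<close> only.\<close>
  have Jeq: "\<bar>J k n x - J k n x'\<bar> \<le> norm (x - x') * c k powr (1 / p)" for k n x x'
  proof (rule ccontr)
    assume "\<not> ?thesis"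
    then have "(norm (x - x') * c k powr (1 / p)) powr p < \<bar>J k n x - J k n x'\<bar> powr p"
      using p c[of k] by (intro powr_less_mono2) auto
    also have "\<dots> \<le> norm (x - x') powr p * (M / m k)"
      unfolding J_def m_def by (rule ball_average_equicontinuous[OF wg p d M gM])
    also have "\<dots> \<le> norm (x - x') powr p * c k" by (intro mult_left_mono) (auto simp: c_def)
    finally show False using p c[of k] by (simp add: powr_mult powr_powr)
  qed
  obtain D :: "'a set" where D: "countable D" "\<And>X. open X \<Longrightarrow> X \<noteq> {} \<Longrightarrow> \<exists>d\<in>D. d \<in> X"
    using countable_dense_setE by blast
  have "countable (UNIV \<times> D :: (nat \<times> 'a) set)" using D(1) by auto
  then obtain r where r: "strict_mono (r :: nat \<Rightarrow> nat)"
    "\<And>z. z \<in> UNIV \<times> D \<Longrightarrow> \<exists>l. (\<lambda>n. J (fst z) (r n) (snd z) / c (fst z)) \<longlonglongrightarrow> l"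
  proof (rule function_convergent_subsequence[where f="\<lambda>n z. J (fst z) n (snd z) / c (fst z)" and M=1])
    show "norm (J (fst z) n (snd z) / c (fst z)) \<le> 1" for n and z :: "nat \<times> 'a"
      using Jc[of "fst z" n "snd z"] c[of "fst z"] by (simp add: divide_simps)
  qed (rule that)
  have "\<exists>l. (\<lambda>n. J k (r n) x) \<longlonglongrightarrow> l" for k x
  proof -
    have "Cauchy (\<lambda>n. J k (r n) x)"
    proof (rule metric_CauchyI)
      fix e :: real assume e: "e > 0"
      define C where "C = c k powr (1 / p)"
      have C: "C > 0" using c[of k] by (simp add: C_def)
      have "e / (3 * C) > 0" using e C by simp
      then have "ball x (e / (3 * C)) \<noteq> {}" using centre_in_ball by blast
      then obtain x' where x': "x' \<in> D" "x' \<in> ball x (e / (3 * C))" using D(2)[of "ball x (e / (3 * C))"] by blast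
      obtain l where "(\<lambda>n. J k (r n) x' / c k) \<longlonglongrightarrow> l" using r(2)[of "(k, x')"] x'(1) by auto
      then have "(\<lambda>n. J k (r n) x' / c k * c k) \<longlonglongrightarrow> l * c k" by (intro tendsto_intros)
      then have "convergent (\<lambda>n. J k (r n) x')" using c[of k] by (auto simp: convergent_def)
      then have "Cauchy (\<lambda>n. J k (r n) x')" by (rule convergent_Cauchy)
      then obtain N where N: "\<And>i j. i \<ge> N \<Longrightarrow> j \<ge> N \<Longrightarrow> dist (J k (r i) x') (J k (r j) x') < e / 3"
        using metric_CauchyD[of _ "e / 3"] e by (metis divide_pos_pos zero_less_numeral)
      have close: "\<bar>J k n x - J k n x'\<bar> < e / 3" for n
      proof -
        have "norm (x - x') * C < e / (3 * C) * C"
          using x'(2) C by (intro mult_strict_right_mono) (auto simp: dist_norm)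
        then show ?thesis using Jeq[of k n x x'] C by (simp add: C_def)
      qed
      have "dist (J k (r i) x) (J k (r j) x) < e" if "i \<ge> N" "j \<ge> N" for i j
        using close[of "r i"] close[of "r j"] N[OF that] unfolding dist_real_def by linarith
      then show "\<exists>N. \<forall>i\<ge>N. \<forall>j\<ge>N. dist (J k (r i) x) (J k (r j) x) < e" by blast
    qed
    then show ?thesis using Cauchy_convergent convergent_def by blast
  qed
  then obtain l where l: "\<And>k x. (\<lambda>n. J k (r n) x) \<longlonglongrightarrow> l k x" by metis
  have [measurable]: "l k \<in> borel_measurable borel" for k
    by (rule borel_measurable_LIMSEQ_real[OF l]) simp
  have lc: "\<bar>l k x\<bar> \<le> c k" for k x
    by (rule LIMSEQ_le_const2[OF tendsto_rabs[OF l]]) (use Jc in auto)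
  show thesis
  proof (rule that[OF r(1)])
    fix R \<epsilon> :: real assume \<epsilon>: "\<epsilon> > 0"
    let ?I = "indicator (cball (0::'a) R) :: 'a \<Rightarrow> real"
    have [measurable]: "cball (0::'a) R \<in> sets borel" by simp
    have "(\<lambda>k. 4 powr p * (2 * (d k powr p * M))) \<longlonglongrightarrow> 4 powr p * (2 * (0 powr p * M))"
      unfolding d_def using p LIMSEQ_inverse_real_of_nat
      by (intro tendsto_intros tendsto_powr') (auto simp: inverse_eq_divide)
    then have "\<forall>\<^sub>F k in sequentially. 4 powr p * (2 * (d k powr p * M)) < \<epsilon> / 2"
      by (rule order_tendstoD) (use \<epsilon> in auto)
    then obtain k where k: "4 powr p * (2 * (d k powr p * M)) < \<epsilon> / 2"
      by (auto dest!: eventually_happens)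
    define a where "a n = (\<integral>x. ?I x * \<bar>J k (r n) x - l k x\<bar> powr p \<partial>lborel)" for n
    have Jl: "?I x * \<bar>J k n x - l k x\<bar> powr p \<le> ?I x *\<^sub>R (2 * c k) powr p" for n x
      using Jc[of k n x] lc[of k x] p c[of k] by (auto simp: indicator_def intro!: powr_mono2)
    have iI: "integrable lborel (\<lambda>x. ?I x *\<^sub>R (2 * c k) powr p)"
      by (rule borel_integrable_compact) auto
    have int: "integrable lborel (\<lambda>x. ?I x * \<bar>J k n x - l k x\<bar> powr p)" for n
      by (rule Bochner_Integration.integrable_bound[OF iI]) (use Jl in auto)
    have "a \<longlonglongrightarrow> (\<integral>x. 0 \<partial>(lborel :: 'a measure))"
      unfolding a_def
    proof (rule integral_dominated_convergence[OF _ _ iI])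
      have "(\<lambda>n. ?I x * \<bar>J k (r n) x - l k x\<bar> powr p) \<longlonglongrightarrow> ?I x * \<bar>l k x - l k x\<bar> powr p" for x
        using p by (intro tendsto_intros l tendsto_powr') auto
      then show "AE x in lborel. (\<lambda>n. ?I x * \<bar>J k (r n) x - l k x\<bar> powr p) \<longlonglongrightarrow> 0" using p by simp
    qed (use Jl in auto)
    then have "(\<lambda>n. 4 powr p * a n) \<longlonglongrightarrow> 4 powr p * 0" by (intro tendsto_intros) simp
    then have "\<forall>\<^sub>F n in sequentially. 4 powr p * a n < \<epsilon> / 4"
      by (rule order_tendstoD) (use \<epsilon> in auto)
    then obtain N where N: "\<And>n. n \<ge> N \<Longrightarrow> 4 powr p * a n < \<epsilon> / 4"
      by (auto simp: eventually_sequentially)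
    have "(\<integral>\<^sup>+x. indicator (cball 0 R) x * ennreal (\<bar>u (r i) x - u (r j) x\<bar> powr p) \<partial>lborel) \<le> ennreal \<epsilon>"
      if ij: "i \<ge> N" "j \<ge> N" for i j
    proof -
      let ?e = "\<lambda>n x. \<bar>u n x - J k n x\<bar> powr p" and ?f = "\<lambda>n x. ?I x * \<bar>J k n x - l k x\<bar> powr p"
      have "(\<integral>\<^sup>+x. indicator (cball 0 R) x * ennreal (\<bar>u (r i) x - u (r j) x\<bar> powr p) \<partial>lborel)
          \<le> (\<integral>\<^sup>+x. ennreal (4 powr p) * (ennreal (?e (r i) x) + ennreal (?f (r i) x)
                + (ennreal (?e (r j) x) + ennreal (?f (r j) x))) \<partial>lborel)"
      proof (rule nn_integral_mono)
        fix x
        define A where "A n = u n x - J k n x" for n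
        define B where "B n = J k n x - l k x" for n
        have "\<bar>u (r i) x - u (r j) x\<bar> powr p \<le> 2 powr p * (\<bar>A (r i) + B (r i)\<bar> powr p + \<bar>A (r j) + B (r j)\<bar> powr p)"
          using norm_diff_powr_le[of p "A (r i) + B (r i)" "A (r j) + B (r j)"] p
          by (simp add: A_def B_def)
        also have "\<dots> \<le> 2 powr p * (2 powr p * (\<bar>A (r i)\<bar> powr p + \<bar>B (r i)\<bar> powr p)
            + 2 powr p * (\<bar>A (r j)\<bar> powr p + \<bar>B (r j)\<bar> powr p))"
          using norm_add_powr_le[of p "A (r i)" "B (r i)"] norm_add_powr_le[of p "A (r j)" "B (r j)"] p
          by (intro mult_left_mono add_mono) auto
        also have "\<dots> = 4 powr p * (\<bar>A (r i)\<bar> powr p + \<bar>B (r i)\<bar> powr p + (\<bar>A (r j)\<bar> powr p + \<bar>B (r j)\<bar> powr p))"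
          using powr_mult[of 2 2 p] by (simp add: algebra_simps)
        finally show "indicator (cball 0 R) x * ennreal (\<bar>u (r i) x - u (r j) x\<bar> powr p)
            \<le> ennreal (4 powr p) * (ennreal (?e (r i) x) + ennreal (?f (r i) x)
                + (ennreal (?e (r j) x) + ennreal (?f (r j) x)))"
          by (auto simp: indicator_def A_def B_def simp flip: ennreal_plus ennreal_mult)
      qed
      also have "\<dots> = ennreal (4 powr p) * ((\<integral>\<^sup>+x. ennreal (?e (r i) x) \<partial>lborel) + (\<integral>\<^sup>+x. ennreal (?f (r i) x) \<partial>lborel)
          + ((\<integral>\<^sup>+x. ennreal (?e (r j) x) \<partial>lborel) + (\<integral>\<^sup>+x. ennreal (?f (r j) x) \<partial>lborel)))"
        by (simp add: nn_integral_cmult nn_integral_add)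
      also have "\<dots> \<le> ennreal (4 powr p) * (ennreal (d k powr p * M) + ennreal (a i) + (ennreal (d k powr p * M) + ennreal (a j)))"
      proof -
        have "(\<integral>\<^sup>+x. ennreal (?e n x) \<partial>lborel) \<le> ennreal (d k powr p * M)" for n
          using order_trans[OF ball_average_error[OF wg p d] mult_left_mono[OF gM]] M
          by (simp add: J_def ennreal_mult)
        moreover have "(\<integral>\<^sup>+x. ennreal (?f (r n) x) \<partial>lborel) = ennreal (a n)" for n
          unfolding a_def by (rule nn_integral_eq_integral[OF int]) auto
        ultimately show ?thesis by (auto intro!: mult_left_mono add_mono)
      qed
      also have "\<dots> = ennreal (4 powr p * (d k powr p * M + a i + (d k powr p * M + a j)))"
        using M by (simp add: a_def Bochner_Integration.integral_nonneg flip: ennreal_plus ennreal_mult)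
      also have "\<dots> \<le> ennreal \<epsilon>"
        using k N[OF ij(1)] N[OF ij(2)] by (intro ennreal_leI) (simp add: algebra_simps)
      finally show ?thesis .
    qed
    then show "\<exists>N. \<forall>i\<ge>N. \<forall>j\<ge>N.
      (\<integral>\<^sup>+x. indicator (cball 0 R) x * ennreal (\<bar>u (r i) x - u (r j) x\<bar> powr p) \<partial>lborel) \<le> ennreal \<epsilon>" by blast
  qed
qed

section \<open>Completeness of the spaces of p-integrable functions\<close>

lemma Fatou_real:
  fixes f :: "nat \<Rightarrow> 'a \<Rightarrow> real"
  assumes [measurable]: "\<And>n. f n \<in> borel_measurable M" "h \<in> borel_measurable M"
    and nonneg: "\<And>n x. f n x \<ge> 0"
    and lim: "AE x in M. (\<lambda>n. f n x) \<longlonglongrightarrow> h x"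
    and int: "\<And>n. integrable M (f n)"
    and le: "\<forall>\<^sub>F n in sequentially. (\<integral>x. f n x \<partial>M) \<le> C"
  shows "integrable M h" "(\<integral>x. h x \<partial>M) \<le> C"
proof -
  have hn: "AE x in M. h x \<ge> 0"
    using lim by eventually_elim (rule LIMSEQ_le_const, auto simp: nonneg)
  have C: "C \<ge> 0"
  proof -
    obtain n where "(\<integral>x. f n x \<partial>M) \<le> C" using eventually_happens[OF le] by auto
    moreover have "(\<integral>x. f n x \<partial>M) \<ge> 0" by (simp add: nonneg)
    ultimately show ?thesis by linarith
  qed
  have "(\<integral>\<^sup>+x. ennreal (h x) \<partial>M) = (\<integral>\<^sup>+x. liminf (\<lambda>n. ennreal (f n x)) \<partial>M)"
  proof (rule nn_integral_cong_AE)
    show "AE x in M. ennreal (h x) = liminf (\<lambda>n. ennreal (f n x))"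
      using lim
    proof eventually_elim
      case (elim x)
      then have "(\<lambda>n. ennreal (f n x)) \<longlonglongrightarrow> ennreal (h x)" by (rule tendsto_ennrealI)
      then show ?case by (intro lim_imp_Liminf[symmetric]) auto
    qed
  qed
  also have "\<dots> \<le> liminf (\<lambda>n. \<integral>\<^sup>+x. ennreal (f n x) \<partial>M)"
    by (rule nn_integral_liminf) simp
  also have "\<dots> \<le> ennreal C"
  proof -
    have "\<forall>\<^sub>F n in sequentially. (\<integral>\<^sup>+x. ennreal (f n x) \<partial>M) \<le> ennreal C"
      using le by eventually_elim (simp add: nn_integral_eq_integral int nonneg ennreal_leI)
    then have "liminf (\<lambda>n. \<integral>\<^sup>+x. ennreal (f n x) \<partial>M) \<le> liminf (\<lambda>n. ennreal C)"
      by (rule Liminf_mono)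
    then show ?thesis by (simp add: Liminf_const)
  qed
  finally have fin: "(\<integral>\<^sup>+x. ennreal (h x) \<partial>M) \<le> ennreal C" .
  show "integrable M h"
    by (rule integrableI_nonneg[OF _ hn]) (use fin in \<open>auto intro: le_less_trans\<close>)
  then have "ennreal (\<integral>x. h x \<partial>M) \<le> ennreal C"
    using fin hn by (simp add: nn_integral_eq_integral)
  then show "(\<integral>x. h x \<partial>M) \<le> C" using C by simp
qed

lemma integrable_norm_diff_powr:
  fixes u v :: "'a \<Rightarrow> 'b::euclidean_space"
  assumes "p > 1" and [measurable]: "u \<in> borel_measurable M" "v \<in> borel_measurable M"
    and int: "integrable M (\<lambda>x. norm (u x) powr p)" "integrable M (\<lambda>x. norm (v x) powr p)"
  shows "integrable M (\<lambda>x. norm (u x - v x) powr p)"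
proof (rule Bochner_Integration.integrable_bound)
  show "integrable M (\<lambda>x. 2 powr p * (norm (u x) powr p + norm (v x) powr p))"
    using int by auto
  show "AE x in M. norm (norm (u x - v x) powr p) \<le> norm (2 powr p * (norm (u x) powr p + norm (v x) powr p))"
    using norm_diff_powr_le[of p] assms(1) by auto
qed measurable

text \<open>Along a subsequence with rapidly decreasing increments \<open>d\<^sub>k\<close>, the sum of
  \<open>2\<^sup>k\<^sup>p \<bar>d\<^sub>k\<bar>\<^sup>p\<close> has a finite integral, so almost everywhere \<open>\<bar>d\<^sub>k\<bar>\<close> is \<open>O(2\<^sup>-\<^sup>k)\<close>.\<close>

lemma Lp_complete:
  fixes v :: "nat \<Rightarrow> 'a \<Rightarrow> 'b::euclidean_space"
  assumes p: "p > 1" and vm[measurable]: "\<And>n. v n \<in> borel_measurable M"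
    and int: "\<And>n. integrable M (\<lambda>x. norm (v n x) powr p)"
    and Cauchy: "\<And>\<epsilon>. \<epsilon> > 0 \<Longrightarrow> \<exists>N. \<forall>i\<ge>N. \<forall>j\<ge>N. (\<integral>x. norm (v i x - v j x) powr p \<partial>M) \<le> \<epsilon>"
  obtains r w where "strict_mono (r :: nat \<Rightarrow> nat)" "w \<in> borel_measurable M"
    "AE x in M. (\<lambda>n. v (r n) x) \<longlonglongrightarrow> w x"
    "integrable M (\<lambda>x. norm (w x) powr p)"
    "(\<lambda>n. \<integral>x. norm (v n x - w x) powr p \<partial>M) \<longlonglongrightarrow> 0"
proof -
  have int2: "integrable M (\<lambda>x. norm (v i x - v j x) powr p)" for i j
    by (rule integrable_norm_diff_powr[OF p vm vm int int])
  \<comment> \<open>The first factor compensates the weight \<open>2\<^sup>k\<^sup>p\<close>, the second makes the weighted series converge.\<close>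
  define \<epsilon> where "\<epsilon> k = 2 powr (- real k * p) * (1 / 2) ^ k" for k
  have \<epsilon>: "\<epsilon> k > 0" for k by (simp add: \<epsilon>_def)
  have "\<forall>k. \<exists>N. \<forall>i\<ge>N. \<forall>j\<ge>N. (\<integral>x. norm (v i x - v j x) powr p \<partial>M) \<le> \<epsilon> k"
    by (intro allI Cauchy \<epsilon>)
  then have "\<exists>N. \<forall>k. \<forall>i\<ge>N k. \<forall>j\<ge>N k. (\<integral>x. norm (v i x - v j x) powr p \<partial>M) \<le> \<epsilon> k"
    by (rule choice)
  then obtain N where N: "\<And>k i j. i \<ge> N k \<Longrightarrow> j \<ge> N k \<Longrightarrow> (\<integral>x. norm (v i x - v j x) powr p \<partial>M) \<le> \<epsilon> k"
    by blast
  define r where "r = rec_nat (N 0) (\<lambda>k rk. max (Suc rk) (N (Suc k)))"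
  have r_Suc: "r (Suc k) = max (Suc (r k)) (N (Suc k))" for k by (simp add: r_def)
  have sm: "strict_mono r" by (simp add: strict_mono_Suc_iff r_Suc less_max_iff_disj)
  have rN: "r k \<ge> N k" for k by (cases k) (auto simp: r_def)
  define d where "d k x = v (r (Suc k)) x - v (r k) x" for k x
  have [measurable]: "d k \<in> borel_measurable M" for k unfolding d_def by measurable
  define X where "X x = (\<Sum>k. ennreal (2 powr (real k * p) * norm (d k x) powr p))" for x
  have Xm: "X \<in> borel_measurable M" unfolding X_def[abs_def] by measurable
  have "(\<integral>\<^sup>+x. X x \<partial>M)
      = (\<Sum>k. (\<integral>\<^sup>+x. ennreal (2 powr (real k * p) * norm (d k x) powr p) \<partial>M))"
    unfolding X_def by (rule nn_integral_suminf) measurable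
  also have "\<dots> \<le> (\<Sum>k. ennreal ((1 / 2) ^ k))"
  proof (intro suminf_le allI)
    fix k
    have i: "integrable M (\<lambda>x. 2 powr (real k * p) * norm (d k x) powr p)"
      unfolding d_def by (intro integrable_mult_right int2)
    have "(\<integral>x. norm (d k x) powr p \<partial>M) \<le> \<epsilon> k"
      unfolding d_def by (rule N) (use rN[of k] strict_monoD[OF sm, of k "Suc k"] in auto)
    then have "2 powr (real k * p) * (\<integral>x. norm (d k x) powr p \<partial>M) \<le> 2 powr (real k * p) * \<epsilon> k"
      by (intro mult_left_mono) auto
    also have "\<dots> = (1 / 2) ^ k" by (simp add: \<epsilon>_def powr_minus)
    finally show "(\<integral>\<^sup>+x. ennreal (2 powr (real k * p) * norm (d k x) powr p) \<partial>M) \<le> ennreal ((1 / 2) ^ k)"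
      by (subst nn_integral_eq_integral[OF i]) (auto intro: ennreal_leI)
  qed auto
  also have "\<dots> = ennreal (\<Sum>k. (1 / 2) ^ k)"
    by (rule suminf_ennreal2) (simp_all add: summable_geometric)
  also have "\<dots> < \<infinity>" by (simp only: infinity_ennreal_def ennreal_less_top)
  finally have "(\<integral>\<^sup>+x. X x \<partial>M) \<noteq> \<infinity>" by (rule less_imp_neq)
  then have "AE x in M. X x \<noteq> \<infinity>" by (rule nn_integral_PInf_AE[OF Xm])
  then have conv: "AE x in M. convergent (\<lambda>n. v (r n) x)"
  proof eventually_elim
    case (elim x)
    then obtain S where S: "S \<ge> 0" "X x = ennreal S" by (cases "X x") auto
    have term_le: "ennreal (2 powr (real k * p) * norm (d k x) powr p) \<le> X x" for k
    proof -
      have "sum (\<lambda>k. ennreal (2 powr (real k * p) * norm (d k x) powr p)) {k} \<le> X x"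
        unfolding X_def by (rule sum_le_suminf) (simp_all only: finite.intros summableI zero_le)
      then show ?thesis by (simp only: sum.insert sum.empty finite.emptyI empty_iff not_False_eq_True add_0_right)
    qed
    have half: "2 powr (- real k) = (1 / 2 :: real) ^ k" for k
      by (simp only: powr_minus powr_realpow zero_less_numeral power_one_over inverse_eq_divide)
    have dk: "norm (d k x) \<le> S powr (1 / p) * (1 / 2) ^ k" for k
    proof (rule ccontr)
      assume "\<not> ?thesis"
      then have "(S powr (1 / p) * 2 powr (- real k)) powr p < norm (d k x) powr p"
        unfolding half using S p by (intro powr_less_mono2) auto
      moreover have "(S powr (1 / p) * 2 powr (- real k)) powr p = S * 2 powr (- (real k * p))"
        using S(1) p by (simp only: powr_mult powr_powr powr_ge_zero) simp
      ultimately have "S * 2 powr (- (real k * p)) < norm (d k x) powr p" by linarith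
      then have "2 powr (real k * p) * (S * 2 powr (- (real k * p))) < 2 powr (real k * p) * norm (d k x) powr p"
        by (rule mult_strict_left_mono) (simp only: powr_gt_zero)
      moreover have "2 powr (real k * p) * (S * 2 powr (- (real k * p))) = S"
        by (simp only: powr_minus) simp
      moreover have "2 powr (real k * p) * norm (d k x) powr p \<le> S"
        using term_le[of k] unfolding S(2) by (rule ennreal_le_iff[OF S(1), THEN iffD1])
      ultimately show False by linarith
    qed
    have "summable (\<lambda>k. d k x)"
      by (rule summable_comparison_test'[where N=0, OF _ dk]) (intro summable_mult summable_geometric, simp)
    then have "convergent (\<lambda>n. v (r 0) x + (\<Sum>k<n. d k x))"
      unfolding summable_iff_convergent by (intro convergent_add convergent_const)
    moreover have "v (r 0) x + (\<Sum>k<n. d k x) = v (r n) x" for n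
      unfolding d_def by (subst sum_lessThan_telescope) simp
    ultimately show ?case by simp
  qed
  define w where "w x = lim (\<lambda>n. v (r n) x)" for x
  have wm[measurable]: "w \<in> borel_measurable M" unfolding w_def by (rule borel_measurable_lim_metric) simp
  have lim: "AE x in M. (\<lambda>n. v (r n) x) \<longlonglongrightarrow> w x"
    using conv by eventually_elim (simp add: w_def convergent_LIMSEQ_iff)
  have close: "integrable M (\<lambda>x. norm (v n x - w x) powr p) \<and> (\<integral>x. norm (v n x - w x) powr p \<partial>M) \<le> e"
    if "\<And>i j. i \<ge> K \<Longrightarrow> j \<ge> K \<Longrightarrow> (\<integral>x. norm (v i x - v j x) powr p \<partial>M) \<le> e" "n \<ge> K" for n K e
  proof -
    have ae: "AE x in M. (\<lambda>m. norm (v n x - v (r m) x) powr p) \<longlonglongrightarrow> norm (v n x - w x) powr p"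
      using lim
    proof eventually_elim
      case (elim x)
      then show ?case using p by (intro tendsto_intros tendsto_powr') auto
    qed
    have ev: "\<forall>\<^sub>F m in sequentially. (\<integral>x. norm (v n x - v (r m) x) powr p \<partial>M) \<le> e"
      using eventually_ge_at_top[of K]
    proof eventually_elim
      case (elim m)
      then have "r m \<ge> K" using seq_suble[OF sm, of m] by linarith
      then show ?case using that by auto
    qed
    show ?thesis
      using Fatou_real[of "\<lambda>m x. norm (v n x - v (r m) x) powr p", OF _ _ _ ae int2 ev] by simp
  qed
  have iw: "integrable M (\<lambda>x. norm (w x) powr p)"
  proof -
    obtain K where K: "\<And>i j. i \<ge> K \<Longrightarrow> j \<ge> K \<Longrightarrow> (\<integral>x. norm (v i x - v j x) powr p \<partial>M) \<le> 1"
      using Cauchy[of 1] by auto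
    have "integrable M (\<lambda>x. norm (v K x - w x) powr p)" using close[OF K] by simp
    then have "integrable M (\<lambda>x. 2 powr p * (norm (v K x) powr p + norm (v K x - w x) powr p))"
      using int by auto
    then show ?thesis
    proof (rule Bochner_Integration.integrable_bound)
      show "AE x in M. norm (norm (w x) powr p)
          \<le> norm (2 powr p * (norm (v K x) powr p + norm (v K x - w x) powr p))"
        using norm_diff_powr_le[of p "v K x" "v K x - w x" for x] p by auto
    qed measurable
  qed
  have "(\<lambda>n. \<integral>x. norm (v n x - w x) powr p \<partial>M) \<longlonglongrightarrow> 0"
  proof (rule LIMSEQ_I)
    fix e :: real assume e: "e > 0"
    obtain K where K: "\<And>i j. i \<ge> K \<Longrightarrow> j \<ge> K \<Longrightarrow> (\<integral>x. norm (v i x - v j x) powr p \<partial>M) \<le> e / 2"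
      using Cauchy[of "e / 2"] e by auto
    have "norm ((\<integral>x. norm (v n x - w x) powr p \<partial>M) - 0) < e" if "n \<ge> K" for n
      using close[OF K that] e by (simp add: Bochner_Integration.integral_nonneg)
    then show "\<exists>K. \<forall>n\<ge>K. norm ((\<integral>x. norm (v n x - w x) powr p \<partial>M) - 0) < e" by blast
  qed
  with sm wm lim iw that show thesis by blast
qed

section \<open>Weak derivatives pass to limits\<close>

text \<open>This passes from \<open>L\<^sup>p\<close> to \<open>L\<^sup>1\<close> on sets of finite measure, with a first term that can be made small.\<close>

lemma abs_le_powr:
  fixes d \<eta> p :: real
  assumes "d \<ge> 0" "\<eta> > 0" "p > 1"
  shows "d \<le> \<eta> + \<eta> powr (1 - p) * d powr p"
proof (cases "d \<le> \<eta>")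
  case False
  then have "d = d powr (1 - p) * d powr p" using assms by (simp flip: powr_add)
  also have "\<dots> \<le> \<eta> powr (1 - p) * d powr p"
    using False assms by (intro mult_right_mono powr_mono2') auto
  finally show ?thesis using assms by simp
qed (use assms in \<open>simp add: add_increasing2\<close>)

lemma Lp_loc_integrable:
  fixes u :: "'a::euclidean_space \<Rightarrow> 'b::euclidean_space"
  assumes "p > 1" and [measurable]: "u \<in> borel_measurable borel"
    and int: "integrable lborel (\<lambda>x. norm (u x) powr p)"
  shows "loc_integrable u"
  unfolding loc_integrable_def
proof (intro conjI allI)
  fix R
  have [measurable]: "cball (0::'a) R \<in> sets borel" by simp
  have "integrable lborel (\<lambda>x::'a. indicator (cball 0 R) x *\<^sub>R (1::real))"
    by (rule borel_integrable_compact) auto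
  then have "integrable lborel (\<lambda>x. indicator (cball 0 R) x *\<^sub>R 1 + norm (u x) powr p)"
    using int by (rule Bochner_Integration.integrable_add)
  then show "integrable lborel (\<lambda>x. indicator (cball 0 R) x *\<^sub>R u x)"
  proof (rule Bochner_Integration.integrable_bound)
    show "AE x in lborel. norm (indicator (cball 0 R) x *\<^sub>R u x)
        \<le> norm (indicator (cball 0 R) x *\<^sub>R 1 + norm (u x) powr p)"
      using abs_le_powr[of "norm (u _)" 1 p] assms(1) by (auto simp: indicator_def)
  qed measurable
qed fact

lemma test_integral_tendsto_0:
  fixes d :: "nat \<Rightarrow> 'a::euclidean_space \<Rightarrow> 'b::euclidean_space"
  assumes p: "p > 1" and dm[measurable]: "\<And>n. d n \<in> borel_measurable borel"
    and int: "\<And>n. integrable lborel (\<lambda>x. norm (d n x) powr p)"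
    and lim: "(\<lambda>n. \<integral>x. norm (d n x) powr p \<partial>lborel) \<longlonglongrightarrow> 0"
    and \<psi>: "test_function \<psi>"
  shows "(\<lambda>n. \<integral>x. (d n x \<bullet> b) * \<psi> x \<partial>lborel) \<longlonglongrightarrow> 0"
proof (rule LIMSEQ_I)
  fix e :: real assume e: "e > 0"
  obtain B R where BR: "B > 0" "\<And>x. \<bar>\<psi> x\<bar> \<le> B" "\<And>x. norm x > R \<Longrightarrow> \<psi> x = 0"
    using test_function_bounds[OF \<psi>] by metis
  note [measurable] = test_function_measurable[OF \<psi>]
  let ?I = "indicator (cball (0::'a) R) :: 'a \<Rightarrow> real"
  define C where "C = B * (norm b + 1)"
  have C: "C > 0" unfolding C_def using BR(1) by (intro mult_pos_pos) (auto simp: add_nonneg_pos)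
  define m where "m = (\<integral>x. ?I x *\<^sub>R (1::real) \<partial>lborel) + 1"
  have iI: "integrable lborel (\<lambda>x::'a. ?I x *\<^sub>R (1::real))"
    by (rule borel_integrable_compact) auto
  have m: "m > 0" unfolding m_def by (intro add_nonneg_pos Bochner_Integration.integral_nonneg) auto
  define \<eta> where "\<eta> = e / (2 * C * m)"
  have \<eta>: "\<eta> > 0" using e C m by (simp add: \<eta>_def)
  have "(\<lambda>n. C * (\<eta> powr (1 - p) * (\<integral>x. norm (d n x) powr p \<partial>lborel))) \<longlonglongrightarrow> C * (\<eta> powr (1 - p) * 0)"
    by (intro tendsto_intros lim)
  then have "\<forall>\<^sub>F n in sequentially. C * (\<eta> powr (1 - p) * (\<integral>x. norm (d n x) powr p \<partial>lborel)) < e / 2"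
    by (rule order_tendstoD) (use e in auto)
  then obtain N where N: "\<And>n. n \<ge> N \<Longrightarrow> C * (\<eta> powr (1 - p) * (\<integral>x. norm (d n x) powr p \<partial>lborel)) < e / 2"
    by (auto simp: eventually_sequentially)
  have "norm ((\<integral>x. (d n x \<bullet> b) * \<psi> x \<partial>lborel) - 0) < e" if "n \<ge> N" for n
  proof -
    have "norm (\<integral>x. (d n x \<bullet> b) * \<psi> x \<partial>lborel) \<le> (\<integral>x. norm ((d n x \<bullet> b) * \<psi> x) \<partial>lborel)"
      by (rule integral_norm_bound)
    also have "\<dots> \<le> (\<integral>x. C * (\<eta> * (?I x *\<^sub>R (1::real)) + \<eta> powr (1 - p) * norm (d n x) powr p) \<partial>lborel)"
    proof (rule integral_mono_AE')
      show "integrable lborel (\<lambda>x. C * (\<eta> * (?I x *\<^sub>R (1::real)) + \<eta> powr (1 - p) * norm (d n x) powr p))"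
        using iI int by (intro integrable_mult_right Bochner_Integration.integrable_add) auto
      have "norm ((d n x \<bullet> b) * \<psi> x) \<le> C * (\<eta> * (?I x *\<^sub>R (1::real)) + \<eta> powr (1 - p) * norm (d n x) powr p)" for x
      proof (cases "norm x \<le> R")
        case True
        have "\<bar>d n x \<bullet> b\<bar> * \<bar>\<psi> x\<bar> \<le> (norm (d n x) * (norm b + 1)) * B"
          using BR Cauchy_Schwarz_ineq2[of "d n x" b]
          by (intro mult_mono) (auto simp: distrib_left intro: add_increasing2)
        also have "\<dots> = C * norm (d n x)" by (simp add: C_def)
        also have "\<dots> \<le> C * (\<eta> + \<eta> powr (1 - p) * norm (d n x) powr p)"
          using C \<eta> p by (intro mult_left_mono abs_le_powr) auto
        finally show ?thesis using True by (simp add: abs_mult)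
      next
        case False
        then show ?thesis using BR C by simp
      qed
      then show "AE x in lborel. norm ((d n x \<bullet> b) * \<psi> x)
          \<le> C * (\<eta> * (?I x *\<^sub>R (1::real)) + \<eta> powr (1 - p) * norm (d n x) powr p)" by simp
    qed (use C \<eta> in simp)
    also have "\<dots> = C * (\<eta> * (m - 1)) + C * (\<eta> powr (1 - p) * (\<integral>x. norm (d n x) powr p \<partial>lborel))"
      using iI int by (simp add: m_def distrib_left)
    also have "\<dots> < C * (\<eta> * m) + e / 2"
      using N[OF that] C \<eta> by (intro add_le_less_mono) auto
    also have "C * (\<eta> * m) = e / 2" using C m by (simp add: \<eta>_def)
    finally show ?thesis by simp
  qed
  then show "\<exists>N. \<forall>n\<ge>N. norm ((\<integral>x. (d n x \<bullet> b) * \<psi> x \<partial>lborel) - 0) < e" by blast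
qed

lemma test_integral_tendsto:
  fixes v :: "nat \<Rightarrow> 'a::euclidean_space \<Rightarrow> 'b::euclidean_space"
  assumes p: "p > 1" and [measurable]: "\<And>n. v n \<in> borel_measurable borel" "w \<in> borel_measurable borel"
    and int: "\<And>n. integrable lborel (\<lambda>x. norm (v n x) powr p)" "integrable lborel (\<lambda>x. norm (w x) powr p)"
    and lim: "(\<lambda>n. \<integral>x. norm (v n x - w x) powr p \<partial>lborel) \<longlonglongrightarrow> 0"
    and \<psi>: "test_function \<psi>"
  shows "(\<lambda>n. \<integral>x. (v n x \<bullet> b) * \<psi> x \<partial>lborel) \<longlonglongrightarrow> (\<integral>x. (w x \<bullet> b) * \<psi> x \<partial>lborel)"
proof -
  have li: "loc_integrable (v n)" "loc_integrable w" for n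
    by (rule Lp_loc_integrable[OF p]; use int in measurable)+
  have "(\<lambda>n. \<integral>x. ((v n x - w x) \<bullet> b) * \<psi> x \<partial>lborel) \<longlonglongrightarrow> 0"
    by (rule test_integral_tendsto_0[OF p _ _ lim \<psi>]) (auto intro!: integrable_norm_diff_powr p int)
  moreover have "(\<integral>x. ((v n x - w x) \<bullet> b) * \<psi> x \<partial>lborel)
      = (\<integral>x. (v n x \<bullet> b) * \<psi> x \<partial>lborel) - (\<integral>x. (w x \<bullet> b) * \<psi> x \<partial>lborel)" for n
    using integrable_times_test[OF loc_integrable_inner[OF li(1)] \<psi>, of n b]
      integrable_times_test[OF loc_integrable_inner[OF li(2)] \<psi>, of b]
    by (simp add: inner_diff_left left_diff_distrib)
  ultimately show ?thesis by (simp add: LIM_zero_iff)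
qed

lemma test_function_laplacian: "test_function \<phi> \<Longrightarrow> test_function (laplacian \<phi>)"
  unfolding laplacian_def[abs_def] by (intro test_function_sum test_function_pderiv_dir) auto

lemma weak_gradient_limit:
  fixes u :: "nat \<Rightarrow> 'a::euclidean_space \<Rightarrow> real"
  assumes p: "p > 1" and wg: "\<And>n. weak_gradient (u n) (g n)"
    and m[measurable]: "u0 \<in> borel_measurable borel" "g0 \<in> borel_measurable borel"
    and int: "\<And>n. integrable lborel (\<lambda>x. norm (u n x) powr p)" "integrable lborel (\<lambda>x. norm (u0 x) powr p)"
      "\<And>n. integrable lborel (\<lambda>x. norm (g n x) powr p)" "integrable lborel (\<lambda>x. norm (g0 x) powr p)"
    and lim: "(\<lambda>n. \<integral>x. norm (u n x - u0 x) powr p \<partial>lborel) \<longlonglongrightarrow> 0"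
      "(\<lambda>n. \<integral>x. norm (g n x - g0 x) powr p \<partial>lborel) \<longlonglongrightarrow> 0"
  shows "weak_gradient u0 g0"
  unfolding weak_gradient_def
proof (intro conjI allI impI ballI)
  have m': "u n \<in> borel_measurable borel" "g n \<in> borel_measurable borel" for n
    using wg by (auto simp: weak_gradient_def dest: loc_integrable_measurable)
  show "loc_integrable u0" "loc_integrable g0"
    using int m by (auto intro!: Lp_loc_integrable[OF p])
  fix \<phi> b assume \<phi>: "test_function (\<phi> :: 'a \<Rightarrow> real)" and b: "(b::'a) \<in> Basis"
  have "(\<lambda>n. \<integral>x. (u n x \<bullet> 1) * pderiv_dir b \<phi> x \<partial>lborel) \<longlonglongrightarrow> (\<integral>x. (u0 x \<bullet> 1) * pderiv_dir b \<phi> x \<partial>lborel)"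
    by (rule test_integral_tendsto[OF p m'(1) m(1) int(1,2) lim(1) test_function_pderiv_dir[OF \<phi> b]])
  moreover have "(\<lambda>n. - (\<integral>x. (g n x \<bullet> b) * \<phi> x \<partial>lborel)) \<longlonglongrightarrow> - (\<integral>x. (g0 x \<bullet> b) * \<phi> x \<partial>lborel)"
    by (intro tendsto_minus test_integral_tendsto[OF p m'(2) m(2) int(3,4) lim(2) \<phi>])
  moreover have "(\<integral>x. (u n x \<bullet> 1) * pderiv_dir b \<phi> x \<partial>lborel) = - (\<integral>x. (g n x \<bullet> b) * \<phi> x \<partial>lborel)" for n
    using wg[of n] \<phi> b by (simp add: weak_gradient_def)
  ultimately show "(\<integral>x. u0 x * pderiv_dir b \<phi> x \<partial>lborel) = - (\<integral>x. (g0 x \<bullet> b) * \<phi> x \<partial>lborel)"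
    using LIMSEQ_unique by fastforce
qed

lemma weak_laplacian_limit:
  fixes u :: "nat \<Rightarrow> 'a::euclidean_space \<Rightarrow> real"
  assumes p: "p > 1" and wl: "\<And>n. weak_laplacian (u n) (w n)"
    and m[measurable]: "u0 \<in> borel_measurable borel" "w0 \<in> borel_measurable borel"
    and int: "\<And>n. integrable lborel (\<lambda>x. norm (u n x) powr p)" "integrable lborel (\<lambda>x. norm (u0 x) powr p)"
      "\<And>n. integrable lborel (\<lambda>x. norm (w n x) powr p)" "integrable lborel (\<lambda>x. norm (w0 x) powr p)"
    and lim: "(\<lambda>n. \<integral>x. norm (u n x - u0 x) powr p \<partial>lborel) \<longlonglongrightarrow> 0"
      "(\<lambda>n. \<integral>x. norm (w n x - w0 x) powr p \<partial>lborel) \<longlonglongrightarrow> 0"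
  shows "weak_laplacian u0 w0"
  unfolding weak_laplacian_def
proof (intro conjI allI impI)
  have m': "u n \<in> borel_measurable borel" "w n \<in> borel_measurable borel" for n
    using wl by (auto simp: weak_laplacian_def dest: loc_integrable_measurable)
  show "loc_integrable u0" "loc_integrable w0"
    using int m by (auto intro!: Lp_loc_integrable[OF p])
  fix \<phi> assume \<phi>: "test_function (\<phi> :: 'a \<Rightarrow> real)"
  have "(\<lambda>n. \<integral>x. (u n x \<bullet> 1) * laplacian \<phi> x \<partial>lborel) \<longlonglongrightarrow> (\<integral>x. (u0 x \<bullet> 1) * laplacian \<phi> x \<partial>lborel)"
    by (rule test_integral_tendsto[OF p m'(1) m(1) int(1,2) lim(1) test_function_laplacian[OF \<phi>]])
  moreover have "(\<lambda>n. (\<integral>x. (w n x \<bullet> 1) * \<phi> x \<partial>lborel)) \<longlonglongrightarrow> (\<integral>x. (w0 x \<bullet> 1) * \<phi> x \<partial>lborel)"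
    by (intro test_integral_tendsto[OF p m'(2) m(2) int(3,4) lim(2) \<phi>])
  moreover have "(\<integral>x. (u n x \<bullet> 1) * laplacian \<phi> x \<partial>lborel) = (\<integral>x. (w n x \<bullet> 1) * \<phi> x \<partial>lborel)" for n
    using wl[of n] \<phi> by (simp add: weak_laplacian_def)
  ultimately show "(\<integral>x. u0 x * laplacian \<phi> x \<partial>lborel) = (\<integral>x. w0 x * \<phi> x \<partial>lborel)"
    using LIMSEQ_unique by fastforce
qed

section \<open>Uniform convexity\<close>

lemma powr_midpoint_strict:
  fixes s t p :: real
  assumes "p > 1" "s \<ge> 0" "t \<ge> 0" "s \<noteq> t"
  shows "((s + t) / 2) powr p < (s powr p + t powr p) / 2"
proof -
  define c where "c = (s + t) / 2"
  define A where "A = p * c powr (p - 1) * (s - c)"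
  have "p * c powr (p - 1) * (t - c) = - A"
    by (simp add: A_def c_def algebra_simps add_divide_distrib)
  moreover have "c powr p + A < s powr p" "c powr p + p * c powr (p - 1) * (t - c) < t powr p"
    unfolding A_def by (rule powr_tangent_strict; use assms in \<open>simp add: c_def field_simps\<close>)+
  ultimately show ?thesis unfolding c_def[symmetric] by simp
qed

lemma norm_powr_midpoint_strict:
  fixes a b :: "'b::real_inner"
  assumes p: "p > 1" and ne: "a \<noteq> b"
  shows "norm ((a + b) /\<^sub>R 2) powr p < (norm a powr p + norm b powr p) / 2"
proof (cases "norm a = norm b")
  case False
  have "norm ((a + b) /\<^sub>R 2) powr p \<le> ((norm a + norm b) / 2) powr p"
    using p norm_triangle_ineq[of a b] by (intro powr_mono2) auto
  also have "\<dots> < (norm a powr p + norm b powr p) / 2"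
    using p False by (intro powr_midpoint_strict) auto
  finally show ?thesis .
next
  case True
  have "(norm (a + b))\<^sup>2 + (norm (a - b))\<^sup>2 = 2 * (norm a)\<^sup>2 + 2 * (norm b)\<^sup>2"
    by (simp add: power2_norm_eq_inner inner_add_left inner_add_right inner_diff_left inner_diff_right inner_commute)
  moreover have "(norm (a - b))\<^sup>2 > 0" using ne by simp
  moreover have "(2 * norm a)\<^sup>2 = 2 * (norm a)\<^sup>2 + 2 * (norm b)\<^sup>2"
    using True by (simp add: power_mult_distrib)
  ultimately have "(norm (a + b))\<^sup>2 < (2 * norm a)\<^sup>2" by linarith
  then have "norm (a + b) < 2 * norm a" by (rule power_less_imp_less_base) simp
  then have "norm ((a + b) /\<^sub>R 2) powr p < norm a powr p"
    using p by (intro powr_less_mono2) auto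
  then show ?thesis using True by simp
qed

definition convexity_gap :: "real \<Rightarrow> 'b::real_inner \<Rightarrow> 'b \<Rightarrow> real" where
  "convexity_gap p a b = (norm a powr p + norm b powr p) / 2 - norm ((a + b) /\<^sub>R 2) powr p"

lemma convexity_gap_nonneg: "p > 1 \<Longrightarrow> convexity_gap p a b \<ge> 0"
  using norm_powr_midpoint_strict[of p a b] by (cases "a = b") (auto simp: convexity_gap_def simp flip: scaleR_2)

text \<open>Both sides are homogeneous, so this is a statement about the unit sphere, where it follows from
  strict convexity by compactness. This covers \<open>p < 2\<close> and \<open>p \<ge> 2\<close> alike.\<close>

lemma uniform_convexity:
  assumes p: "p > 1" and \<epsilon>: "\<epsilon> > 0"
  obtains C where "C \<ge> 0" "\<And>a b :: 'b::euclidean_space.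
    norm (a - b) powr p \<le> \<epsilon> * (norm a powr p + norm b powr p) + C * convexity_gap p a b"
proof -
  define S where "S = {z :: 'b \<times> 'b. norm z = 1}"
  define K where "K = {z \<in> S. \<epsilon> * (norm (fst z) powr p + norm (snd z) powr p) \<le> norm (fst z - snd z) powr p}"
  have cont: "continuous_on A (\<lambda>z :: 'b \<times> 'b. convexity_gap p (fst z) (snd z))" for A
    unfolding convexity_gap_def using p by (auto intro!: continuous_intros continuous_on_powr')
  have "compact S" unfolding S_def using compact_sphere[of "0 :: 'b \<times> 'b" 1] by (simp add: sphere_def dist_norm)
  moreover have "closed {z :: 'b \<times> 'b. \<epsilon> * (norm (fst z) powr p + norm (snd z) powr p) \<le> norm (fst z - snd z) powr p}"
    using p by (intro closed_Collect_le continuous_intros continuous_on_powr') auto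
  ultimately have K: "compact K" unfolding K_def Collect_conj_eq Int_def[symmetric]
    by (simp add: Collect_conj_eq compact_Int_closed)
  have pos: "convexity_gap p (fst z) (snd z) > 0" if "z \<in> K" for z
  proof -
    have "fst z \<noteq> snd z"
    proof
      assume "fst z = snd z"
      moreover have "z \<noteq> 0" using that by (auto simp: K_def S_def)
      ultimately have "fst z \<noteq> 0" "snd z \<noteq> 0" by (auto simp: prod_eq_iff)
      with \<open>fst z = snd z\<close> that \<epsilon> show False by (auto simp: K_def mult_le_0_iff)
    qed
    then show ?thesis using norm_powr_midpoint_strict[OF p] by (simp add: convexity_gap_def)
  qed
  obtain m where m: "m > 0" "\<And>z. z \<in> K \<Longrightarrow> m \<le> convexity_gap p (fst z) (snd z)"
  proof (cases "K = {}")
    case True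
    then show ?thesis using that[of 1] by auto
  next
    case False
    obtain z where "z \<in> K" "\<And>y. y \<in> K \<Longrightarrow> convexity_gap p (fst z) (snd z) \<le> convexity_gap p (fst y) (snd y)"
      using continuous_attains_inf[OF K False cont] by metis
    then show ?thesis using that[of "convexity_gap p (fst z) (snd z)"] pos by auto
  qed
  define C where "C = 2 powr p / m"
  have C: "C \<ge> 0" using m by (simp add: C_def)
  have sphere: "norm (fst z - snd z) powr p
      \<le> \<epsilon> * (norm (fst z) powr p + norm (snd z) powr p) + C * convexity_gap p (fst z) (snd z)" if "z \<in> S" for z
  proof (cases "z \<in> K")
    case True
    have "norm (fst z) \<le> 1" "norm (snd z) \<le> 1"
      using that norm_fst_le[of "fst z" "snd z"] norm_snd_le[of "snd z" "fst z"] by (auto simp: S_def)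
    then have "norm (fst z - snd z) \<le> 2" using norm_triangle_ineq4[of "fst z" "snd z"] by linarith
    then have "norm (fst z - snd z) powr p \<le> 2 powr p" using p by (intro powr_mono2) auto
    also have "\<dots> = C * m" using m by (simp add: C_def)
    also have "\<dots> \<le> C * convexity_gap p (fst z) (snd z)" using C m(2)[OF True] by (intro mult_left_mono)
    finally show ?thesis using \<epsilon> by (simp add: add_increasing)
  next
    case False
    then show ?thesis using that C convexity_gap_nonneg[OF p, of "fst z" "snd z"]
      by (auto simp: K_def intro: add_increasing2)
  qed
  have "norm (a - b) powr p \<le> \<epsilon> * (norm a powr p + norm b powr p) + C * convexity_gap p a b" for a b :: 'b
  proof (cases "(a, b) = 0")
    case False
    define t where "t = norm (a, b)"
    have t: "t > 0" using False by (simp add: t_def)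
    define a' b' where "a' = a /\<^sub>R t" and "b' = b /\<^sub>R t"
    have ab: "a = t *\<^sub>R a'" "b = t *\<^sub>R b'" using t by (auto simp: a'_def b'_def)
    have "(a', b') = (a, b) /\<^sub>R t" by (simp add: a'_def b'_def)
    then have "norm (a', b') = \<bar>inverse t\<bar> * t" unfolding t_def by (simp only: norm_scaleR)
    then have "(a', b') \<in> S" using t by (simp add: S_def)
    note s = sphere[OF this, simplified]
    have n: "norm (t *\<^sub>R c) powr p = t powr p * norm c powr p" for c :: 'b
      using t by (simp add: powr_mult)
    have h: "convexity_gap p a b = t powr p * convexity_gap p a' b'"
    proof -
      have "(a + b) /\<^sub>R 2 = t *\<^sub>R ((a' + b') /\<^sub>R 2)" by (simp add: ab algebra_simps)
      then have "norm ((a + b) /\<^sub>R 2) powr p = t powr p * norm ((a' + b') /\<^sub>R 2) powr p"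
        by (simp only: n)
      moreover have "norm a powr p = t powr p * norm a' powr p" "norm b powr p = t powr p * norm b' powr p"
        by (simp_all only: ab n)
      ultimately show ?thesis unfolding convexity_gap_def
        by (simp only: right_diff_distrib distrib_left times_divide_eq_right)
    qed
    have "norm (a - b) powr p = t powr p * norm (a' - b') powr p"
      using n[of "a' - b'"] by (simp add: ab scaleR_diff_right)
    also have "\<dots> \<le> t powr p * (\<epsilon> * (norm a' powr p + norm b' powr p) + C * convexity_gap p a' b')"
      using s by (intro mult_left_mono) auto
    also have "\<dots> = \<epsilon> * (norm a powr p + norm b powr p) + C * convexity_gap p a b"
      unfolding h by (simp add: ab n algebra_simps del: norm_scaleR)
    finally show ?thesis .
  qed (use p in \<open>simp add: convexity_gap_def zero_prod_def\<close>)
  with C show thesis by (rule that)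
qed

section \<open>The nonlinear term\<close>

text \<open>All three exponents are positive and add up to \<open>p\<close>. With \<open>M = max X s\<close>, either \<open>d \<le> \<epsilon> M\<close> or
  \<open>M\<close> is below \<open>d / \<epsilon>\<close>; in each case one part of the right-hand side absorbs the product.\<close>

lemma Young_three:
  fixes X d s \<gamma> p \<epsilon> :: real
  assumes "X \<ge> 0" "d \<ge> 0" "s \<ge> 0" "1 < \<gamma>" "\<gamma> < p" "\<epsilon> > 0"
  shows "X powr (p - \<gamma>) * (d * s powr (\<gamma> - 1)) \<le> \<epsilon> * (X powr p + s powr p) + \<epsilon> powr (1 - p) * d powr p"
proof -
  define M where "M = max X s"
  have M: "M \<ge> 0" "X \<le> M" "s \<le> M" using assms by (auto simp: M_def)
  have "X powr (p - \<gamma>) * (d * s powr (\<gamma> - 1)) \<le> M powr (p - \<gamma>) * (d * M powr (\<gamma> - 1))"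
    using assms M by (intro mult_mono powr_mono2) auto
  also have "\<dots> = M powr (p - 1) * d"
    using powr_add[of M "p - \<gamma>" "\<gamma> - 1"] by (simp add: mult_ac)
  also have "\<dots> \<le> \<epsilon> * M powr p + \<epsilon> powr (1 - p) * d powr p"
  proof (cases "d \<le> \<epsilon> * M")
    case True
    have "M powr (p - 1) * d \<le> M powr (p - 1) * (\<epsilon> * M)" using True by (intro mult_left_mono) auto
    also have "\<dots> = \<epsilon> * M powr p" using M(1) powr_mult_base[of M "p - 1"] by (simp add: mult_ac)
    finally show ?thesis by (simp add: add_increasing2)
  next
    case False
    then have "M powr (p - 1) \<le> (d / \<epsilon>) powr (p - 1)"
      using assms M by (intro powr_mono2) (auto simp: field_simps)
    then have "M powr (p - 1) * d \<le> (d / \<epsilon>) powr (p - 1) * d"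
      using assms by (intro mult_right_mono) auto
    also have "\<dots> = \<epsilon> powr (1 - p) * d powr p"
    proof -
      have "\<epsilon> powr (1 - p) = 1 / \<epsilon> powr (p - 1)" by (metis minus_diff_eq powr_minus_divide)
      then show ?thesis using assms powr_mult_base[of d "p - 1"] by (simp add: powr_divide mult_ac)
    qed
    finally show ?thesis using assms by (simp add: add_increasing)
  qed
  also have "M powr p \<le> X powr p + s powr p" by (auto simp: M_def max_def)
  finally show ?thesis using assms by simp
qed

text \<open>Split according to whether \<open>X \<le> \<tau> s\<close>, with \<open>\<tau>\<close> chosen to produce the coefficient \<open>\<epsilon>\<close>.\<close>

lemma Young_two:
  fixes \<gamma> p \<epsilon> :: real
  assumes "1 < \<gamma>" "\<gamma> < p" "\<epsilon> > 0"
  obtains C where "C \<ge> 0" "\<And>X s. X \<ge> 0 \<Longrightarrow> s \<ge> 0 \<Longrightarrow> X powr (p - \<gamma>) * s powr \<gamma> \<le> \<epsilon> * s powr p + C * X powr p"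
proof -
  define \<tau> where "\<tau> = \<epsilon> powr (1 / (p - \<gamma>))"
  have \<tau>: "\<tau> > 0" "\<tau> powr (p - \<gamma>) = \<epsilon>" using assms by (auto simp: \<tau>_def powr_powr)
  have "X powr (p - \<gamma>) * s powr \<gamma> \<le> \<epsilon> * s powr p + (1 / \<tau>) powr \<gamma> * X powr p"
    if Xs: "X \<ge> 0" "s \<ge> 0" for X s
  proof (cases "X \<le> \<tau> * s")
    case True
    then have "X powr (p - \<gamma>) * s powr \<gamma> \<le> (\<tau> * s) powr (p - \<gamma>) * s powr \<gamma>"
      using assms Xs by (intro mult_right_mono powr_mono2) auto
    also have "\<dots> = \<epsilon> * (s powr (p - \<gamma>) * s powr \<gamma>)" using \<tau> Xs by (simp add: powr_mult)
    also have "\<dots> = \<epsilon> * s powr p" by (simp flip: powr_add)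
    finally show ?thesis by (simp add: add_increasing2)
  next
    case False
    then have "s \<le> X / \<tau>" using \<tau> by (simp add: field_simps)
    then have "X powr (p - \<gamma>) * s powr \<gamma> \<le> X powr (p - \<gamma>) * (1 / \<tau> * X) powr \<gamma>"
      using assms Xs by (intro mult_left_mono powr_mono2) auto
    also have "\<dots> = (1 / \<tau>) powr \<gamma> * (X powr (p - \<gamma>) * X powr \<gamma>)"
      using \<tau>(1) Xs powr_mult[of "1 / \<tau>" X \<gamma>] by simp
    also have "X powr (p - \<gamma>) * X powr \<gamma> = X powr p" by (simp flip: powr_add)
    finally show ?thesis using assms Xs by (simp add: add_increasing)
  qed
  then show thesis by (intro that[of "(1 / \<tau>) powr \<gamma>"]) auto
qed

lemma primitive_0: "primitive f x 0 = 0"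
  by (simp add: primitive_def)

lemma primitive_has_derivative:
  assumes "continuous_on UNIV (f x)"
  shows "(primitive f x has_real_derivative f x t) (at t)"
proof -
  let ?a = "- \<bar>t\<bar> - 1" and ?b = "\<bar>t\<bar> + 1"
  have "((\<lambda>u. LBINT y=ereal 0..ereal u. f x y) has_vector_derivative f x t) (at t within {?a..?b})"
    by (rule interval_integral_FTC2) (use assms in \<open>auto intro: continuous_on_subset\<close>)
  moreover have "at t within {?a..?b} = at t"
    by (rule at_within_interior) (auto simp: interior_atLeastAtMost_real)
  ultimately show ?thesis
    by (simp add: primitive_def[abs_def] has_real_derivative_iff_has_vector_derivative)
qed

lemma primitive_measurable:
  assumes "continuous_on UNIV (\<lambda>(x :: 'a::euclidean_space, t). f x t)"
  shows "(\<lambda>(x, t). primitive f x t) \<in> borel_measurable (borel \<Otimes>\<^sub>M borel)"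
proof -
  have [measurable]: "(\<lambda>(x, t). f x t) \<in> borel_measurable (borel \<Otimes>\<^sub>M borel)"
    using borel_measurable_continuous_onI[OF assms] by (simp add: borel_prod)
  have eq: "primitive f x t = (if 0 \<le> t then (\<integral>s. (if 0 < s \<and> s < t then f x s else 0) \<partial>lborel)
      else - (\<integral>s. (if t < s \<and> s < 0 then f x s else 0) \<partial>lborel))" for x t
    unfolding primitive_def interval_lebesgue_integral_def set_lebesgue_integral_def
    by (auto simp: indicator_def einterval_def zero_ereal_def intro!: Bochner_Integration.integral_cong)
  have [measurable]: "(\<lambda>z :: ('a \<times> real) \<times> real. f (fst (fst z)) (snd z)) \<in> borel_measurable ((borel \<Otimes>\<^sub>M borel) \<Otimes>\<^sub>M lborel)"
  proof -
    have "(\<lambda>z :: ('a \<times> real) \<times> real. (fst (fst z), snd z)) \<in> (borel \<Otimes>\<^sub>M borel) \<Otimes>\<^sub>M lborel \<rightarrow>\<^sub>M borel \<Otimes>\<^sub>M borel"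
      by measurable
    from measurable_compose[OF this, of "\<lambda>(x, t). f x t" borel] show ?thesis by simp
  qed
  have "(\<lambda>z :: 'a \<times> real. \<integral>s. (if 0 < s \<and> s < snd z then f (fst z) s else 0) \<partial>lborel) \<in> borel_measurable (borel \<Otimes>\<^sub>M borel)"
    by (rule lborel.borel_measurable_lebesgue_integral) (simp add: case_prod_beta')
  moreover have "(\<lambda>z :: 'a \<times> real. \<integral>s. (if snd z < s \<and> s < 0 then f (fst z) s else 0) \<partial>lborel) \<in> borel_measurable (borel \<Otimes>\<^sub>M borel)"
    by (rule lborel.borel_measurable_lebesgue_integral) (simp add: case_prod_beta')
  ultimately show ?thesis
    unfolding eq case_prod_beta' by measurable
qed

lemma primitive_comp_measurable:
  assumes "continuous_on UNIV (\<lambda>(x :: 'a::euclidean_space, t). f x t)"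
    and "u \<in> borel_measurable borel"
  shows "(\<lambda>x. primitive f x (u x)) \<in> borel_measurable borel"
    "(\<lambda>x. f x (u x)) \<in> borel_measurable borel"
proof -
  have "(\<lambda>x. (x, u x)) \<in> borel \<rightarrow>\<^sub>M borel \<Otimes>\<^sub>M borel" using assms(2) by measurable
  from measurable_compose[OF this primitive_measurable[OF assms(1)]]
  show "(\<lambda>x. primitive f x (u x)) \<in> borel_measurable borel" by simp
  have "(\<lambda>(x, t). f x t) \<in> borel_measurable (borel \<Otimes>\<^sub>M borel)"
    using borel_measurable_continuous_onI[OF assms(1)] by (simp add: borel_prod)
  from measurable_compose[OF \<open>(\<lambda>x. (x, u x)) \<in> borel \<rightarrow>\<^sub>M borel \<Otimes>\<^sub>M borel\<close> this]
  show "(\<lambda>x. f x (u x)) \<in> borel_measurable borel" by simp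
qed

lemma lebesgue_borel_version:
  fixes u v :: "'a::euclidean_space \<Rightarrow> 'b::{banach, second_countable_topology}"
  assumes "AE x in lborel. u x = v x" and [measurable]: "v \<in> borel_measurable borel"
    and "u \<in> borel_measurable lebesgue"
  shows "integrable lebesgue u \<longleftrightarrow> integrable lborel v" "integral\<^sup>L lebesgue u = integral\<^sup>L lborel v"
proof -
  have v: "v \<in> borel_measurable lebesgue" by (intro measurable_completion) measurable
  have ae: "AE x in lebesgue. u x = v x" using assms(1) by (rule AE_completion)
  show "integrable lebesgue u \<longleftrightarrow> integrable lborel v"
    using integrable_cong_AE[OF assms(3) v ae] by (simp add: integrable_completion)
  show "integral\<^sup>L lebesgue u = integral\<^sup>L lborel v"
    using integral_cong_AE[OF assms(3) v ae] by (simp add: integral_completion)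
qed

text \<open>The function \<open>X i\<close> is \<open>\<xi>\<^sub>i\<close> to the power \<open>1/(p - \<gamma>\<^sub>i)\<close>, which lies in \<open>L\<^sup>p\<close>. In terms of it each
  growth term is homogeneous of degree \<open>p\<close>.\<close>

lemma cond_F1_homogeneous:
  fixes f :: "'a::euclidean_space \<Rightarrow> real \<Rightarrow> real"
  assumes p: "p > 1" and F1: "cond_F1 p f"
  obtains m :: nat and \<gamma> X where
    "\<And>i. i \<in> {1..m} \<Longrightarrow> 1 < \<gamma> i \<and> \<gamma> i < p"
    "\<And>i x. i \<in> {1..m} \<Longrightarrow> X i x \<ge> (0::real)"
    "\<And>i. i \<in> {1..m} \<Longrightarrow> integrable lborel (\<lambda>x. X i x powr p)"
    "AE x in lborel. \<forall>s t. \<bar>primitive f x s - primitive f x t\<bar>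
      \<le> (\<Sum>i=1..m. \<gamma> i * (X i x powr (p - \<gamma> i) * (\<bar>s - t\<bar> * (\<bar>s\<bar> + \<bar>t\<bar>) powr (\<gamma> i - 1))))"
proof -
  obtain m :: nat and \<gamma> :: "nat \<Rightarrow> real" and \<xi> where
    \<gamma>: "\<And>i. i \<in> {1..m} \<Longrightarrow> 1 < \<gamma> i \<and> \<gamma> i < p"
    and \<xi>: "\<And>i. i \<in> {1..m} \<Longrightarrow> \<xi> i \<in> Lp (p / (p - \<gamma> i))" "\<And>i x. i \<in> {1..m} \<Longrightarrow> \<xi> i x \<ge> 0"
    and bound: "\<And>x t. \<bar>f x t\<bar> \<le> (\<Sum>i=1..m. \<gamma> i * \<xi> i x * \<bar>t\<bar> powr (\<gamma> i - 1))"
    and cont: "continuous_on UNIV (\<lambda>(x, t). f x t)"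
    using F1 unfolding cond_F1_def by blast
  have "\<forall>i\<in>{1..m}. \<exists>\<xi>'\<in>borel_measurable lborel. AE x in lborel. \<xi> i x = \<xi>' x"
  proof
    fix i assume "i \<in> {1..m}"
    then have "\<xi> i \<in> borel_measurable lebesgue" using \<xi>(1) by (simp add: Lp_def)
    then show "\<exists>\<xi>'\<in>borel_measurable lborel. AE x in lborel. \<xi> i x = \<xi>' x"
      by (rule completion_ex_borel_measurable_real)
  qed
  then obtain \<xi>' where \<xi>'m: "\<And>i. i \<in> {1..m} \<Longrightarrow> \<xi>' i \<in> borel_measurable borel"
    and ae: "\<And>i. i \<in> {1..m} \<Longrightarrow> AE x in lborel. \<xi> i x = \<xi>' i x"
    unfolding bchoice_iff Ball_def by auto metis
  define X where "X i x = \<bar>\<xi>' i x\<bar> powr (1 / (p - \<gamma> i))" for i x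
  have Xp: "X i x powr p = \<bar>\<xi>' i x\<bar> powr (p / (p - \<gamma> i))" for i x by (simp add: X_def powr_powr)
  have Xi: "X i x powr (p - \<gamma> i) = \<bar>\<xi>' i x\<bar>" if "i \<in> {1..m}" for i x
    using \<gamma>[OF that] by (simp add: X_def powr_powr)
  have int: "integrable lborel (\<lambda>x. X i x powr p)" if i: "i \<in> {1..m}" for i
  proof -
    note [measurable] = \<xi>'m[OF i]
    have "integrable lebesgue (\<lambda>x. norm (\<xi> i x) powr (p / (p - \<gamma> i)))"
      "(\<lambda>x. norm (\<xi> i x) powr (p / (p - \<gamma> i))) \<in> borel_measurable lebesgue"
      using \<xi>(1)[OF i] by (auto simp: Lp_def)
    moreover have "AE x in lborel. norm (\<xi> i x) powr (p / (p - \<gamma> i)) = X i x powr p"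
      using ae[OF i] by eventually_elim (simp add: Xp)
    ultimately show ?thesis
      by (subst lebesgue_borel_version(1)[symmetric]) (auto simp: Xp)
  qed
  have all: "AE x in lborel. \<forall>i\<in>{1..m}. \<xi> i x = \<xi>' i x"
    using ae by (subst AE_ball_countable) auto
  have "AE x in lborel. \<forall>s t. \<bar>primitive f x s - primitive f x t\<bar>
      \<le> (\<Sum>i=1..m. \<gamma> i * (X i x powr (p - \<gamma> i) * (\<bar>s - t\<bar> * (\<bar>s\<bar> + \<bar>t\<bar>) powr (\<gamma> i - 1))))"
    using all
  proof eventually_elim
    case (elim x)
    have cx: "continuous_on UNIV (f x)"
    proof -
      have "continuous_on UNIV (\<lambda>t. (x, t))" by (intro continuous_intros)
      from continuous_on_compose2[OF cont this] show ?thesis by simp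
    qed
    show ?case
    proof (intro allI)
      fix s t :: real
      let ?L = "\<Sum>i=1..m. \<gamma> i * X i x powr (p - \<gamma> i) * (\<bar>s\<bar> + \<bar>t\<bar>) powr (\<gamma> i - 1)"
      have "norm (primitive f x s - primitive f x t) \<le> ?L * norm (s - t)"
      proof (rule field_differentiable_bound[of "closed_segment s t"])
        fix r assume r: "r \<in> closed_segment s t"
        show "(primitive f x has_field_derivative f x r) (at r within closed_segment s t)"
          using primitive_has_derivative[of f x, OF cx] by (rule has_field_derivative_at_within)
        have "\<bar>r\<bar> \<le> \<bar>s\<bar> + \<bar>t\<bar>" using r by (auto simp: closed_segment_eq_real_ivl split: if_splits)
        then have "\<gamma> i * \<xi> i x * \<bar>r\<bar> powr (\<gamma> i - 1)
            \<le> \<gamma> i * X i x powr (p - \<gamma> i) * (\<bar>s\<bar> + \<bar>t\<bar>) powr (\<gamma> i - 1)" if i: "i \<in> {1..m}" for i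
          using \<gamma>[OF i] elim i \<xi>(2)[OF i, of x] by (intro mult_mono powr_mono2) (auto simp: Xi[OF i])
        then have "(\<Sum>i=1..m. \<gamma> i * \<xi> i x * \<bar>r\<bar> powr (\<gamma> i - 1)) \<le> ?L" by (rule sum_mono)
        with bound[of x r] show "norm (f x r) \<le> ?L" by simp
      qed auto
      then show "\<bar>primitive f x s - primitive f x t\<bar>
        \<le> (\<Sum>i=1..m. \<gamma> i * (X i x powr (p - \<gamma> i) * (\<bar>s - t\<bar> * (\<bar>s\<bar> + \<bar>t\<bar>) powr (\<gamma> i - 1))))"
        by (simp add: sum_distrib_right sum_distrib_left mult_ac)
    qed
  qed
  with \<gamma> int show thesis by (intro that[of m \<gamma> X]) (auto simp: X_def)
qed

text \<open>The coefficient \<open>\<epsilon>\<close> may be as small as one likes because all exponents \<open>\<gamma> i\<close> lie below \<open>p\<close>. This is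
  used for coercivity and for the tails at infinity.\<close>

lemma primitive_growth:
  fixes f :: "'a::euclidean_space \<Rightarrow> real \<Rightarrow> real"
  assumes p: "p > 1" and F1: "cond_F1 p f" and \<epsilon>: "\<epsilon> > 0"
  obtains H where "integrable lborel H" "AE x in lborel. \<forall>s. \<bar>primitive f x s\<bar> \<le> \<epsilon> * \<bar>s\<bar> powr p + H x"
proof -
  obtain m :: nat and \<gamma> X where
    \<gamma>: "\<And>i. i \<in> {1..m} \<Longrightarrow> 1 < \<gamma> i \<and> \<gamma> i < p"
    and X: "\<And>i x. i \<in> {1..m} \<Longrightarrow> X i x \<ge> (0::real)"
    and int: "\<And>i. i \<in> {1..m} \<Longrightarrow> integrable lborel (\<lambda>x. X i x powr p)"
    and ae: "AE x in lborel. \<forall>s t. \<bar>primitive f x s - primitive f x t\<bar>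
      \<le> (\<Sum>i=1..m. \<gamma> i * (X i x powr (p - \<gamma> i) * (\<bar>s - t\<bar> * (\<bar>s\<bar> + \<bar>t\<bar>) powr (\<gamma> i - 1))))"
    using cond_F1_homogeneous[OF p F1] by blast
  define \<Gamma> where "\<Gamma> = (\<Sum>i=1..m. \<gamma> i)"
  have \<Gamma>: "\<Gamma> \<ge> 0" unfolding \<Gamma>_def using \<gamma> by (intro sum_nonneg) (force simp: less_imp_le)
  define e where "e = \<epsilon> / (1 + \<Gamma>)"
  have e: "e > 0" "\<Gamma> * e \<le> \<epsilon>" using \<epsilon> \<Gamma> by (auto simp: e_def field_simps)
  have "\<forall>i\<in>{1..m}. \<exists>C\<ge>0. \<forall>X\<ge>0. \<forall>s\<ge>0. X powr (p - \<gamma> i) * s powr \<gamma> i \<le> e * s powr p + C * X powr p"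
    using Young_two[OF _ _ e(1)] \<gamma> by metis
  then obtain C where C: "\<And>i X s. i \<in> {1..m} \<Longrightarrow> X \<ge> 0 \<Longrightarrow> s \<ge> 0 \<Longrightarrow>
      X powr (p - \<gamma> i) * s powr \<gamma> i \<le> e * s powr p + C i * X powr p"
    by metis
  show thesis
  proof (rule that)
    show "integrable lborel (\<lambda>x. \<Sum>i=1..m. \<gamma> i * (C i * X i x powr p))"
      by (intro Bochner_Integration.integrable_sum integrable_mult_right int)
    show "AE x in lborel. \<forall>s. \<bar>primitive f x s\<bar> \<le> \<epsilon> * \<bar>s\<bar> powr p + (\<Sum>i=1..m. \<gamma> i * (C i * X i x powr p))"
      using ae
    proof eventually_elim
      case (elim x)
      show ?case
      proof
        fix s
        have "\<bar>primitive f x s\<bar> \<le> (\<Sum>i=1..m. \<gamma> i * (X i x powr (p - \<gamma> i) * (\<bar>s\<bar> * \<bar>s\<bar> powr (\<gamma> i - 1))))"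
          using elim[rule_format, of s 0] by (simp add: primitive_0)
        also have "\<dots> \<le> (\<Sum>i=1..m. \<gamma> i * (e * \<bar>s\<bar> powr p + C i * X i x powr p))"
        proof (intro sum_mono mult_left_mono)
          fix i assume i: "i \<in> {1..m}"
          show "X i x powr (p - \<gamma> i) * (\<bar>s\<bar> * \<bar>s\<bar> powr (\<gamma> i - 1)) \<le> e * \<bar>s\<bar> powr p + C i * X i x powr p"
            using C[OF i X[OF i], of "\<bar>s\<bar>" x] by (simp add: powr_mult_base)
        qed (use \<gamma> in \<open>force simp: less_imp_le\<close>)
        also have "\<dots> = \<Gamma> * e * \<bar>s\<bar> powr p + (\<Sum>i=1..m. \<gamma> i * (C i * X i x powr p))"
          by (simp add: distrib_left sum.distrib \<Gamma>_def sum_distrib_left mult_ac)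
        also have "\<dots> \<le> \<epsilon> * \<bar>s\<bar> powr p + (\<Sum>i=1..m. \<gamma> i * (C i * X i x powr p))"
          using e(2) by (intro add_right_mono mult_right_mono) auto
        finally show "\<bar>primitive f x s\<bar> \<le> \<epsilon> * \<bar>s\<bar> powr p + (\<Sum>i=1..m. \<gamma> i * (C i * X i x powr p))" .
      qed
    qed
  qed
qed

text \<open>The first estimate is used where the arguments are close in \<open>L\<^sup>p\<close>; the second dominates the
  difference quotients in the Euler-Lagrange equation.\<close>

lemma primitive_difference:
  fixes f :: "'a::euclidean_space \<Rightarrow> real \<Rightarrow> real"
  assumes p: "p > 1" and F1: "cond_F1 p f"
  obtains H K where "integrable lborel H" "K \<ge> 0" "\<And>x. H x \<ge> 0"
    "AE x in lborel. \<forall>s t \<epsilon>. \<epsilon> > 0 \<longrightarrow> \<bar>primitive f x s - primitive f x t\<bar>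
      \<le> \<epsilon> * (H x + K * (\<bar>s\<bar> powr p + \<bar>t\<bar> powr p)) + K * \<epsilon> powr (1 - p) * \<bar>s - t\<bar> powr p"
    "AE x in lborel. \<forall>s d t. 0 < t \<and> t \<le> 1 \<longrightarrow> \<bar>primitive f x (s + t * d) - primitive f x s\<bar>
      \<le> t * (H x + K * (\<bar>s\<bar> powr p + \<bar>d\<bar> powr p))"
proof -
  obtain m :: nat and \<gamma> X where
    \<gamma>: "\<And>i. i \<in> {1..m} \<Longrightarrow> 1 < \<gamma> i \<and> \<gamma> i < p"
    and X: "\<And>i x. i \<in> {1..m} \<Longrightarrow> X i x \<ge> (0::real)"
    and int: "\<And>i. i \<in> {1..m} \<Longrightarrow> integrable lborel (\<lambda>x. X i x powr p)"
    and ae: "AE x in lborel. \<forall>s t. \<bar>primitive f x s - primitive f x t\<bar>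
      \<le> (\<Sum>i=1..m. \<gamma> i * (X i x powr (p - \<gamma> i) * (\<bar>s - t\<bar> * (\<bar>s\<bar> + \<bar>t\<bar>) powr (\<gamma> i - 1))))"
    using cond_F1_homogeneous[OF p F1] by blast
  define \<Gamma> where "\<Gamma> = (\<Sum>i=1..m. \<gamma> i)"
  have \<gamma>0: "\<gamma> i \<ge> 0" if "i \<in> {1..m}" for i using \<gamma>[OF that] by linarith
  have \<Gamma>: "\<Gamma> \<ge> 0" unfolding \<Gamma>_def using \<gamma>0 by (rule sum_nonneg)
  define H where "H x = (\<Sum>i=1..m. \<gamma> i * X i x powr p)" for x
  have iH: "integrable lborel H"
    unfolding H_def[abs_def] by (intro Bochner_Integration.integrable_sum integrable_mult_right int)
  define P where "P = 2 powr p * 2 powr p + (1::real)"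
  have P: "P \<ge> 1" by (simp add: P_def)
  have P2: "2 powr p \<le> P"
  proof -
    have "1 \<le> 2 powr p" using p by (intro ge_one_powr_ge_zero) auto
    then have "2 powr p * 1 \<le> 2 powr p * 2 powr p" by (intro mult_left_mono) auto
    then show ?thesis unfolding P_def by linarith
  qed
  \<comment> \<open>The common estimate of the sum, with \<open>D\<close> and \<open>S\<close> for the increment and the size of the arguments.\<close>
  have est: "(\<Sum>i=1..m. \<gamma> i * (X i x powr (p - \<gamma> i) * (D * S powr (\<gamma> i - 1))))
      \<le> \<epsilon> * (H x + \<Gamma> * S powr p) + \<Gamma> * \<epsilon> powr (1 - p) * D powr p"
    if "D \<ge> 0" "S \<ge> 0" "\<epsilon> > 0" for x D S \<epsilon>
  proof -
    have "(\<Sum>i=1..m. \<gamma> i * (X i x powr (p - \<gamma> i) * (D * S powr (\<gamma> i - 1))))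
        \<le> (\<Sum>i=1..m. \<gamma> i * (\<epsilon> * (X i x powr p + S powr p) + \<epsilon> powr (1 - p) * D powr p))"
      using \<gamma> X that \<gamma>0 by (intro sum_mono mult_left_mono Young_three) auto
    also have "\<dots> = \<epsilon> * (H x + \<Gamma> * S powr p) + \<Gamma> * \<epsilon> powr (1 - p) * D powr p"
      by (simp add: H_def \<Gamma>_def distrib_left sum.distrib sum_distrib_left sum_distrib_right mult_ac)
    finally show ?thesis .
  qed
  show thesis
  proof (rule that[OF iH])
    show "\<Gamma> * P \<ge> 0" using \<Gamma> P by simp
    show "H x \<ge> 0" for x unfolding H_def using \<gamma>0 by (intro sum_nonneg mult_nonneg_nonneg) auto
    show "AE x in lborel. \<forall>s t \<epsilon>. \<epsilon> > 0 \<longrightarrow> \<bar>primitive f x s - primitive f x t\<bar>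
      \<le> \<epsilon> * (H x + \<Gamma> * P * (\<bar>s\<bar> powr p + \<bar>t\<bar> powr p)) + \<Gamma> * P * \<epsilon> powr (1 - p) * \<bar>s - t\<bar> powr p"
      using ae
    proof eventually_elim
      case (elim x)
      show ?case
      proof (intro allI impI)
        fix s t \<epsilon> :: real assume \<epsilon>: "\<epsilon> > 0"
        have "\<bar>primitive f x s - primitive f x t\<bar>
            \<le> \<epsilon> * (H x + \<Gamma> * (\<bar>s\<bar> + \<bar>t\<bar>) powr p) + \<Gamma> * \<epsilon> powr (1 - p) * \<bar>s - t\<bar> powr p"
          using order_trans[OF elim[rule_format, of s t] est[of "\<bar>s - t\<bar>" "\<bar>s\<bar> + \<bar>t\<bar>" \<epsilon> x]] \<epsilon> by simp
        also have "\<dots> \<le> \<epsilon> * (H x + \<Gamma> * (P * (\<bar>s\<bar> powr p + \<bar>t\<bar> powr p))) + \<Gamma> * P * \<epsilon> powr (1 - p) * \<bar>s - t\<bar> powr p"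
        proof (intro add_mono mult_left_mono mult_right_mono order_refl)
          have "(\<bar>s\<bar> + \<bar>t\<bar>) powr p \<le> 2 powr p * (\<bar>s\<bar> powr p + \<bar>t\<bar> powr p)"
            using p by (intro powr_add_le) auto
          also have "\<dots> \<le> P * (\<bar>s\<bar> powr p + \<bar>t\<bar> powr p)" using P2 by (intro mult_right_mono) auto
          finally show "(\<bar>s\<bar> + \<bar>t\<bar>) powr p \<le> P * (\<bar>s\<bar> powr p + \<bar>t\<bar> powr p)" .
          show "\<Gamma> \<le> \<Gamma> * P" using \<Gamma> P by (simp add: mult_le_cancel_left1)
        qed (use \<Gamma> \<epsilon> in auto)
        finally show "\<bar>primitive f x s - primitive f x t\<bar>
            \<le> \<epsilon> * (H x + \<Gamma> * P * (\<bar>s\<bar> powr p + \<bar>t\<bar> powr p)) + \<Gamma> * P * \<epsilon> powr (1 - p) * \<bar>s - t\<bar> powr p"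
          by (simp add: mult.assoc)
      qed
    qed
    show "AE x in lborel. \<forall>s d t. 0 < t \<and> t \<le> 1 \<longrightarrow> \<bar>primitive f x (s + t * d) - primitive f x s\<bar>
      \<le> t * (H x + \<Gamma> * P * (\<bar>s\<bar> powr p + \<bar>d\<bar> powr p))"
      using ae
    proof eventually_elim
      case (elim x)
      show ?case
      proof (intro allI impI)
        fix s d t :: real assume t: "0 < t \<and> t \<le> 1"
        let ?S = "2 * \<bar>s\<bar> + \<bar>d\<bar>"
        have S: "\<bar>s + t * d\<bar> + \<bar>s\<bar> \<le> ?S"
        proof -
          have "t * \<bar>d\<bar> \<le> \<bar>d\<bar>" using t by (simp add: mult_left_le_one_le)
          then show ?thesis using abs_triangle_ineq[of s "t * d"] t by (simp add: abs_mult)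
        qed
        have "\<bar>primitive f x (s + t * d) - primitive f x s\<bar>
            \<le> (\<Sum>i=1..m. \<gamma> i * (X i x powr (p - \<gamma> i) * (\<bar>t * d\<bar> * (\<bar>s + t * d\<bar> + \<bar>s\<bar>) powr (\<gamma> i - 1))))"
          using elim[rule_format, of "s + t * d" s] by simp
        also have "\<dots> \<le> (\<Sum>i=1..m. \<gamma> i * (X i x powr (p - \<gamma> i) * (\<bar>t * d\<bar> * ?S powr (\<gamma> i - 1))))"
        proof (intro sum_mono mult_left_mono powr_mono2 S)
          show "0 \<le> \<gamma> i - 1" if "i \<in> {1..m}" for i using \<gamma>[OF that] by simp
        qed (use \<gamma>0 in auto)
        also have "\<dots> = t * (\<Sum>i=1..m. \<gamma> i * (X i x powr (p - \<gamma> i) * (\<bar>d\<bar> * ?S powr (\<gamma> i - 1))))"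
          using t by (simp add: sum_distrib_left abs_mult mult_ac)
        also have "\<dots> \<le> t * (H x + \<Gamma> * P * (\<bar>s\<bar> powr p + \<bar>d\<bar> powr p))"
        proof (rule mult_left_mono)
          have "?S powr p \<le> 2 powr p * ((2 * \<bar>s\<bar>) powr p + \<bar>d\<bar> powr p)"
            using p by (intro powr_add_le) auto
          also have "(2 * \<bar>s\<bar>) powr p = 2 powr p * \<bar>s\<bar> powr p" by (simp add: powr_mult)
          finally have "?S powr p + \<bar>d\<bar> powr p \<le> P * (\<bar>s\<bar> powr p + \<bar>d\<bar> powr p)"
          proof (rule order_trans[OF add_right_mono])
            have "2 powr p * 1 \<le> 2 powr p * 2 powr p"
              using p by (intro mult_left_mono ge_one_powr_ge_zero) auto
            then have "2 powr p * \<bar>d\<bar> powr p \<le> 2 powr p * 2 powr p * \<bar>d\<bar> powr p"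
              by (intro mult_right_mono) auto
            then show "2 powr p * (2 powr p * \<bar>s\<bar> powr p + \<bar>d\<bar> powr p) + \<bar>d\<bar> powr p \<le> P * (\<bar>s\<bar> powr p + \<bar>d\<bar> powr p)"
              by (simp add: P_def algebra_simps add_increasing)
          qed
          then have "\<Gamma> * (?S powr p + \<bar>d\<bar> powr p) \<le> \<Gamma> * (P * (\<bar>s\<bar> powr p + \<bar>d\<bar> powr p))"
            using \<Gamma> by (rule mult_left_mono)
          then show "(\<Sum>i=1..m. \<gamma> i * (X i x powr (p - \<gamma> i) * (\<bar>d\<bar> * ?S powr (\<gamma> i - 1))))
              \<le> H x + \<Gamma> * P * (\<bar>s\<bar> powr p + \<bar>d\<bar> powr p)"
            using est[of "\<bar>d\<bar>" ?S 1 x] by (simp add: algebra_simps)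
        qed (use t in auto)
        finally show "\<bar>primitive f x (s + t * d) - primitive f x s\<bar>
          \<le> t * (H x + \<Gamma> * P * (\<bar>s\<bar> powr p + \<bar>d\<bar> powr p))" .
      qed
    qed
  qed
qed

lemma primitive_integrable:
  fixes f :: "'a::euclidean_space \<Rightarrow> real \<Rightarrow> real"
  assumes p: "p > 1" and F1: "cond_F1 p f" and u: "u \<in> borel_measurable borel"
    and int: "integrable lborel (\<lambda>x. \<bar>u x\<bar> powr p)"
  shows "integrable lborel (\<lambda>x. primitive f x (u x))"
proof -
  obtain H where H: "integrable lborel H" "AE x in lborel. \<forall>s. \<bar>primitive f x s\<bar> \<le> 1 * \<bar>s\<bar> powr p + H x"
    by (rule primitive_growth[OF p F1 zero_less_one])
  have "integrable lborel (\<lambda>x. \<bar>u x\<bar> powr p + H x)" using int H(1) by auto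
  then show ?thesis
  proof (rule Bochner_Integration.integrable_bound)
    show "(\<lambda>x. primitive f x (u x)) \<in> borel_measurable lborel"
      using primitive_comp_measurable(1)[OF _ u] F1 by (simp add: cond_F1_def)
    show "AE x in lborel. norm (primitive f x (u x)) \<le> norm (\<bar>u x\<bar> powr p + H x)"
      using H(2)
    proof eventually_elim
      case (elim x)
      show ?case using elim[rule_format, of "u x"] unfolding real_norm_def by linarith
    qed
  qed
qed

text \<open>Inside a large ball the local convergence makes the difference small, outside it the integrable
  part of the growth bound does.\<close>

lemma primitive_integral_close:
  fixes f :: "'a::euclidean_space \<Rightarrow> real \<Rightarrow> real"
  assumes p: "p > 1" and F1: "cond_F1 p f" and M: "M \<ge> 0" and e: "e > 0"
  obtains R \<eta> where "\<eta> > 0"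
    "\<And>u v. u \<in> borel_measurable borel \<Longrightarrow> v \<in> borel_measurable borel \<Longrightarrow>
      integrable lborel (\<lambda>x. \<bar>u x\<bar> powr p) \<Longrightarrow> integrable lborel (\<lambda>x. \<bar>v x\<bar> powr p) \<Longrightarrow>
      (\<integral>x. \<bar>u x\<bar> powr p \<partial>lborel) \<le> M \<Longrightarrow> (\<integral>x. \<bar>v x\<bar> powr p \<partial>lborel) \<le> M \<Longrightarrow>
      (\<integral>x. indicator (cball 0 R) x * \<bar>u x - v x\<bar> powr p \<partial>lborel) \<le> \<eta> \<Longrightarrow>
      \<bar>(\<integral>x. primitive f x (u x) \<partial>lborel) - (\<integral>x. primitive f x (v x) \<partial>lborel)\<bar> < e"
proof -
  obtain H K where H: "integrable lborel H" "K \<ge> 0" "\<And>x. H x \<ge> 0"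
    and ae: "AE x in lborel. \<forall>s t \<epsilon>. \<epsilon> > 0 \<longrightarrow> \<bar>primitive f x s - primitive f x t\<bar>
      \<le> \<epsilon> * (H x + K * (\<bar>s\<bar> powr p + \<bar>t\<bar> powr p)) + K * \<epsilon> powr (1 - p) * \<bar>s - t\<bar> powr p"
    by (rule primitive_difference[OF p F1]) (rule that)
  define B where "B = (\<integral>x. H x \<partial>lborel) + 2 * K * M + 2 * M"
  have B: "B \<ge> 0" unfolding B_def using H M
    by (intro add_nonneg_nonneg Bochner_Integration.integral_nonneg) auto
  define \<epsilon> where "\<epsilon> = e / (4 * (B + 1))"
  have \<epsilon>: "\<epsilon> > 0" "\<epsilon> * B < e / 4 + 0" using e B by (auto simp: \<epsilon>_def divide_simps)
  obtain T where T: "integrable lborel T" "AE x in lborel. \<forall>s. \<bar>primitive f x s\<bar> \<le> \<epsilon> * \<bar>s\<bar> powr p + T x"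
    using primitive_growth[OF p F1 \<epsilon>(1)] by blast
  have [measurable]: "T \<in> borel_measurable borel" "H \<in> borel_measurable borel"
    using T(1) H(1) by auto
  have [measurable]: "cball (0::'a) R \<in> sets borel" for R by simp
  have "(\<lambda>n. \<integral>x. indicator (- cball 0 (real n)) x * \<bar>T x\<bar> \<partial>lborel) \<longlonglongrightarrow> (\<integral>x. 0 \<partial>(lborel :: 'a measure))"
  proof (rule integral_dominated_convergence[where w="\<lambda>x. \<bar>T x\<bar>"])
    show "AE x in lborel. (\<lambda>n. indicator (- cball 0 (real n)) x * \<bar>T x\<bar>) \<longlonglongrightarrow> 0"
    proof (intro AE_I2 tendsto_eventually)
      fix x :: 'a
      obtain N where "norm x \<le> real N" using real_arch_simple by blast
      then have "indicator (- cball 0 (real n)) x * \<bar>T x\<bar> = 0" if "n \<ge> N" for n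
        using that by (auto simp: indicator_def)
      then show "\<forall>\<^sub>F n in sequentially. indicator (- cball 0 (real n)) x * \<bar>T x\<bar> = 0"
        unfolding eventually_sequentially by blast
    qed
  qed (use T(1) in \<open>auto simp: indicator_def\<close>)
  then have "\<forall>\<^sub>F n in sequentially. (\<integral>x. indicator (- cball 0 (real n)) x * \<bar>T x\<bar> \<partial>lborel) < e / 8"
    by (rule order_tendstoD) (use e in auto)
  then obtain n where n: "(\<integral>x. indicator (- cball 0 (real n)) x * \<bar>T x\<bar> \<partial>lborel) < e / 8"
    by (auto dest!: eventually_happens)
  define R where "R = real n"
  define \<eta> where "\<eta> = e / (4 * (K * \<epsilon> powr (1 - p) + 1))"
  have K\<epsilon>: "K * \<epsilon> powr (1 - p) \<ge> 0" using H(2) by simp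
  then have \<eta>: "\<eta> > 0" "K * \<epsilon> powr (1 - p) * \<eta> \<le> e / 4"
    using e by (auto simp: \<eta>_def divide_simps)
  show thesis
  proof (rule that[OF \<eta>(1)])
    fix u v :: "'a \<Rightarrow> real"
    assume [measurable]: "u \<in> borel_measurable borel" "v \<in> borel_measurable borel"
      and iu: "integrable lborel (\<lambda>x. \<bar>u x\<bar> powr p)" and iv: "integrable lborel (\<lambda>x. \<bar>v x\<bar> powr p)"
      and uM: "(\<integral>x. \<bar>u x\<bar> powr p \<partial>lborel) \<le> M" and vM: "(\<integral>x. \<bar>v x\<bar> powr p \<partial>lborel) \<le> M"
      and uv: "(\<integral>x. indicator (cball 0 R) x * \<bar>u x - v x\<bar> powr p \<partial>lborel) \<le> \<eta>"
    have iuv: "integrable lborel (\<lambda>x. indicator (cball 0 R) x * \<bar>u x - v x\<bar> powr p)"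
      using integrable_mult_indicator[OF _ integrable_norm_diff_powr[OF p _ _ iu[folded real_norm_def] iv[folded real_norm_def]], of "cball 0 R"]
      by simp
    have iT: "integrable lborel (\<lambda>x. indicator (- cball 0 R) x * \<bar>T x\<bar>)"
      using integrable_mult_indicator[OF _ integrable_abs[OF T(1)], of "- cball 0 R"] by simp
    have iFu: "integrable lborel (\<lambda>x. primitive f x (u x))" and iFv: "integrable lborel (\<lambda>x. primitive f x (v x))"
      by (intro primitive_integrable[OF p F1] iu iv; measurable)+
    let ?b = "\<lambda>x. \<epsilon> * (H x + K * (\<bar>u x\<bar> powr p + \<bar>v x\<bar> powr p) + (\<bar>u x\<bar> powr p + \<bar>v x\<bar> powr p))
      + K * \<epsilon> powr (1 - p) * (indicator (cball 0 R) x * \<bar>u x - v x\<bar> powr p)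
      + 2 * (indicator (- cball 0 R) x * \<bar>T x\<bar>)"
    have ib: "integrable lborel ?b" using iu iv H(1) iuv iT by auto
    have "\<bar>(\<integral>x. primitive f x (u x) \<partial>lborel) - (\<integral>x. primitive f x (v x) \<partial>lborel)\<bar>
        = \<bar>\<integral>x. primitive f x (u x) - primitive f x (v x) \<partial>lborel\<bar>"
      using iFu iFv by simp
    also have "\<dots> \<le> (\<integral>x. \<bar>primitive f x (u x) - primitive f x (v x)\<bar> \<partial>lborel)"
      by (rule integral_abs_bound)
    also have "\<dots> \<le> (\<integral>x. ?b x \<partial>lborel)"
    proof (rule integral_mono_AE)
      show "AE x in lborel. \<bar>primitive f x (u x) - primitive f x (v x)\<bar> \<le> ?b x"
        using ae T(2)
      proof eventually_elim
        case (elim x)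
        show ?case
        proof (cases "x \<in> cball 0 R")
          case True
          have "\<epsilon> * (\<bar>u x\<bar> powr p + \<bar>v x\<bar> powr p) \<ge> 0" using \<epsilon> by simp
          then show ?thesis using elim(1)[rule_format, OF \<epsilon>(1), of "u x" "v x"] True by (simp add: distrib_left)
        next
          case False
          have "\<bar>primitive f x (u x) - primitive f x (v x)\<bar> \<le> \<epsilon> * (\<bar>u x\<bar> powr p + \<bar>v x\<bar> powr p) + 2 * \<bar>T x\<bar>"
            using elim(2)[rule_format, of "u x"] elim(2)[rule_format, of "v x"] by (simp add: distrib_left)
          moreover have "\<epsilon> * (H x + K * (\<bar>u x\<bar> powr p + \<bar>v x\<bar> powr p)) \<ge> 0"
            using \<epsilon> H by (intro mult_nonneg_nonneg add_nonneg_nonneg) auto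
          ultimately show ?thesis using False by (simp add: distrib_left)
        qed
      qed
    qed (use ib iFu iFv in auto)
    also have "\<dots> = \<epsilon> * ((\<integral>x. H x \<partial>lborel) + K * ((\<integral>x. \<bar>u x\<bar> powr p \<partial>lborel) + (\<integral>x. \<bar>v x\<bar> powr p \<partial>lborel))
          + ((\<integral>x. \<bar>u x\<bar> powr p \<partial>lborel) + (\<integral>x. \<bar>v x\<bar> powr p \<partial>lborel)))
        + K * \<epsilon> powr (1 - p) * (\<integral>x. indicator (cball 0 R) x * \<bar>u x - v x\<bar> powr p \<partial>lborel)
        + 2 * (\<integral>x. indicator (- cball 0 R) x * \<bar>T x\<bar> \<partial>lborel)"
      using iu iv H(1) iuv iT by simp
    also have "\<dots> \<le> \<epsilon> * B + K * \<epsilon> powr (1 - p) * \<eta> + 2 * (e / 8)"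
    proof (intro add_mono mult_left_mono)
      have "K * ((\<integral>x. \<bar>u x\<bar> powr p \<partial>lborel) + (\<integral>x. \<bar>v x\<bar> powr p \<partial>lborel)) \<le> K * (2 * M)"
        using uM vM H(2) by (intro mult_left_mono) auto
      then show "(\<integral>x. H x \<partial>lborel) + K * ((\<integral>x. \<bar>u x\<bar> powr p \<partial>lborel) + (\<integral>x. \<bar>v x\<bar> powr p \<partial>lborel))
          + ((\<integral>x. \<bar>u x\<bar> powr p \<partial>lborel) + (\<integral>x. \<bar>v x\<bar> powr p \<partial>lborel)) \<le> B"
        using uM vM by (simp add: B_def)
    qed (use \<epsilon> K\<epsilon> uv n in \<open>auto simp: R_def\<close>)
    also have "\<dots> < e" using \<epsilon>(2) \<eta>(2) e by linarith
    finally show "\<bar>(\<integral>x. primitive f x (u x) \<partial>lborel) - (\<integral>x. primitive f x (v x) \<partial>lborel)\<bar> < e" .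
  qed
qed

section \<open>The energy\<close>

lemma loc_integrable_lincomb:
  assumes "loc_integrable y" "loc_integrable z"
  shows "loc_integrable (\<lambda>x. a *\<^sub>R y x + b *\<^sub>R z x)"
  unfolding loc_integrable_def
proof (intro conjI allI)
  have [measurable]: "y \<in> borel_measurable borel" "z \<in> borel_measurable borel"
    using assms by (auto dest: loc_integrable_measurable)
  show "(\<lambda>x. a *\<^sub>R y x + b *\<^sub>R z x) \<in> borel_measurable borel" by measurable
  fix R
  have "integrable lborel (\<lambda>x. a *\<^sub>R (indicator (cball 0 R) x *\<^sub>R y x) + b *\<^sub>R (indicator (cball 0 R) x *\<^sub>R z x))"
    using assms by (intro Bochner_Integration.integrable_add integrable_scaleR_right) (auto simp: loc_integrable_def)
  then show "integrable lborel (\<lambda>x. indicator (cball 0 R) x *\<^sub>R (a *\<^sub>R y x + b *\<^sub>R z x))"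
    by (simp add: scaleR_add_right mult.commute)
qed

lemma weak_gradient_lincomb:
  assumes "weak_gradient u g" "weak_gradient v h"
  shows "weak_gradient (\<lambda>x. a * u x + b * v x) (\<lambda>x. a *\<^sub>R g x + b *\<^sub>R h x)"
proof -
  have li: "loc_integrable u" "loc_integrable v" "loc_integrable g" "loc_integrable h"
    using assms by (auto simp: weak_gradient_def)
  note comb = loc_integrable_lincomb
  show ?thesis
    unfolding weak_gradient_def
  proof (intro conjI allI impI ballI)
    show "loc_integrable (\<lambda>x. a * u x + b * v x)" using comb[OF li(1,2), of a b] by simp
    show "loc_integrable (\<lambda>x. a *\<^sub>R g x + b *\<^sub>R h x)" by (rule comb[OF li(3,4)])
    fix \<phi> e assume \<phi>: "test_function (\<phi> :: 'a \<Rightarrow> real)" and e: "(e::'a) \<in> Basis"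
    note i = integrable_times_test[OF li(1) test_function_pderiv_dir[OF \<phi> e]]
      integrable_times_test[OF li(2) test_function_pderiv_dir[OF \<phi> e]]
      integrable_times_test[OF loc_integrable_inner[OF li(3), of e] \<phi>]
      integrable_times_test[OF loc_integrable_inner[OF li(4), of e] \<phi>]
    have "(\<integral>x. (a * u x + b * v x) * pderiv_dir e \<phi> x \<partial>lborel)
        = a * (\<integral>x. u x * pderiv_dir e \<phi> x \<partial>lborel) + b * (\<integral>x. v x * pderiv_dir e \<phi> x \<partial>lborel)"
      using i by (simp add: distrib_right mult.assoc)
    also have "\<dots> = - (a * (\<integral>x. (g x \<bullet> e) * \<phi> x \<partial>lborel) + b * (\<integral>x. (h x \<bullet> e) * \<phi> x \<partial>lborel))"
      using assms \<phi> e by (simp add: weak_gradient_def)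
    also have "a * (\<integral>x. (g x \<bullet> e) * \<phi> x \<partial>lborel) + b * (\<integral>x. (h x \<bullet> e) * \<phi> x \<partial>lborel)
        = (\<integral>x. ((a *\<^sub>R g x + b *\<^sub>R h x) \<bullet> e) * \<phi> x \<partial>lborel)"
      using i by (simp add: inner_add_left distrib_right mult.assoc)
    finally show "(\<integral>x. (a * u x + b * v x) * pderiv_dir e \<phi> x \<partial>lborel)
        = - (\<integral>x. ((a *\<^sub>R g x + b *\<^sub>R h x) \<bullet> e) * \<phi> x \<partial>lborel)" .
  qed
qed

lemma weak_laplacian_lincomb:
  assumes "weak_laplacian u w" "weak_laplacian v z"
  shows "weak_laplacian (\<lambda>x. a * u x + b * v x) (\<lambda>x. a * w x + b * z x)"
proof -
  have li: "loc_integrable u" "loc_integrable v" "loc_integrable w" "loc_integrable z"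
    using assms by (auto simp: weak_laplacian_def)
  have comb: "loc_integrable (\<lambda>x. a * y x + b * z x)"
    if "loc_integrable y" "loc_integrable z" for y z :: "'a \<Rightarrow> real"
    using loc_integrable_lincomb[OF that, of a b] by simp
  show ?thesis
    unfolding weak_laplacian_def
  proof (intro conjI allI impI comb li)
    fix \<phi> assume \<phi>: "test_function (\<phi> :: 'a \<Rightarrow> real)"
    note i = integrable_times_test[OF li(1) test_function_laplacian[OF \<phi>]]
      integrable_times_test[OF li(2) test_function_laplacian[OF \<phi>]]
      integrable_times_test[OF li(3) \<phi>] integrable_times_test[OF li(4) \<phi>]
    show "(\<integral>x. (a * u x + b * v x) * laplacian \<phi> x \<partial>lborel) = (\<integral>x. (a * w x + b * z x) * \<phi> x \<partial>lborel)"
      using i assms \<phi> by (simp add: weak_laplacian_def distrib_right mult.assoc)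
  qed
qed

text \<open>Borel representatives \<open>g\<close> and \<open>w\<close> of the weak gradient and the weak Laplacian accompany each
  function \<open>u\<close>, so that linear combinations and limits of such triples need no choice of derivatives.\<close>

definition finite_energy ::
    "real \<Rightarrow> ('a::euclidean_space \<Rightarrow> real) \<Rightarrow> ('a \<Rightarrow> real) \<Rightarrow> ('a \<Rightarrow> 'a) \<Rightarrow> ('a \<Rightarrow> real) \<Rightarrow> bool" where
  "finite_energy p V u g w \<longleftrightarrow> weak_gradient u g \<and> weak_laplacian u w \<and>
     integrable lborel (\<lambda>x. \<bar>u x\<bar> powr p) \<and> integrable lborel (\<lambda>x. norm (g x) powr p) \<and>
     integrable lborel (\<lambda>x. \<bar>w x\<bar> powr p) \<and> integrable lborel (\<lambda>x. V x * \<bar>u x\<bar> powr p)"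

definition energy_density ::
    "real \<Rightarrow> real \<Rightarrow> ('a::euclidean_space \<Rightarrow> real) \<Rightarrow> ('a \<Rightarrow> real) \<Rightarrow> ('a \<Rightarrow> 'a) \<Rightarrow> ('a \<Rightarrow> real) \<Rightarrow> 'a \<Rightarrow> real" where
  "energy_density p lam V u g w x = \<bar>w x\<bar> powr p + norm (g x) powr p + lam * V x * \<bar>u x\<bar> powr p"

definition energy ::
    "real \<Rightarrow> real \<Rightarrow> ('a::euclidean_space \<Rightarrow> real) \<Rightarrow> ('a \<Rightarrow> real) \<Rightarrow> ('a \<Rightarrow> 'a) \<Rightarrow> ('a \<Rightarrow> real) \<Rightarrow> real" where
  "energy p lam V u g w = (\<integral>x. energy_density p lam V u g w x \<partial>lborel)"

definition action ::
    "real \<Rightarrow> real \<Rightarrow> ('a::euclidean_space \<Rightarrow> real) \<Rightarrow> ('a \<Rightarrow> real \<Rightarrow> real) \<Rightarrow>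
      ('a \<Rightarrow> real) \<Rightarrow> ('a \<Rightarrow> 'a) \<Rightarrow> ('a \<Rightarrow> real) \<Rightarrow> real" where
  "action p lam V f u g w = energy p lam V u g w / p - (\<integral>x. primitive f x (u x) \<partial>lborel)"

lemma finite_energyD:
  assumes "finite_energy p V u g w"
  shows "u \<in> borel_measurable borel" "g \<in> borel_measurable borel" "w \<in> borel_measurable borel"
    "weak_gradient u g" "weak_laplacian u w"
    "integrable lborel (\<lambda>x. \<bar>u x\<bar> powr p)" "integrable lborel (\<lambda>x. norm (g x) powr p)"
    "integrable lborel (\<lambda>x. \<bar>w x\<bar> powr p)" "integrable lborel (\<lambda>x. V x * \<bar>u x\<bar> powr p)"
    "integrable lborel (energy_density p lam V u g w)"
proof -
  show *: "integrable lborel (\<lambda>x. norm (g x) powr p)" "integrable lborel (\<lambda>x. \<bar>w x\<bar> powr p)"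
    "integrable lborel (\<lambda>x. V x * \<bar>u x\<bar> powr p)"
    using assms by (auto simp: finite_energy_def)
  have "integrable lborel (\<lambda>x. lam * (V x * \<bar>u x\<bar> powr p))" using *(3) by (rule integrable_mult_right)
  then show "integrable lborel (energy_density p lam V u g w)"
    using * unfolding energy_density_def[abs_def] by (intro Bochner_Integration.integrable_add) (auto simp: mult.assoc)
qed (use assms in \<open>auto simp: finite_energy_def weak_gradient_def weak_laplacian_def dest: loc_integrable_measurable\<close>)

lemma norm_lincomb_powr_le:
  fixes y z :: "'b::real_normed_vector"
  assumes "p > 1"
  shows "norm (a *\<^sub>R y + b *\<^sub>R z) powr p \<le> 2 powr p * (\<bar>a\<bar> powr p * norm y powr p + \<bar>b\<bar> powr p * norm z powr p)"
  using norm_add_powr_le[of p "a *\<^sub>R y" "b *\<^sub>R z"] assms by (simp add: powr_mult)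

locale energy_setting =
  fixes p lam :: real and V :: "'a::euclidean_space \<Rightarrow> real" and f :: "'a \<Rightarrow> real \<Rightarrow> real"
  assumes p: "p > 1" and lam: "lam > 0" and V_cont: "continuous_on UNIV V" and V_nonneg: "V x \<ge> 0"
    and V2: "cond_V2 V" and F1: "cond_F1 p f"
begin

lemma V_measurable[measurable]: "V \<in> borel_measurable borel"
  using V_cont by (rule borel_measurable_continuous_onI)

abbreviation "fin \<equiv> finite_energy p V"
abbreviation "dens \<equiv> energy_density p lam V"
abbreviation "\<Phi> \<equiv> energy p lam V"
abbreviation "\<G> u \<equiv> (\<integral>x. primitive f x (u x) \<partial>lborel)"
abbreviation "\<A> \<equiv> action p lam V f"

lemma energy_density_nonneg: "dens u g w x \<ge> 0"
  using lam V_nonneg[of x] by (simp add: energy_density_def)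

lemma energy_nonneg: "\<Phi> u g w \<ge> 0"
  unfolding energy_def by (intro Bochner_Integration.integral_nonneg energy_density_nonneg)

lemma finite_energy_lincomb:
  assumes T: "fin u g w" and T': "fin u' g' w'"
  shows "fin (\<lambda>x. a * u x + b * u' x) (\<lambda>x. a *\<^sub>R g x + b *\<^sub>R g' x) (\<lambda>x. a * w x + b * w' x)"
proof -
  note D = finite_energyD[OF T] and D' = finite_energyD[OF T']
  note [measurable] = D(1-3) D'(1-3)
  have int: "integrable lborel (\<lambda>x. \<rho> x * norm (a *\<^sub>R y x + b *\<^sub>R z x) powr p)"
    if i: "integrable lborel (\<lambda>x. \<rho> x * norm (y x) powr p)" "integrable lborel (\<lambda>x. \<rho> x * norm (z x) powr p)"
      and [measurable]: "y \<in> borel_measurable borel" "z \<in> borel_measurable borel" "\<rho> \<in> borel_measurable borel"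
      and \<rho>: "\<And>x. \<rho> x \<ge> 0"
    for y z :: "'a \<Rightarrow> 'c::euclidean_space" and \<rho> :: "'a \<Rightarrow> real"
  proof (rule Bochner_Integration.integrable_bound)
    show "integrable lborel (\<lambda>x. 2 powr p * (\<bar>a\<bar> powr p * (\<rho> x * norm (y x) powr p) + \<bar>b\<bar> powr p * (\<rho> x * norm (z x) powr p)))"
      using i by auto
    show "AE x in lborel. norm (\<rho> x * norm (a *\<^sub>R y x + b *\<^sub>R z x) powr p)
        \<le> norm (2 powr p * (\<bar>a\<bar> powr p * (\<rho> x * norm (y x) powr p) + \<bar>b\<bar> powr p * (\<rho> x * norm (z x) powr p)))"
    proof (rule AE_I2)
      fix x
      have "\<rho> x * norm (a *\<^sub>R y x + b *\<^sub>R z x) powr p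
          \<le> \<rho> x * (2 powr p * (\<bar>a\<bar> powr p * norm (y x) powr p + \<bar>b\<bar> powr p * norm (z x) powr p))"
        using \<rho> p by (intro mult_left_mono norm_lincomb_powr_le) auto
      also have "\<dots> = 2 powr p * (\<bar>a\<bar> powr p * (\<rho> x * norm (y x) powr p) + \<bar>b\<bar> powr p * (\<rho> x * norm (z x) powr p))"
        by (simp add: algebra_simps)
      finally show "norm (\<rho> x * norm (a *\<^sub>R y x + b *\<^sub>R z x) powr p)
          \<le> norm (2 powr p * (\<bar>a\<bar> powr p * (\<rho> x * norm (y x) powr p) + \<bar>b\<bar> powr p * (\<rho> x * norm (z x) powr p)))"
        using \<rho>[of x] by simp
    qed
  qed measurable
  show ?thesis
    unfolding finite_energy_def
  proof (intro conjI weak_gradient_lincomb weak_laplacian_lincomb D(4,5) D'(4,5))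
    show "integrable lborel (\<lambda>x. \<bar>a * u x + b * u' x\<bar> powr p)"
      using int[of "\<lambda>_. 1" u u'] D(6) D'(6) by simp
    show "integrable lborel (\<lambda>x. norm (a *\<^sub>R g x + b *\<^sub>R g' x) powr p)"
      using int[of "\<lambda>_. 1" g g'] D(7) D'(7) by simp
    show "integrable lborel (\<lambda>x. \<bar>a * w x + b * w' x\<bar> powr p)"
      using int[of "\<lambda>_. 1" w w'] D(8) D'(8) by simp
    show "integrable lborel (\<lambda>x. V x * \<bar>a * u x + b * u' x\<bar> powr p)"
      using int[of V u u'] D(9) D'(9) V_nonneg by simp
  qed
qed

lemma finite_energy_diff:
  assumes "fin u g w" "fin u' g' w'"
  shows "fin (\<lambda>x. u x - u' x) (\<lambda>x. g x - g' x) (\<lambda>x. w x - w' x)"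
  using finite_energy_lincomb[OF assms, of 1 "-1"] by simp

lemma finite_energy_mid:
  assumes "fin u g w" "fin u' g' w'"
  shows "fin (\<lambda>x. (u x + u' x) /\<^sub>R 2) (\<lambda>x. (g x + g' x) /\<^sub>R 2) (\<lambda>x. (w x + w' x) /\<^sub>R 2)"
  using finite_energy_lincomb[OF assms, of "inverse 2" "inverse 2"] by (simp add: scaleR_add_right distrib_left)

text \<open>Where \<open>V \<ge> b\<close> the potential term controls \<open>u\<close>; the rest has finite measure.\<close>

lemma energy_controls_Lp:
  obtains C where "C > 0" "\<And>u g w. fin u g w \<Longrightarrow> (\<integral>x. \<bar>u x\<bar> powr p \<partial>lborel) \<le> C * \<Phi> u g w"
proof -
  obtain b where b: "b > 0" "{x. V x < b} \<in> lmeasurable"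
    using V2 by (auto simp: cond_V2_def)
  define A where "A = {x. V x < b}"
  have [measurable]: "A \<in> sets borel"
  proof -
    have "open A" unfolding A_def using V_cont by (intro open_Collect_less) auto
    then show ?thesis by simp
  qed
  have "emeasure lborel A < \<infinity>"
    using b(2) unfolding A_def[symmetric] fmeasurable_def by simp
  then obtain C where C: "C > 0" "\<And>u g. weak_gradient u g \<Longrightarrow> integrable lborel (\<lambda>x. \<bar>u x\<bar> powr p) \<Longrightarrow>
    integrable lborel (\<lambda>x. norm (g x) powr p) \<Longrightarrow>
    (\<integral>x. \<bar>u x\<bar> powr p \<partial>lborel)
      \<le> C * ((\<integral>x. norm (g x) powr p \<partial>lborel) + (\<integral>x. indicator (- A) x * \<bar>u x\<bar> powr p \<partial>lborel))"
    by (rule Poincare_finite_measure[OF \<open>A \<in> sets borel\<close> _ p]) blast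
  show thesis
  proof (rule that)
    show "C * (1 + 1 / (lam * b)) > 0" using C(1) lam b by (intro mult_pos_pos add_pos_pos) auto
    fix u g w assume T: "fin u g w"
    note D = finite_energyD[OF T]
    note [measurable] = D(1-3)
    have "(\<integral>x. norm (g x) powr p \<partial>lborel) \<le> \<Phi> u g w"
      unfolding energy_def
      by (rule integral_mono[OF D(7) D(10)]) (use lam V_nonneg in \<open>simp add: energy_density_def\<close>)
    moreover have "(\<integral>x. indicator (- A) x * \<bar>u x\<bar> powr p \<partial>lborel) \<le> (\<integral>x. 1 / (lam * b) * dens u g w x \<partial>lborel)"
    proof (rule integral_mono)
      show "integrable lborel (\<lambda>x. indicator (- A) x * \<bar>u x\<bar> powr p)"
        using integrable_mult_indicator[OF _ D(6), of "- A"] by simp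
      show "integrable lborel (\<lambda>x. 1 / (lam * b) * dens u g w x)" using D(10) by (rule integrable_mult_right)
      fix x
      show "indicator (- A) x * \<bar>u x\<bar> powr p \<le> 1 / (lam * b) * dens u g w x"
      proof (cases "x \<in> A")
        case False
        then have "lam * b * \<bar>u x\<bar> powr p \<le> lam * V x * \<bar>u x\<bar> powr p"
          using lam by (intro mult_right_mono mult_left_mono) (auto simp: A_def)
        also have "\<dots> \<le> dens u g w x" by (simp add: energy_density_def)
        finally show ?thesis using False lam b by (simp add: field_simps)
      next
        case True
        then show ?thesis using energy_density_nonneg[of u g w x] lam b by simp
      qed
    qed
    ultimately have "C * ((\<integral>x. norm (g x) powr p \<partial>lborel) + (\<integral>x. indicator (- A) x * \<bar>u x\<bar> powr p \<partial>lborel))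
        \<le> C * (\<Phi> u g w + 1 / (lam * b) * \<Phi> u g w)"
      using C(1) by (intro mult_left_mono add_mono) (auto simp: energy_def)
    with C(2)[OF D(4,6,7)] show "(\<integral>x. \<bar>u x\<bar> powr p \<partial>lborel) \<le> C * (1 + 1 / (lam * b)) * \<Phi> u g w"
      by (simp add: algebra_simps)
  qed
qed

text \<open>The nonlinear term absorbs at most half of the energy.\<close>

lemma action_coercive:
  obtains c where "\<And>u g w. fin u g w \<Longrightarrow> \<Phi> u g w / (2 * p) - c \<le> \<A> u g w"
proof -
  obtain C where C: "C > 0" "\<And>u g w. fin u g w \<Longrightarrow> (\<integral>x. \<bar>u x\<bar> powr p \<partial>lborel) \<le> C * \<Phi> u g w"
    by (rule energy_controls_Lp) blast
  define \<epsilon> where "\<epsilon> = 1 / (2 * p * C)"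
  have \<epsilon>: "\<epsilon> > 0" using p C by (simp add: \<epsilon>_def)
  obtain H where H: "integrable lborel H" "AE x in lborel. \<forall>s. \<bar>primitive f x s\<bar> \<le> \<epsilon> * \<bar>s\<bar> powr p + H x"
    by (rule primitive_growth[OF p F1 \<epsilon>])
  show thesis
  proof (rule that)
    fix u g w assume T: "fin u g w"
    note D = finite_energyD[OF T]
    have "\<G> u \<le> (\<integral>x. \<epsilon> * \<bar>u x\<bar> powr p + H x \<partial>lborel)"
    proof (rule integral_mono_AE)
      show "integrable lborel (\<lambda>x. primitive f x (u x))" by (rule primitive_integrable[OF p F1 D(1,6)])
      show "integrable lborel (\<lambda>x. \<epsilon> * \<bar>u x\<bar> powr p + H x)" using D(6) H(1) by auto
      show "AE x in lborel. primitive f x (u x) \<le> \<epsilon> * \<bar>u x\<bar> powr p + H x"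
        using H(2)
      proof eventually_elim
        case (elim x)
        show ?case using elim[rule_format, of "u x"] by linarith
      qed
    qed
    also have "\<dots> = \<epsilon> * (\<integral>x. \<bar>u x\<bar> powr p \<partial>lborel) + (\<integral>x. H x \<partial>lborel)" using D(6) H(1) by simp
    also have "\<dots> \<le> \<epsilon> * (C * \<Phi> u g w) + (\<integral>x. H x \<partial>lborel)"
      using C(2)[OF T] \<epsilon> by (intro add_right_mono mult_left_mono) auto
    also have "\<epsilon> * (C * \<Phi> u g w) = \<Phi> u g w / (2 * p)" using C(1) by (simp add: \<epsilon>_def)
    finally have le: "\<G> u \<le> \<Phi> u g w / (2 * p) + (\<integral>x. H x \<partial>lborel)" .
    show "\<Phi> u g w / (2 * p) - (\<integral>x. H x \<partial>lborel) \<le> \<A> u g w"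
    proof -
      have "\<Phi> u g w / p = \<Phi> u g w / (2 * p) + \<Phi> u g w / (2 * p)" using p by simp
      then show ?thesis using le unfolding action_def by linarith
    qed
  qed
qed

text \<open>The pointwise inequality \<open>uniform_convexity\<close>, applied to each of the three terms and integrated.\<close>

lemma energy_uniformly_convex:
  assumes \<epsilon>: "\<epsilon> > 0"
  obtains C where "C \<ge> 0" "\<And>u g w u' g' w'. fin u g w \<Longrightarrow> fin u' g' w' \<Longrightarrow>
    \<Phi> (\<lambda>x. u x - u' x) (\<lambda>x. g x - g' x) (\<lambda>x. w x - w' x)
      \<le> \<epsilon> * (\<Phi> u g w + \<Phi> u' g' w') + C * ((\<Phi> u g w + \<Phi> u' g' w') / 2
          - \<Phi> (\<lambda>x. (u x + u' x) /\<^sub>R 2) (\<lambda>x. (g x + g' x) /\<^sub>R 2) (\<lambda>x. (w x + w' x) /\<^sub>R 2))"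
proof -
  obtain C1 where C1: "C1 \<ge> 0" "\<And>a b :: real. norm (a - b) powr p
      \<le> \<epsilon> * (norm a powr p + norm b powr p) + C1 * convexity_gap p a b"
    by (rule uniform_convexity[OF p \<epsilon>]) blast
  obtain C2 where C2: "C2 \<ge> 0" "\<And>a b :: 'a. norm (a - b) powr p
      \<le> \<epsilon> * (norm a powr p + norm b powr p) + C2 * convexity_gap p a b"
    by (rule uniform_convexity[OF p \<epsilon>]) blast
  define C where "C = C1 + C2"
  have c1: "\<bar>a - b\<bar> powr p \<le> \<epsilon> * (\<bar>a\<bar> powr p + \<bar>b\<bar> powr p) + C * convexity_gap p a b" for a b :: real
  proof -
    have "C1 * convexity_gap p a b \<le> C * convexity_gap p a b"
      using convexity_gap_nonneg[OF p, of a b] C2(1) by (intro mult_right_mono) (auto simp: C_def)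
    then show ?thesis using C1(2)[of a b] unfolding real_norm_def by linarith
  qed
  have c2: "norm (a - b) powr p \<le> \<epsilon> * (norm a powr p + norm b powr p) + C * convexity_gap p a b" for a b :: 'a
  proof -
    have "C2 * convexity_gap p a b \<le> C * convexity_gap p a b"
      using convexity_gap_nonneg[OF p, of a b] C1(1) by (intro mult_right_mono) (auto simp: C_def)
    then show ?thesis using C2(2)[of a b] by linarith
  qed
  show thesis
  proof (rule that)
    show "C \<ge> 0" using C1 C2 by (simp add: C_def)
    fix u g w u' g' w' assume T: "fin u g w" and T': "fin u' g' w'"
    let ?d = "dens (\<lambda>x. u x - u' x) (\<lambda>x. g x - g' x) (\<lambda>x. w x - w' x)"
    let ?m = "dens (\<lambda>x. (u x + u' x) /\<^sub>R 2) (\<lambda>x. (g x + g' x) /\<^sub>R 2) (\<lambda>x. (w x + w' x) /\<^sub>R 2)"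
    note i = finite_energyD(10)[OF T, of lam] finite_energyD(10)[OF T', of lam]
      finite_energyD(10)[OF finite_energy_mid[OF T T'], of lam]
    have "(\<integral>x. ?d x \<partial>lborel) \<le> (\<integral>x. \<epsilon> * (dens u g w x + dens u' g' w' x)
        + C * ((dens u g w x + dens u' g' w' x) / 2 - ?m x) \<partial>lborel)"
    proof (rule integral_mono)
      show "integrable lborel ?d" by (rule finite_energyD(10)[OF finite_energy_diff[OF T T']])
      show "integrable lborel (\<lambda>x. \<epsilon> * (dens u g w x + dens u' g' w' x)
        + C * ((dens u g w x + dens u' g' w' x) / 2 - ?m x))" using i by auto
      fix x
      have "lam * V x * \<bar>u x - u' x\<bar> powr p \<le> lam * V x * (\<epsilon> * (\<bar>u x\<bar> powr p + \<bar>u' x\<bar> powr p) + C * convexity_gap p (u x) (u' x))"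
        using lam V_nonneg[of x] by (intro mult_left_mono c1) auto
      then have "?d x \<le> (\<epsilon> * (\<bar>w x\<bar> powr p + \<bar>w' x\<bar> powr p) + C * convexity_gap p (w x) (w' x))
          + (\<epsilon> * (norm (g x) powr p + norm (g' x) powr p) + C * convexity_gap p (g x) (g' x))
          + lam * V x * (\<epsilon> * (\<bar>u x\<bar> powr p + \<bar>u' x\<bar> powr p) + C * convexity_gap p (u x) (u' x))"
        unfolding energy_density_def by (intro add_mono c1 c2)
      also have "\<dots> = \<epsilon> * (dens u g w x + dens u' g' w' x)
        + C * ((dens u g w x + dens u' g' w' x) / 2 - ?m x)"
        unfolding energy_density_def convexity_gap_def real_norm_def by algebra
      finally show "?d x \<le> \<epsilon> * (dens u g w x + dens u' g' w' x)
        + C * ((dens u g w x + dens u' g' w' x) / 2 - ?m x)" .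
    qed
    also have "\<dots> = \<epsilon> * (\<Phi> u g w + \<Phi> u' g' w') + C * ((\<Phi> u g w + \<Phi> u' g' w') / 2
          - \<Phi> (\<lambda>x. (u x + u' x) /\<^sub>R 2) (\<lambda>x. (g x + g' x) /\<^sub>R 2) (\<lambda>x. (w x + w' x) /\<^sub>R 2))"
      using i unfolding energy_def by simp
    finally show "\<Phi> (\<lambda>x. u x - u' x) (\<lambda>x. g x - g' x) (\<lambda>x. w x - w' x)
      \<le> \<epsilon> * (\<Phi> u g w + \<Phi> u' g' w') + C * ((\<Phi> u g w + \<Phi> u' g' w') / 2
          - \<Phi> (\<lambda>x. (u x + u' x) /\<^sub>R 2) (\<lambda>x. (g x + g' x) /\<^sub>R 2) (\<lambda>x. (w x + w' x) /\<^sub>R 2))"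
      by (simp add: energy_def)
  qed
qed

end

section \<open>Existence of a minimiser\<close>

context energy_setting
begin

lemma finite_energy_zero: "fin (\<lambda>_. 0) (\<lambda>_. 0) (\<lambda>_. 0)"
  using p by (simp add: finite_energy_def weak_gradient_def weak_laplacian_def loc_integrable_def)

lemma energy_parts_le:
  assumes T: "fin u g w"
  shows "(\<integral>x. norm (g x) powr p \<partial>lborel) \<le> \<Phi> u g w" "(\<integral>x. \<bar>w x\<bar> powr p \<partial>lborel) \<le> \<Phi> u g w"
  unfolding energy_def using V_nonneg lam
  by (auto intro!: integral_mono finite_energyD(7,8,10)[OF T] simp: energy_density_def)

text \<open>Coercivity bounds a minimising sequence, and the Rellich theorem selects a subsequence that converges
  locally.\<close>

lemma minimising_sequence:
  obtains u g w M c where "\<And>n :: nat. fin (u n) (g n) (w n)" "M \<ge> 0"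
    "\<And>n. (\<integral>x. \<bar>u n x\<bar> powr p \<partial>lborel) \<le> M" "\<And>n. \<Phi> (u n) (g n) (w n) \<le> M"
    "(\<lambda>n. \<A> (u n) (g n) (w n)) \<longlonglongrightarrow> c"
    "\<And>u g w. fin u g w \<Longrightarrow> c \<le> \<A> u g w"
    "\<And>R \<epsilon>. \<epsilon> > 0 \<Longrightarrow> \<exists>N. \<forall>i\<ge>N. \<forall>j\<ge>N.
      (\<integral>x. indicator (cball 0 R) x * \<bar>u i x - u j x\<bar> powr p \<partial>lborel) \<le> \<epsilon>"
proof -
  obtain c0 where c0: "\<And>u g w. fin u g w \<Longrightarrow> \<Phi> u g w / (2 * p) - c0 \<le> \<A> u g w"
    by (rule action_coercive) blast
  obtain C where C: "C > 0" "\<And>u g w. fin u g w \<Longrightarrow> (\<integral>x. \<bar>u x\<bar> powr p \<partial>lborel) \<le> C * \<Phi> u g w"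
    by (rule energy_controls_Lp) blast
  define S where "S = {a. \<exists>u g w. fin u g w \<and> a = \<A> u g w}"
  have S: "S \<noteq> {}" using finite_energy_zero by (auto simp: S_def)
  have "- c0 \<le> a" if a: "a \<in> S" for a
  proof -
    obtain u g w where T: "fin u g w" "a = \<A> u g w" using a by (auto simp: S_def)
    have "\<Phi> u g w / (2 * p) \<ge> 0" using energy_nonneg p by simp
    then show ?thesis using c0[OF T(1)] T(2) by linarith
  qed
  then have bdd: "bdd_below S" unfolding bdd_below_def by blast
  define c where "c = Inf S"
  have c_le: "c \<le> \<A> u g w" if "fin u g w" for u g w
    unfolding c_def using that by (intro cInf_lower bdd) (auto simp: S_def)
  have "\<exists>T. fin (fst T) (fst (snd T)) (snd (snd T)) \<and> \<A> (fst T) (fst (snd T)) (snd (snd T)) < c + 1 / real (Suc n)" for n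
  proof -
    obtain a where "a \<in> S" "a < c + 1 / real (Suc n)"
      using cInf_lessD[OF S, of "c + 1 / real (Suc n)"] by (auto simp: c_def)
    then obtain u g w where "fin u g w" "\<A> u g w < c + 1 / real (Suc n)" by (auto simp: S_def)
    then show ?thesis by (intro exI[of _ "(u, g, w)"]) simp
  qed
  then obtain T where T: "\<And>n. fin (fst (T n)) (fst (snd (T n))) (snd (snd (T n)))"
    "\<And>n. \<A> (fst (T n)) (fst (snd (T n))) (snd (snd (T n))) < c + 1 / real (Suc n)" by metis
  define u where "u n = fst (T n)" for n
  define g where "g n = fst (snd (T n))" for n
  define w where "w n = snd (snd (T n))" for n
  have fin: "fin (u n) (g n) (w n)" for n using T(1) by (simp add: u_def g_def w_def)
  have A_less: "\<A> (u n) (g n) (w n) < c + 1 / real (Suc n)" for n using T(2) by (simp add: u_def g_def w_def)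
  define M1 where "M1 = 2 * p * (c + 1 + c0)"
  have \<Phi>_le: "\<Phi> (u n) (g n) (w n) \<le> M1" for n
  proof -
    have "1 / real (Suc n) \<le> 1" by simp
    then have "\<Phi> (u n) (g n) (w n) / (2 * p) \<le> c + 1 + c0"
      using c0[OF fin, of n] A_less[of n] by linarith
    then show ?thesis using p by (simp add: M1_def field_simps)
  qed
  define M where "M = max M1 (C * M1)"
  have M: "M \<ge> 0" using energy_nonneg[of "u 0" "g 0" "w 0"] \<Phi>_le[of 0] by (simp add: M_def)
  have \<Phi>M: "\<Phi> (u n) (g n) (w n) \<le> M" for n using \<Phi>_le[of n] by (simp add: M_def)
  have uM: "(\<integral>x. \<bar>u n x\<bar> powr p \<partial>lborel) \<le> M" for n
  proof -
    have "(\<integral>x. \<bar>u n x\<bar> powr p \<partial>lborel) \<le> C * \<Phi> (u n) (g n) (w n)" by (rule C(2)[OF fin])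
    also have "\<dots> \<le> C * M1" using C(1) \<Phi>_le by (intro mult_left_mono) auto
    finally show ?thesis by (simp add: M_def)
  qed
  note D = finite_energyD[OF fin]
  obtain r :: "nat \<Rightarrow> nat" where r: "strict_mono r"
    "\<And>R \<epsilon>. \<epsilon> > 0 \<Longrightarrow> \<exists>N. \<forall>i\<ge>N. \<forall>j\<ge>N.
      (\<integral>\<^sup>+x. indicator (cball 0 R) x * ennreal (\<bar>u (r i) x - u (r j) x\<bar> powr p) \<partial>lborel) \<le> ennreal \<epsilon>"
  proof (rule Rellich[of u g, OF D(4) p M])
    show "(\<integral>\<^sup>+x. ennreal (\<bar>u n x\<bar> powr p) \<partial>lborel) \<le> ennreal M" for n
      using uM[of n] by (subst nn_integral_eq_integral[OF D(6)]) (auto intro: ennreal_leI)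
    show "(\<integral>\<^sup>+x. ennreal (norm (g n x) powr p) \<partial>lborel) \<le> ennreal M" for n
      using order_trans[OF energy_parts_le(1)[OF fin] \<Phi>M, of n]
      by (subst nn_integral_eq_integral[OF D(7)]) (auto intro: ennreal_leI)
  qed blast
  show thesis
  proof (rule that[of "u \<circ> r" "g \<circ> r" "w \<circ> r" M c])
    have "(\<lambda>n. \<A> (u n) (g n) (w n)) \<longlonglongrightarrow> c"
    proof (rule tendsto_sandwich[OF always_eventually always_eventually])
      show "\<forall>n. c \<le> \<A> (u n) (g n) (w n)" using c_le fin by blast
      show "\<forall>n. \<A> (u n) (g n) (w n) \<le> c + 1 / real (Suc n)" using A_less by (intro allI less_imp_le)
      show "(\<lambda>n. c + 1 / real (Suc n)) \<longlonglongrightarrow> c"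
        using tendsto_add[OF tendsto_const LIMSEQ_inverse_real_of_nat, of c] by (simp add: inverse_eq_divide)
    qed simp
    from LIMSEQ_subseq_LIMSEQ[OF this r(1)]
    show "(\<lambda>n. \<A> ((u \<circ> r) n) ((g \<circ> r) n) ((w \<circ> r) n)) \<longlonglongrightarrow> c" by (simp add: o_def)
    fix R \<epsilon> :: real assume \<epsilon>: "\<epsilon> > 0"
    obtain N where N: "\<And>i j. i \<ge> N \<Longrightarrow> j \<ge> N \<Longrightarrow>
      (\<integral>\<^sup>+x. indicator (cball 0 R) x * ennreal (\<bar>u (r i) x - u (r j) x\<bar> powr p) \<partial>lborel) \<le> ennreal \<epsilon>"
      using r(2)[OF \<epsilon>, of R] by blast
    have "(\<integral>x. indicator (cball 0 R) x * \<bar>(u \<circ> r) i x - (u \<circ> r) j x\<bar> powr p \<partial>lborel) \<le> \<epsilon>"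
      if ij: "i \<ge> N" "j \<ge> N" for i j
    proof -
      have i: "integrable lborel (\<lambda>x. indicator (cball 0 R) x * \<bar>u (r i) x - u (r j) x\<bar> powr p)"
        using integrable_mult_indicator[OF _ finite_energyD(6)[OF finite_energy_diff[OF fin[of "r i"] fin[of "r j"]]], of "cball 0 R"]
        by simp
      have "ennreal (\<integral>x. indicator (cball 0 R) x * \<bar>u (r i) x - u (r j) x\<bar> powr p \<partial>lborel)
          = (\<integral>\<^sup>+x. ennreal (indicator (cball 0 R) x * \<bar>u (r i) x - u (r j) x\<bar> powr p) \<partial>lborel)"
        by (rule nn_integral_eq_integral[OF i, symmetric]) auto
      also have "\<dots> = (\<integral>\<^sup>+x. indicator (cball 0 R) x * ennreal (\<bar>u (r i) x - u (r j) x\<bar> powr p) \<partial>lborel)"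
        by (intro nn_integral_cong) (auto simp: indicator_def)
      also have "\<dots> \<le> ennreal \<epsilon>" by (rule N[OF ij])
      finally show ?thesis using \<epsilon> by (simp add: ennreal_le_iff less_imp_le)
    qed
    then show "\<exists>N. \<forall>i\<ge>N. \<forall>j\<ge>N.
      (\<integral>x. indicator (cball 0 R) x * \<bar>(u \<circ> r) i x - (u \<circ> r) j x\<bar> powr p \<partial>lborel) \<le> \<epsilon>" by blast
  qed (use fin M uM \<Phi>M c_le in auto)
qed

text \<open>By the local convergence the nonlinear term has almost the same value at two late members of the
  sequence and at their midpoint. As the midpoint cannot lie below the infimum, the convex part of the
  action has almost no convexity gap there.\<close>

lemma minimising_sequence_Cauchy:
  assumes fin: "\<And>n :: nat. fin (u n) (g n) (w n)" and M: "M \<ge> 0"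
    and uM: "\<And>n. (\<integral>x. \<bar>u n x\<bar> powr p \<partial>lborel) \<le> M" and \<Phi>M: "\<And>n. \<Phi> (u n) (g n) (w n) \<le> M"
    and lim: "(\<lambda>n. \<A> (u n) (g n) (w n)) \<longlonglongrightarrow> c"
    and c_le: "\<And>u g w. fin u g w \<Longrightarrow> c \<le> \<A> u g w"
    and loc: "\<And>R \<epsilon>. \<epsilon> > 0 \<Longrightarrow> \<exists>N. \<forall>i\<ge>N. \<forall>j\<ge>N.
      (\<integral>x. indicator (cball 0 R) x * \<bar>u i x - u j x\<bar> powr p \<partial>lborel) \<le> \<epsilon>"
    and e: "e > 0"
  shows "\<exists>N. \<forall>i\<ge>N. \<forall>j\<ge>N. \<Phi> (\<lambda>x. u i x - u j x) (\<lambda>x. g i x - g j x) (\<lambda>x. w i x - w j x) \<le> e"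
proof -
  note D = finite_energyD[OF fin]
  define \<epsilon> where "\<epsilon> = e / (4 * (M + 1))"
  have \<epsilon>: "\<epsilon> > 0" "\<epsilon> * (2 * M) \<le> e / 2" using e M by (auto simp: \<epsilon>_def divide_simps)
  obtain C where C: "C \<ge> 0" "\<And>u g w u' g' w'. fin u g w \<Longrightarrow> fin u' g' w' \<Longrightarrow>
    \<Phi> (\<lambda>x. u x - u' x) (\<lambda>x. g x - g' x) (\<lambda>x. w x - w' x)
      \<le> \<epsilon> * (\<Phi> u g w + \<Phi> u' g' w') + C * ((\<Phi> u g w + \<Phi> u' g' w') / 2
          - \<Phi> (\<lambda>x. (u x + u' x) /\<^sub>R 2) (\<lambda>x. (g x + g' x) /\<^sub>R 2) (\<lambda>x. (w x + w' x) /\<^sub>R 2))"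
    by (rule energy_uniformly_convex[OF \<epsilon>(1)]) blast
  define e0 where "e0 = e / (4 * p * (C + 1))"
  have e0: "e0 > 0" "C * (p * (2 * e0)) \<le> e / 2"
  proof -
    have "C * (p * (2 * e0)) = (C / (C + 1)) * (e / 2)" using p by (simp add: e0_def divide_simps)
    also have "\<dots> \<le> 1 * (e / 2)" using C(1) e by (intro mult_right_mono) auto
    finally show "C * (p * (2 * e0)) \<le> e / 2" by simp
    show "e0 > 0" unfolding e0_def using e C(1) p by (intro divide_pos_pos mult_pos_pos) auto
  qed
  obtain R \<eta> where \<eta>: "\<eta> > 0" and close:
    "\<And>u v. u \<in> borel_measurable borel \<Longrightarrow> v \<in> borel_measurable borel \<Longrightarrow>
      integrable lborel (\<lambda>x. \<bar>u x\<bar> powr p) \<Longrightarrow> integrable lborel (\<lambda>x. \<bar>v x\<bar> powr p) \<Longrightarrow>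
      (\<integral>x. \<bar>u x\<bar> powr p \<partial>lborel) \<le> M \<Longrightarrow> (\<integral>x. \<bar>v x\<bar> powr p \<partial>lborel) \<le> M \<Longrightarrow>
      (\<integral>x. indicator (cball 0 R) x * \<bar>u x - v x\<bar> powr p \<partial>lborel) \<le> \<eta> \<Longrightarrow>
      \<bar>\<G> u - \<G> v\<bar> < e0"
    by (rule primitive_integral_close[OF p F1 M e0(1)]) blast
  obtain N1 where N1: "\<And>i j. i \<ge> N1 \<Longrightarrow> j \<ge> N1 \<Longrightarrow>
      (\<integral>x. indicator (cball 0 R) x * \<bar>u i x - u j x\<bar> powr p \<partial>lborel) \<le> \<eta>"
    using loc[OF \<eta>, of R] by blast
  have "\<forall>\<^sub>F n in sequentially. \<A> (u n) (g n) (w n) < c + e0"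
    using lim by (rule order_tendstoD) (use e0 in auto)
  then obtain N2 where N2: "\<And>n. n \<ge> N2 \<Longrightarrow> \<A> (u n) (g n) (w n) < c + e0"
    by (auto simp: eventually_sequentially)
  have "\<Phi> (\<lambda>x. u i x - u j x) (\<lambda>x. g i x - g j x) (\<lambda>x. w i x - w j x) \<le> e"
    if i: "i \<ge> max N1 N2" and j: "j \<ge> max N1 N2" for i j
  proof -
    let ?u = "\<lambda>x. (u i x + u j x) /\<^sub>R 2" and ?g = "\<lambda>x. (g i x + g j x) /\<^sub>R 2" and ?w = "\<lambda>x. (w i x + w j x) /\<^sub>R 2"
    have mid: "fin ?u ?g ?w" by (rule finite_energy_mid[OF fin fin])
    note Dm = finite_energyD[OF mid]
    have uM': "(\<integral>x. \<bar>?u x\<bar> powr p \<partial>lborel) \<le> M"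
    proof -
      have "(\<integral>x. \<bar>?u x\<bar> powr p \<partial>lborel) \<le> (\<integral>x. (\<bar>u i x\<bar> powr p + \<bar>u j x\<bar> powr p) / 2 \<partial>lborel)"
      proof (rule integral_mono[OF Dm(6)])
        show "integrable lborel (\<lambda>x. (\<bar>u i x\<bar> powr p + \<bar>u j x\<bar> powr p) / 2)" using D(6) by auto
        show "\<bar>?u x\<bar> powr p \<le> (\<bar>u i x\<bar> powr p + \<bar>u j x\<bar> powr p) / 2" for x
          using convexity_gap_nonneg[OF p, of "u i x" "u j x"] unfolding convexity_gap_def real_norm_def by linarith
      qed
      also have "\<dots> = ((\<integral>x. \<bar>u i x\<bar> powr p \<partial>lborel) + (\<integral>x. \<bar>u j x\<bar> powr p \<partial>lborel)) / 2"
        using D(6) by simp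
      also have "\<dots> \<le> M" using uM[of i] uM[of j] by simp
      finally show ?thesis .
    qed
    have half: "\<bar>\<G> (u k) - \<G> ?u\<bar> < e0" if k: "k = i \<or> k = j" for k
    proof (rule close[OF D(1) Dm(1) D(6) Dm(6) uM uM'])
      have "(\<integral>x. indicator (cball 0 R) x * \<bar>u k x - ?u x\<bar> powr p \<partial>lborel)
          \<le> (\<integral>x. indicator (cball 0 R) x * \<bar>u i x - u j x\<bar> powr p \<partial>lborel)"
      proof (rule integral_mono)
        show "integrable lborel (\<lambda>x. indicator (cball 0 R) x * \<bar>u k x - ?u x\<bar> powr p)"
          using integrable_mult_indicator[OF _ finite_energyD(6)[OF finite_energy_diff[OF fin[of k] mid]], of "cball 0 R"] by simp
        show "integrable lborel (\<lambda>x. indicator (cball 0 R) x * \<bar>u i x - u j x\<bar> powr p)"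
          using integrable_mult_indicator[OF _ finite_energyD(6)[OF finite_energy_diff[OF fin[of i] fin[of j]]], of "cball 0 R"] by simp
        fix x
        have "\<bar>u k x - ?u x\<bar> \<le> \<bar>u i x - u j x\<bar>" using k by (auto simp: abs_if field_simps)
        then show "indicator (cball 0 R) x * \<bar>u k x - ?u x\<bar> powr p \<le> indicator (cball 0 R) x * \<bar>u i x - u j x\<bar> powr p"
          using p by (intro mult_left_mono powr_mono2) auto
      qed
      also have "\<dots> \<le> \<eta>" using i j by (intro N1) auto
      finally show "(\<integral>x. indicator (cball 0 R) x * \<bar>u k x - ?u x\<bar> powr p \<partial>lborel) \<le> \<eta>" .
    qed
    let ?gap = "(\<Phi> (u i) (g i) (w i) + \<Phi> (u j) (g j) (w j)) / 2 - \<Phi> ?u ?g ?w"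
    have \<Phi>_eq: "\<Phi> u g w = p * (\<A> u g w + \<G> u)" for u g w
      using p by (simp add: action_def)
    have "(\<A> (u i) (g i) (w i) + \<G> (u i) + (\<A> (u j) (g j) (w j) + \<G> (u j))) / 2 - (\<A> ?u ?g ?w + \<G> ?u) \<le> 2 * e0"
    proof -
      have "\<A> (u i) (g i) (w i) < c + e0" "\<A> (u j) (g j) (w j) < c + e0" using N2 i j by auto
      moreover have "(a + x + (b + y)) / 2 - (m + z) \<le> 2 * d"
        if "a < c + d" "b < c + d" "c \<le> m" "\<bar>x - z\<bar> < d" "\<bar>y - z\<bar> < d" for a b m x y z d :: real
        using that unfolding abs_less_iff by (simp add: field_simps)
      ultimately show ?thesis
        using c_le[OF mid] half[OF disjI1[OF refl]] half[OF disjI2[OF refl]] by presburger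
    qed
    then have "p * ((\<A> (u i) (g i) (w i) + \<G> (u i) + (\<A> (u j) (g j) (w j) + \<G> (u j))) / 2 - (\<A> ?u ?g ?w + \<G> ?u)) \<le> p * (2 * e0)"
      using p by (intro mult_left_mono) auto
    then have "?gap \<le> p * (2 * e0)" unfolding \<Phi>_eq by (simp add: algebra_simps)
    then have "C * ?gap \<le> C * (p * (2 * e0))" using C(1) by (rule mult_left_mono)
    moreover have "\<epsilon> * (\<Phi> (u i) (g i) (w i) + \<Phi> (u j) (g j) (w j)) \<le> \<epsilon> * (2 * M)"
      using \<epsilon>(1) \<Phi>M[of i] \<Phi>M[of j] by (intro mult_left_mono) auto
    ultimately show ?thesis
      using C(2)[OF fin[of i] fin[of j]] e0(2) \<epsilon>(2) by linarith
  qed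
  then show ?thesis by blast
qed

text \<open>The minimising sequence converges in energy, so the nonlinear term converges to its value at the limit;
  Fatou's lemma bounds the energy of the limit.\<close>

lemma minimiser_exists:
  obtains u g w where "fin u g w" "\<And>u' g' w'. fin u' g' w' \<Longrightarrow> \<A> u g w \<le> \<A> u' g' w'"
proof -
  obtain u g w M c where fin: "\<And>n :: nat. fin (u n) (g n) (w n)" and M: "M \<ge> 0"
    and uM: "\<And>n. (\<integral>x. \<bar>u n x\<bar> powr p \<partial>lborel) \<le> M" and \<Phi>M: "\<And>n. \<Phi> (u n) (g n) (w n) \<le> M"
    and lim: "(\<lambda>n. \<A> (u n) (g n) (w n)) \<longlonglongrightarrow> c"
    and c_le: "\<And>u g w. fin u g w \<Longrightarrow> c \<le> \<A> u g w"
    and loc: "\<And>R \<epsilon>. \<epsilon> > 0 \<Longrightarrow> \<exists>N. \<forall>i\<ge>N. \<forall>j\<ge>N.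
      (\<integral>x. indicator (cball 0 R) x * \<bar>u i x - u j x\<bar> powr p \<partial>lborel) \<le> \<epsilon>"
    by (rule minimising_sequence) blast
  note D = finite_energyD[OF fin]
  note [measurable] = D(1-3)
  obtain C where C: "C > 0" "\<And>u g w. fin u g w \<Longrightarrow> (\<integral>x. \<bar>u x\<bar> powr p \<partial>lborel) \<le> C * \<Phi> u g w"
    by (rule energy_controls_Lp) blast
  \<comment> \<open>All three components are collected in one vector-valued function, so that a single subsequence
     serves them.\<close>
  define U where "U n x = (w n x, g n x, u n x)" for n x
  have Um[measurable]: "U n \<in> borel_measurable borel" for n
    unfolding U_def borel_prod[symmetric] by measurable
  have U_powr: "norm (a, b, c) powr p \<le> 2 powr p * (\<bar>a\<bar> powr p + 2 powr p * (norm b powr p + \<bar>c\<bar> powr p))"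
    for a c :: real and b :: 'a
  proof -
    have "norm (a, b, c) powr p \<le> (\<bar>a\<bar> + norm (b, c)) powr p"
      using p norm_Pair_le[of a "(b, c)"] by (intro powr_mono2) auto
    also have "\<dots> \<le> 2 powr p * (\<bar>a\<bar> powr p + norm (b, c) powr p)" using p by (intro powr_add_le) auto
    also have "norm (b, c) powr p \<le> (norm b + \<bar>c\<bar>) powr p"
      using p norm_Pair_le[of b c] by (intro powr_mono2) auto
    also have "(norm b + \<bar>c\<bar>) powr p \<le> 2 powr p * (norm b powr p + \<bar>c\<bar> powr p)" using p by (intro powr_add_le) auto
    finally show ?thesis by simp
  qed
  have parts: "\<bar>a\<bar> powr p \<le> norm (a, b, c) powr p" "norm b powr p \<le> norm (a, b, c) powr p" "\<bar>c\<bar> powr p \<le> norm (a, b, c) powr p"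
    for a c :: real and b :: 'a
    using p norm_fst_le[of a "(b, c)"] norm_snd_le[of "(b, c)" a] norm_fst_le[of b c] norm_snd_le[of c b]
    by (auto intro!: powr_mono2)
  have U_int: "integrable lborel (\<lambda>x. norm (y x, z x, v x) powr p)"
    "(\<integral>x. norm (y x, z x, v x) powr p \<partial>lborel) \<le> 2 powr p * (1 + 2 powr p * (1 + C)) * \<Phi> v z y"
    if T: "fin v z y" for v z y
  proof -
    note DT = finite_energyD[OF T]
    note [measurable] = DT(1-3)
    have i: "integrable lborel (\<lambda>x. 2 powr p * (\<bar>y x\<bar> powr p + 2 powr p * (norm (z x) powr p + \<bar>v x\<bar> powr p)))"
      using DT(6-8) by auto
    show *: "integrable lborel (\<lambda>x. norm (y x, z x, v x) powr p)"
    proof (rule Bochner_Integration.integrable_bound[OF i])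
      show "(\<lambda>x. norm (y x, z x, v x) powr p) \<in> borel_measurable lborel"
      proof -
        have "(\<lambda>x. (y x, z x, v x)) \<in> borel_measurable borel"
          unfolding borel_prod[symmetric] by measurable
        then show ?thesis by measurable
      qed
    qed (use U_powr in \<open>auto intro!: AE_I2\<close>)
    have "(\<integral>x. norm (y x, z x, v x) powr p \<partial>lborel)
        \<le> (\<integral>x. 2 powr p * (\<bar>y x\<bar> powr p + 2 powr p * (norm (z x) powr p + \<bar>v x\<bar> powr p)) \<partial>lborel)"
      by (rule integral_mono[OF * i U_powr])
    also have "\<dots> = 2 powr p * ((\<integral>x. \<bar>y x\<bar> powr p \<partial>lborel) + 2 powr p * ((\<integral>x. norm (z x) powr p \<partial>lborel) + (\<integral>x. \<bar>v x\<bar> powr p \<partial>lborel)))"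
      using DT(6-8) by simp
    also have "\<dots> \<le> 2 powr p * (\<Phi> v z y + 2 powr p * (\<Phi> v z y + C * \<Phi> v z y))"
      using energy_parts_le[OF T] C(2)[OF T] by (intro mult_left_mono add_mono) auto
    finally show "(\<integral>x. norm (y x, z x, v x) powr p \<partial>lborel) \<le> 2 powr p * (1 + 2 powr p * (1 + C)) * \<Phi> v z y"
      by (simp add: algebra_simps)
  qed
  define Q where "Q = 2 powr p * (1 + 2 powr p * (1 + C))"
  have Q: "Q > 0" unfolding Q_def using C(1) by (intro mult_pos_pos add_pos_pos) auto
  have UC: "\<exists>N. \<forall>i\<ge>N. \<forall>j\<ge>N. (\<integral>x. norm (U i x - U j x) powr p \<partial>lborel) \<le> \<epsilon>" if \<epsilon>: "\<epsilon> > 0" for \<epsilon>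
  proof -
    have \<epsilon>Q: "\<epsilon> / Q > 0" using \<epsilon> Q by simp
    obtain N where N: "\<And>i j. i \<ge> N \<Longrightarrow> j \<ge> N \<Longrightarrow>
        \<Phi> (\<lambda>x. u i x - u j x) (\<lambda>x. g i x - g j x) (\<lambda>x. w i x - w j x) \<le> \<epsilon> / Q"
      using minimising_sequence_Cauchy[of u g w M c "\<epsilon> / Q", OF fin M uM \<Phi>M lim c_le loc \<epsilon>Q] by blast
    have "(\<integral>x. norm (U i x - U j x) powr p \<partial>lborel) \<le> \<epsilon>" if "i \<ge> N" "j \<ge> N" for i j
    proof -
      have "(\<integral>x. norm (U i x - U j x) powr p \<partial>lborel)
          \<le> Q * \<Phi> (\<lambda>x. u i x - u j x) (\<lambda>x. g i x - g j x) (\<lambda>x. w i x - w j x)"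
        using U_int(2)[OF finite_energy_diff[OF fin[of i] fin[of j]]] by (simp add: U_def Q_def)
      also have "\<dots> \<le> Q * (\<epsilon> / Q)" using N[OF that] Q by (intro mult_left_mono) auto
      finally show ?thesis using Q by simp
    qed
    then show ?thesis by blast
  qed
  have Ui: "integrable lborel (\<lambda>x. norm (U n x) powr p)" for n
    unfolding U_def by (rule U_int(1)[OF fin])
  have Um': "U n \<in> borel_measurable lborel" for n using Um by simp
  obtain r W where r: "strict_mono (r :: nat \<Rightarrow> nat)" and Wm: "W \<in> borel_measurable lborel"
    and ae: "AE x in lborel. (\<lambda>n. U (r n) x) \<longlonglongrightarrow> W x"
    and W_int: "integrable lborel (\<lambda>x. norm (W x) powr p)"
    and W_lim: "(\<lambda>n. \<integral>x. norm (U n x - W x) powr p \<partial>lborel) \<longlonglongrightarrow> 0"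
    by (rule Lp_complete[of p U lborel, OF p Um' Ui UC]) blast
  define w0 where "w0 x = fst (W x)" for x
  define g0 where "g0 x = fst (snd (W x))" for x
  define u0 where "u0 x = snd (snd (W x))" for x
  have W_eq: "W x = (w0 x, g0 x, u0 x)" for x by (simp add: w0_def g0_def u0_def)
  have m0[measurable]: "w0 \<in> borel_measurable borel" "g0 \<in> borel_measurable borel" "u0 \<in> borel_measurable borel"
  proof -
    have [measurable]: "W \<in> borel \<rightarrow>\<^sub>M borel \<Otimes>\<^sub>M borel \<Otimes>\<^sub>M borel"
      using Wm by (simp add: borel_prod)
    show "w0 \<in> borel_measurable borel" "g0 \<in> borel_measurable borel" "u0 \<in> borel_measurable borel"
      unfolding w0_def[abs_def] g0_def[abs_def] u0_def[abs_def] by measurable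
  qed
  have W_int': "integrable lborel (\<lambda>x. norm (w0 x, g0 x, u0 x) powr p)" using W_int by (simp add: W_eq)
  have int0: "integrable lborel (\<lambda>x. norm (w0 x) powr p)" "integrable lborel (\<lambda>x. norm (g0 x) powr p)"
      "integrable lborel (\<lambda>x. norm (u0 x) powr p)"
    by (rule Bochner_Integration.integrable_bound[OF W_int']; use parts in \<open>auto intro!: AE_I2\<close>)+
  have lim0: "(\<lambda>n. \<integral>x. norm (u n x - u0 x) powr p \<partial>lborel) \<longlonglongrightarrow> 0"
    "(\<lambda>n. \<integral>x. norm (g n x - g0 x) powr p \<partial>lborel) \<longlonglongrightarrow> 0"
    "(\<lambda>n. \<integral>x. norm (w n x - w0 x) powr p \<partial>lborel) \<longlonglongrightarrow> 0"
  proof -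
    have iu: "integrable lborel (\<lambda>x. norm (u n x - u0 x) powr p)" for n
      by (rule integrable_norm_diff_powr[OF p]) (use D(6)[of n] int0 in \<open>auto\<close>)
    have ig: "integrable lborel (\<lambda>x. norm (g n x - g0 x) powr p)" for n
      by (rule integrable_norm_diff_powr[OF p]) (use D(7)[of n] int0 in \<open>auto\<close>)
    have iw: "integrable lborel (\<lambda>x. norm (w n x - w0 x) powr p)" for n
      by (rule integrable_norm_diff_powr[OF p]) (use D(8)[of n] int0 in \<open>auto\<close>)
    have iU: "integrable lborel (\<lambda>x. norm (U n x - W x) powr p)" for n
      by (rule integrable_norm_diff_powr[OF p _ _ _ W_int]) (use Wm U_int(1)[OF fin] in \<open>auto simp: U_def[abs_def, symmetric] U_def\<close>)
    have UW: "U n x - W x = (w n x - w0 x, g n x - g0 x, u n x - u0 x)" for n x by (simp add: U_def W_eq)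
    note sq = tendsto_sandwich[OF always_eventually always_eventually tendsto_const W_lim]
    show "(\<lambda>n. \<integral>x. norm (u n x - u0 x) powr p \<partial>lborel) \<longlonglongrightarrow> 0"
      by (rule sq) (use parts(3) iu iU in \<open>auto intro!: Bochner_Integration.integral_nonneg integral_mono simp: UW\<close>)
    show "(\<lambda>n. \<integral>x. norm (g n x - g0 x) powr p \<partial>lborel) \<longlonglongrightarrow> 0"
      by (rule sq) (use parts(2) ig iU in \<open>auto intro!: Bochner_Integration.integral_nonneg integral_mono simp: UW\<close>)
    show "(\<lambda>n. \<integral>x. norm (w n x - w0 x) powr p \<partial>lborel) \<longlonglongrightarrow> 0"
      by (rule sq) (use parts(1) iw iU in \<open>auto intro!: Bochner_Integration.integral_nonneg integral_mono simp: UW\<close>)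
  qed
  have wg: "weak_gradient u0 g0"
    by (rule weak_gradient_limit[OF p D(4) m0(3,2) _ int0(3) _ int0(2) lim0(1,2)]) (use D(6,7) in auto)
  have wl: "weak_laplacian u0 w0"
    by (rule weak_laplacian_limit[OF p D(5) m0(3,1) _ int0(3) _ int0(1) lim0(1,3)]) (use D(6,8) in auto)
  have ae_dens: "AE x in lborel. (\<lambda>n. dens (u (r n)) (g (r n)) (w (r n)) x) \<longlonglongrightarrow> dens u0 g0 w0 x"
    using ae
  proof eventually_elim
    case (elim x)
    have 1: "(\<lambda>n. w (r n) x) \<longlonglongrightarrow> w0 x" using tendsto_fst[OF elim] by (simp add: U_def w0_def)
    have 2: "(\<lambda>n. g (r n) x) \<longlonglongrightarrow> g0 x" using tendsto_fst[OF tendsto_snd[OF elim]] by (simp add: U_def g0_def)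
    have 3: "(\<lambda>n. u (r n) x) \<longlonglongrightarrow> u0 x" using tendsto_snd[OF tendsto_snd[OF elim]] by (simp add: U_def u0_def)
    show ?case unfolding energy_density_def
      using p by (intro tendsto_intros tendsto_powr' 1 2 3) auto
  qed
  define M' where "M' = max M (\<integral>x. \<bar>u0 x\<bar> powr p \<partial>lborel)"
  have M': "M' \<ge> 0" "M \<le> M'" "(\<integral>x. \<bar>u0 x\<bar> powr p \<partial>lborel) \<le> M'" using M by (auto simp: M'_def)
  have Glim: "(\<lambda>n. \<G> (u n)) \<longlonglongrightarrow> \<G> u0"
  proof (rule LIMSEQ_I)
    fix e :: real assume e: "e > 0"
    obtain R \<eta> where \<eta>: "\<eta> > 0" and close:
      "\<And>u v. u \<in> borel_measurable borel \<Longrightarrow> v \<in> borel_measurable borel \<Longrightarrow>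
        integrable lborel (\<lambda>x. \<bar>u x\<bar> powr p) \<Longrightarrow> integrable lborel (\<lambda>x. \<bar>v x\<bar> powr p) \<Longrightarrow>
        (\<integral>x. \<bar>u x\<bar> powr p \<partial>lborel) \<le> M' \<Longrightarrow> (\<integral>x. \<bar>v x\<bar> powr p \<partial>lborel) \<le> M' \<Longrightarrow>
        (\<integral>x. indicator (cball 0 R) x * \<bar>u x - v x\<bar> powr p \<partial>lborel) \<le> \<eta> \<Longrightarrow>
        \<bar>\<G> u - \<G> v\<bar> < e"
      by (rule primitive_integral_close[OF p F1 M'(1) e]) blast
    have "\<forall>\<^sub>F n in sequentially. (\<integral>x. norm (u n x - u0 x) powr p \<partial>lborel) < \<eta>"
      using lim0(1) by (rule order_tendstoD) (use \<eta> in auto)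
    then obtain N where N: "\<And>n. n \<ge> N \<Longrightarrow> (\<integral>x. norm (u n x - u0 x) powr p \<partial>lborel) < \<eta>"
      by (auto simp: eventually_sequentially)
    have "norm (\<G> (u n) - \<G> u0) < e" if n: "n \<ge> N" for n
    proof -
      have iu: "integrable lborel (\<lambda>x. \<bar>u n x - u0 x\<bar> powr p)"
        using integrable_norm_diff_powr[OF p, of "u n" lborel u0] D(6)[of n] int0(3) by simp
      have "(\<integral>x. indicator (cball 0 R) x * \<bar>u n x - u0 x\<bar> powr p \<partial>lborel) \<le> (\<integral>x. \<bar>u n x - u0 x\<bar> powr p \<partial>lborel)"
        using integrable_mult_indicator[OF _ iu, of "cball 0 R"] iu
        by (intro integral_mono) (auto simp: indicator_def)
      also have "\<dots> \<le> \<eta>" using N[OF n] by simp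
      finally show ?thesis
        using close[of "u n" u0] D(6)[of n] int0(3) uM[of n] M' by simp
    qed
    then show "\<exists>N. \<forall>n\<ge>N. norm (\<G> (u n) - \<G> u0) < e" by blast
  qed
  have "(\<lambda>n. p * (\<A> (u n) (g n) (w n) + \<G> (u n))) \<longlonglongrightarrow> p * (c + \<G> u0)"
    by (intro tendsto_intros lim Glim)
  then have \<Phi>lim: "(\<lambda>n. \<Phi> (u n) (g n) (w n)) \<longlonglongrightarrow> p * (c + \<G> u0)"
    using p by (simp add: action_def)
  have fatou: "integrable lborel (dens u0 g0 w0) \<and> \<Phi> u0 g0 w0 \<le> p * (c + \<G> u0) + \<delta>" if \<delta>: "\<delta> > 0" for \<delta>
  proof -
    have "\<forall>\<^sub>F n in sequentially. \<Phi> (u (r n)) (g (r n)) (w (r n)) < p * (c + \<G> u0) + \<delta>"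
      using LIMSEQ_subseq_LIMSEQ[OF \<Phi>lim r] unfolding o_def by (rule order_tendstoD) (use \<delta> in auto)
    then have ev: "\<forall>\<^sub>F n in sequentially. (\<integral>x. dens (u (r n)) (g (r n)) (w (r n)) x \<partial>lborel) \<le> p * (c + \<G> u0) + \<delta>"
      by eventually_elim (simp add: energy_def)
    have md: "dens (u n) (g n) (w n) \<in> borel_measurable lborel" "dens u0 g0 w0 \<in> borel_measurable lborel" for n
      unfolding energy_density_def[abs_def] by measurable
    show ?thesis
      using Fatou_real[of "\<lambda>n. dens (u (r n)) (g (r n)) (w (r n))", OF md energy_density_nonneg ae_dens D(10) ev]
      by (simp add: energy_def)
  qed
  have fin0: "fin u0 g0 w0"
    unfolding finite_energy_def
  proof (intro conjI wg wl)
    have i: "integrable lborel (\<lambda>x. 1 / lam * dens u0 g0 w0 x)"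
      using fatou[of 1] by (intro integrable_mult_right) simp
    show "integrable lborel (\<lambda>x. V x * \<bar>u0 x\<bar> powr p)"
    proof (rule Bochner_Integration.integrable_bound[OF i])
      have le: "V x * \<bar>u0 x\<bar> powr p \<le> 1 / lam * dens u0 g0 w0 x" for x
      proof -
        have "lam * (V x * \<bar>u0 x\<bar> powr p) \<le> dens u0 g0 w0 x" by (simp add: energy_density_def mult.assoc)
        then show ?thesis using lam by (simp add: le_divide_eq mult.commute)
      qed
      show "AE x in lborel. norm (V x * \<bar>u0 x\<bar> powr p) \<le> norm (1 / lam * dens u0 g0 w0 x)"
      proof (rule AE_I2)
        fix x
        have "0 \<le> V x * \<bar>u0 x\<bar> powr p" using V_nonneg[of x] by simp
        then show "norm (V x * \<bar>u0 x\<bar> powr p) \<le> norm (1 / lam * dens u0 g0 w0 x)"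
          using le[of x] unfolding real_norm_def by linarith
      qed
    qed measurable
  qed (use int0 in auto)
  have "\<Phi> u0 g0 w0 \<le> p * (c + \<G> u0)"
    by (rule field_le_epsilon) (rule fatou[THEN conjunct2])
  then have "\<Phi> u0 g0 w0 / p \<le> c + \<G> u0" using p by (simp add: divide_le_eq mult.commute)
  then have Ac: "\<A> u0 g0 w0 \<le> c" unfolding action_def by linarith
  show thesis by (rule that[OF fin0 order_trans[OF Ac c_le]])
qed

end

section \<open>The Euler-Lagrange equation\<close>

lemma powr_diff_le:
  fixes s r S p :: real
  assumes "p > 1" "0 \<le> s" "0 \<le> r" "s \<le> S" "r \<le> S"
  shows "\<bar>s powr p - r powr p\<bar> \<le> p * S powr (p - 1) * \<bar>s - r\<bar>"
proof -
  have *: "x powr p - y powr p \<le> p * S powr (p - 1) * \<bar>x - y\<bar>" if "0 \<le> y" "y \<le> x" "x \<le> S" for x y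
  proof -
    have "x powr p - y powr p \<le> p * x powr (p - 1) * (x - y)"
      using powr_tangent[of p y x] that assms(1) by (simp add: algebra_simps)
    also have "\<dots> \<le> p * S powr (p - 1) * (x - y)"
      using that assms(1) by (intro mult_right_mono mult_left_mono powr_mono2) auto
    finally show ?thesis using that by simp
  qed
  have mono: "y powr p \<le> x powr p" if "0 \<le> y" "y \<le> x" for x y :: real
    using that assms(1) by (intro powr_mono2) auto
  show ?thesis
  proof (cases "r \<le> s")
    case True
    then show ?thesis using *[of r s] mono[of r s] assms by simp
  next
    case False
    then show ?thesis using *[of s r] mono[of s r] assms by (simp add: abs_minus_commute)
  qed
qed

lemma norm_powr_difference_bound:
  fixes a b :: "'b::real_normed_vector"
  assumes p: "p > 1" and t: "0 < t" "t \<le> 1"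
  shows "\<bar>(norm (a + t *\<^sub>R b) powr p - norm a powr p) / t\<bar> \<le> p * 2 powr p * (norm a powr p + norm b powr p)"
proof -
  let ?S = "norm a + norm b"
  have tb: "norm (t *\<^sub>R b) = t * norm b" "t * norm b \<le> norm b" using t by (auto intro: mult_left_le_one_le)
  have "\<bar>norm (a + t *\<^sub>R b) - norm a\<bar> \<le> t * norm b"
    using norm_triangle_ineq3[of "a + t *\<^sub>R b" a] by (simp only: add_diff_cancel_left' tb(1))
  moreover have "norm (a + t *\<^sub>R b) \<le> ?S" using norm_triangle_ineq[of a "t *\<^sub>R b"] tb by linarith
  ultimately have "\<bar>norm (a + t *\<^sub>R b) powr p - norm a powr p\<bar> \<le> p * ?S powr (p - 1) * (t * norm b)"
    using p by (intro order_trans[OF powr_diff_le[where S="?S"]] mult_left_mono) auto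
  also have "\<dots> \<le> p * ?S powr (p - 1) * (t * ?S)"
    using p t by (intro mult_left_mono) auto
  also have "\<dots> = t * (p * ?S powr p)" using powr_mult_base[of ?S "p - 1"] by (simp add: mult_ac)
  also have "\<dots> \<le> t * (p * (2 powr p * (norm a powr p + norm b powr p)))"
    using p t by (intro mult_left_mono powr_add_le) auto
  finally show ?thesis using t by (simp add: abs_divide divide_le_eq mult_ac)
qed

lemma inverse_Suc_tendsto:
  "(\<lambda>n. 1 / real (Suc n)) \<longlonglongrightarrow> 0" "filterlim (\<lambda>n. 1 / real (Suc n)) (at 0) sequentially"
proof -
  show 1: "(\<lambda>n. 1 / real (Suc n)) \<longlonglongrightarrow> 0"
    using LIMSEQ_inverse_real_of_nat by (simp add: inverse_eq_divide)
  show "filterlim (\<lambda>n. 1 / real (Suc n)) (at 0) sequentially"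
    using 1 by (intro filterlim_atI) (auto intro!: always_eventually)
qed

lemma norm_powr_directional_derivative:
  fixes a b :: "'b::real_inner"
  assumes p: "p > 1"
  shows "(\<lambda>n. (norm (a + (1 / real (Suc n)) *\<^sub>R b) powr p - norm a powr p) / (1 / real (Suc n)))
    \<longlonglongrightarrow> p * (norm a powr (p - 2) * (a \<bullet> b))"
proof (cases "a = 0")
  case True
  define t where "t n = 1 / real (Suc n)" for n
  have t: "t n > 0" for n by (simp add: t_def)
  have "(\<lambda>n. t n powr (p - 1) * norm b powr p) \<longlonglongrightarrow> 0 powr (p - 1) * norm b powr p"
    using p inverse_Suc_tendsto(1) t by (intro tendsto_intros tendsto_powr') (auto simp: t_def[abs_def])
  moreover have "(norm (a + t n *\<^sub>R b) powr p - norm a powr p) / t n = t n powr (p - 1) * norm b powr p" for n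
    using True t[of n] p by (simp add: powr_mult powr_diff)
  ultimately show ?thesis using True by (simp add: t_def)
next
  case False
  have norm_eq: "norm x powr p = (x \<bullet> x) powr (p / 2)" for x :: 'b
  proof -
    have "norm x powr p = (norm x powr 2) powr (p / 2)" by (simp only: powr_powr) simp
    also have "norm x powr 2 = x \<bullet> x" by (simp add: power2_norm_eq_inner)
    finally show ?thesis .
  qed
  have pos: "a \<bullet> a > 0" using False by simp
  have "((\<lambda>s. (a \<bullet> a + s * (2 * (a \<bullet> b)) + s * s * (b \<bullet> b)) powr (p / 2)) has_real_derivative
      (p / 2) * (a \<bullet> a) powr (p / 2 - 1) * (2 * (a \<bullet> b))) (at 0)"
    using pos by (auto intro!: derivative_eq_intros)
  moreover have "(a \<bullet> a + s * (2 * (a \<bullet> b)) + s * s * (b \<bullet> b)) powr (p / 2) = norm (a + s *\<^sub>R b) powr p" for s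
    unfolding norm_eq by (simp add: inner_add_left inner_add_right inner_commute algebra_simps)
  moreover have "(p / 2) * (a \<bullet> a) powr (p / 2 - 1) * (2 * (a \<bullet> b)) = p * (norm a powr (p - 2) * (a \<bullet> b))"
  proof -
    have "(a \<bullet> a) powr (p / 2 - 1) = (norm a powr 2) powr (p / 2 - 1)"
      by (simp add: power2_norm_eq_inner)
    also have "\<dots> = norm a powr (p - 2)" by (simp only: powr_powr) (simp add: algebra_simps)
    finally show ?thesis by simp
  qed
  ultimately have "((\<lambda>s. norm (a + s *\<^sub>R b) powr p) has_real_derivative p * (norm a powr (p - 2) * (a \<bullet> b))) (at 0)"
    by (simp only:)
  then have "((\<lambda>s. (norm (a + s *\<^sub>R b) powr p - norm a powr p) / s) \<longlongrightarrow> p * (norm a powr (p - 2) * (a \<bullet> b))) (at 0)"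
    by (simp add: has_field_derivative_iff)
  from filterlim_compose[OF this inverse_Suc_tendsto(2)] show ?thesis .
qed

text \<open>Differentiation under the integral along \<open>t = 1/(n+1)\<close>. The weight \<open>\<rho>\<close> is \<open>1\<close> for the two
  derivative terms and \<open>\<lambda> V\<close> for the potential term.\<close>

lemma integral_norm_powr_derivative:
  fixes y z :: "'a \<Rightarrow> 'b::euclidean_space" and \<rho> :: "'a \<Rightarrow> real"
  assumes p: "p > 1" and [measurable]: "y \<in> borel_measurable M" "z \<in> borel_measurable M" "\<rho> \<in> borel_measurable M"
    and \<rho>: "\<And>x. \<rho> x \<ge> 0"
    and int: "integrable M (\<lambda>x. \<rho> x * norm (y x) powr p)" "integrable M (\<lambda>x. \<rho> x * norm (z x) powr p)"
      "\<And>n. integrable M (\<lambda>x. \<rho> x * norm (y x + (1 / real (Suc n)) *\<^sub>R z x) powr p)"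
  shows "integrable M (\<lambda>x. \<rho> x * (norm (y x) powr (p - 2) * (y x \<bullet> z x)))"
    "(\<lambda>n. ((\<integral>x. \<rho> x * norm (y x + (1 / real (Suc n)) *\<^sub>R z x) powr p \<partial>M) - (\<integral>x. \<rho> x * norm (y x) powr p \<partial>M))
        / (1 / real (Suc n))) \<longlonglongrightarrow> p * (\<integral>x. \<rho> x * (norm (y x) powr (p - 2) * (y x \<bullet> z x)) \<partial>M)"
proof -
  let ?q = "\<lambda>n x. \<rho> x * ((norm (y x + (1 / real (Suc n)) *\<^sub>R z x) powr p - norm (y x) powr p) / (1 / real (Suc n)))"
  let ?l = "\<lambda>x. \<rho> x * (p * (norm (y x) powr (p - 2) * (y x \<bullet> z x)))"
  let ?W = "\<lambda>x. p * 2 powr p * (\<rho> x * norm (y x) powr p + \<rho> x * norm (z x) powr p)"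
  have W: "integrable M ?W" using int by auto
  have lim: "AE x in M. (\<lambda>n. ?q n x) \<longlonglongrightarrow> ?l x"
    by (intro AE_I2 tendsto_mult tendsto_const norm_powr_directional_derivative p)
  have bound: "AE x in M. norm (?q n x) \<le> ?W x" for n
  proof (rule AE_I2)
    fix x
    have "\<bar>?q n x\<bar> = \<rho> x * \<bar>(norm (y x + (1 / real (Suc n)) *\<^sub>R z x) powr p - norm (y x) powr p) / (1 / real (Suc n))\<bar>"
      using \<rho>[of x] by (simp only: abs_mult abs_of_nonneg)
    also have "\<dots> \<le> \<rho> x * (p * 2 powr p * (norm (y x) powr p + norm (z x) powr p))"
      using \<rho>[of x] p by (intro mult_left_mono norm_powr_difference_bound) auto
    finally show "norm (?q n x) \<le> ?W x" by (simp add: algebra_simps)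
  qed
  have m: "?l \<in> borel_measurable M" "?q n \<in> borel_measurable M" for n by measurable
  have "integrable M (\<lambda>x. 1 / p * ?l x)"
    by (intro integrable_mult_right integrable_dominated_convergence[OF m W lim bound])
  then show "integrable M (\<lambda>x. \<rho> x * (norm (y x) powr (p - 2) * (y x \<bullet> z x)))" using p by simp
  have "(\<lambda>n. \<integral>x. ?q n x \<partial>M) \<longlonglongrightarrow> (\<integral>x. ?l x \<partial>M)"
    by (rule integral_dominated_convergence[OF m W lim bound])
  moreover have "(\<integral>x. ?q n x \<partial>M) = ((\<integral>x. \<rho> x * norm (y x + (1 / real (Suc n)) *\<^sub>R z x) powr p \<partial>M)
      - (\<integral>x. \<rho> x * norm (y x) powr p \<partial>M)) / (1 / real (Suc n))" for n
  proof -
    have "(\<lambda>x. ?q n x) = (\<lambda>x. (\<rho> x * norm (y x + (1 / real (Suc n)) *\<^sub>R z x) powr p - \<rho> x * norm (y x) powr p) / (1 / real (Suc n)))"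
      by (simp only: times_divide_eq_right right_diff_distrib)
    then show ?thesis using int by (simp only: integral_divide_zero Bochner_Integration.integral_diff)
  qed
  moreover have "(\<integral>x. ?l x \<partial>M) = p * (\<integral>x. \<rho> x * (norm (y x) powr (p - 2) * (y x \<bullet> z x)) \<partial>M)"
    by (simp add: mult.left_commute[of _ p])
  ultimately show "(\<lambda>n. ((\<integral>x. \<rho> x * norm (y x + (1 / real (Suc n)) *\<^sub>R z x) powr p \<partial>M)
      - (\<integral>x. \<rho> x * norm (y x) powr p \<partial>M)) / (1 / real (Suc n))) \<longlonglongrightarrow> p * (\<integral>x. \<rho> x * (norm (y x) powr (p - 2) * (y x \<bullet> z x)) \<partial>M)"
    by simp
qed

context energy_setting
begin

lemma primitive_integral_derivative:
  assumes u: "u \<in> borel_measurable borel" and v: "v \<in> borel_measurable borel"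
    and iu: "integrable lborel (\<lambda>x. \<bar>u x\<bar> powr p)" and iv: "integrable lborel (\<lambda>x. \<bar>v x\<bar> powr p)"
    and iuv: "\<And>n. integrable lborel (\<lambda>x. \<bar>u x + (1 / real (Suc n)) * v x\<bar> powr p)"
  shows "integrable lborel (\<lambda>x. f x (u x) * v x)"
    "(\<lambda>n. (\<G> (\<lambda>x. u x + (1 / real (Suc n)) * v x) - \<G> u) / (1 / real (Suc n))) \<longlonglongrightarrow> (\<integral>x. f x (u x) * v x \<partial>lborel)"
proof -
  note [measurable] = u v
  have cont: "continuous_on UNIV (\<lambda>(x, t). f x t)" using F1 by (simp add: cond_F1_def)
  obtain H K where H: "integrable lborel H" "K \<ge> 0" "\<And>x. H x \<ge> 0"
    and ae0: "AE x in lborel. \<forall>s t \<epsilon>. \<epsilon> > 0 \<longrightarrow> \<bar>primitive f x s - primitive f x t\<bar>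
      \<le> \<epsilon> * (H x + K * (\<bar>s\<bar> powr p + \<bar>t\<bar> powr p)) + K * \<epsilon> powr (1 - p) * \<bar>s - t\<bar> powr p"
    and ae: "AE x in lborel. \<forall>s d t. 0 < t \<and> t \<le> 1 \<longrightarrow> \<bar>primitive f x (s + t * d) - primitive f x s\<bar>
      \<le> t * (H x + K * (\<bar>s\<bar> powr p + \<bar>d\<bar> powr p))"
    by (rule primitive_difference[OF p F1]) (rule that)
  let ?q = "\<lambda>n x. (primitive f x (u x + (1 / real (Suc n)) * v x) - primitive f x (u x)) / (1 / real (Suc n))"
  let ?W = "\<lambda>x. H x + K * (\<bar>u x\<bar> powr p + \<bar>v x\<bar> powr p)"
  have W: "integrable lborel ?W" using H(1) iu iv by auto
  have Fm: "(\<lambda>x. primitive f x (u x + (1 / real (Suc n)) * v x)) \<in> borel_measurable borel"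
    "(\<lambda>x. primitive f x (u x)) \<in> borel_measurable borel" "(\<lambda>x. f x (u x)) \<in> borel_measurable borel" for n
    by (intro primitive_comp_measurable[OF cont]; measurable)+
  have m: "(\<lambda>x. f x (u x) * v x) \<in> borel_measurable lborel" "?q n \<in> borel_measurable lborel" for n
    using Fm(1)[of n] Fm(2,3) by auto
  have lim: "AE x in lborel. (\<lambda>n. ?q n x) \<longlonglongrightarrow> f x (u x) * v x"
  proof (rule AE_I2)
    fix x
    have cx: "continuous_on UNIV (f x)"
    proof -
      have "continuous_on UNIV (\<lambda>t. (x, t))" by (intro continuous_intros)
      from continuous_on_compose2[OF cont this] show ?thesis by simp
    qed
    have "((\<lambda>s. primitive f x (u x + s * v x)) has_real_derivative f x (u x) * v x) (at 0)"
      by (rule DERIV_chain2[where g="\<lambda>s. u x + s * v x"])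
         (use primitive_has_derivative[of f x, OF cx] in \<open>auto intro!: derivative_eq_intros\<close>)
    then have "((\<lambda>s. (primitive f x (u x + s * v x) - primitive f x (u x)) / s) \<longlongrightarrow> f x (u x) * v x) (at 0)"
      by (simp add: has_field_derivative_iff)
    from filterlim_compose[OF this inverse_Suc_tendsto(2)]
    show "(\<lambda>n. ?q n x) \<longlonglongrightarrow> f x (u x) * v x" .
  qed
  have bound: "AE x in lborel. norm (?q n x) \<le> ?W x" for n
    using ae
  proof eventually_elim
    case (elim x)
    have t: "0 < 1 / real (Suc n)" "1 / real (Suc n) \<le> 1" by auto
    have "\<bar>primitive f x (u x + (1 / real (Suc n)) * v x) - primitive f x (u x)\<bar> \<le> (1 / real (Suc n)) * ?W x"
      using elim t by blast
    then show ?case using t(1) unfolding real_norm_def abs_divide by (simp only: abs_of_pos divide_le_eq mult.commute if_True)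
  qed
  show "integrable lborel (\<lambda>x. f x (u x) * v x)"
    by (rule integrable_dominated_convergence[OF m W lim bound])
  have "(\<lambda>n. \<integral>x. ?q n x \<partial>lborel) \<longlonglongrightarrow> (\<integral>x. f x (u x) * v x \<partial>lborel)"
    by (rule integral_dominated_convergence[OF m W lim bound])
  moreover have "(\<integral>x. ?q n x \<partial>lborel) = (\<G> (\<lambda>x. u x + (1 / real (Suc n)) * v x) - \<G> u) / (1 / real (Suc n))" for n
  proof -
    have "integrable lborel (\<lambda>x. primitive f x (u x + (1 / real (Suc n)) * v x))"
      "integrable lborel (\<lambda>x. primitive f x (u x))"
      by (intro primitive_integrable[OF p F1] iu iuv; measurable)+
    then show ?thesis by (simp only: integral_divide_zero Bochner_Integration.integral_diff)
  qed
  ultimately show "(\<lambda>n. (\<G> (\<lambda>x. u x + (1 / real (Suc n)) * v x) - \<G> u) / (1 / real (Suc n))) \<longlonglongrightarrow> (\<integral>x. f x (u x) * v x \<partial>lborel)"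
    by simp
qed

abbreviation "el_density u g w v h z x \<equiv> \<bar>w x\<bar> powr (p - 2) * w x * z x
  + norm (g x) powr (p - 2) * (g x \<bullet> h x) + lam * V x * \<bar>u x\<bar> powr (p - 2) * u x * v x"

lemma action_derivative:
  assumes T: "fin u g w" and T': "fin v h z"
  shows "integrable lborel (el_density u g w v h z)" "integrable lborel (\<lambda>x. f x (u x) * v x)"
    "(\<lambda>n. (\<A> (\<lambda>x. 1 * u x + (1 / real (Suc n)) * v x) (\<lambda>x. 1 *\<^sub>R g x + (1 / real (Suc n)) *\<^sub>R h x)
        (\<lambda>x. 1 * w x + (1 / real (Suc n)) * z x) - \<A> u g w) / (1 / real (Suc n)))
      \<longlonglongrightarrow> (\<integral>x. el_density u g w v h z x \<partial>lborel) - (\<integral>x. f x (u x) * v x \<partial>lborel)"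
proof -
  let ?t = "\<lambda>n. 1 / real (Suc n)"
  note D = finite_energyD[OF T] and D' = finite_energyD[OF T']
  note [measurable] = D(1-3) D'(1-3)
  have Tn: "fin (\<lambda>x. 1 * u x + ?t n * v x) (\<lambda>x. 1 *\<^sub>R g x + ?t n *\<^sub>R h x) (\<lambda>x. 1 * w x + ?t n * z x)" for n
    by (rule finite_energy_lincomb[OF T T'])
  note Dn = finite_energyD[OF Tn]
  have iV: "integrable lborel (\<lambda>x. lam * V x * norm (y x) powr p)" if "integrable lborel (\<lambda>x. V x * \<bar>y x\<bar> powr p)" for y :: "'a \<Rightarrow> real"
    using integrable_mult_right[OF that, of lam] by (simp add: mult.assoc)
  have w: "integrable lborel (\<lambda>x. 1 * (norm (w x) powr (p - 2) * (w x \<bullet> z x)))"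
    "(\<lambda>n. ((\<integral>x. 1 * norm (w x + ?t n *\<^sub>R z x) powr p \<partial>lborel) - (\<integral>x. 1 * norm (w x) powr p \<partial>lborel)) / ?t n)
      \<longlonglongrightarrow> p * (\<integral>x. 1 * (norm (w x) powr (p - 2) * (w x \<bullet> z x)) \<partial>lborel)"
    by (rule integral_norm_powr_derivative[OF p]; use D(8) D'(8) Dn(8) in simp)+
  have g: "integrable lborel (\<lambda>x. 1 * (norm (g x) powr (p - 2) * (g x \<bullet> h x)))"
    "(\<lambda>n. ((\<integral>x. 1 * norm (g x + ?t n *\<^sub>R h x) powr p \<partial>lborel) - (\<integral>x. 1 * norm (g x) powr p \<partial>lborel)) / ?t n)
      \<longlonglongrightarrow> p * (\<integral>x. 1 * (norm (g x) powr (p - 2) * (g x \<bullet> h x)) \<partial>lborel)"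
    by (rule integral_norm_powr_derivative[OF p]; use D(7) D'(7) Dn(7) in simp)+
  have u: "integrable lborel (\<lambda>x. lam * V x * (norm (u x) powr (p - 2) * (u x \<bullet> v x)))"
    "(\<lambda>n. ((\<integral>x. lam * V x * norm (u x + ?t n *\<^sub>R v x) powr p \<partial>lborel) - (\<integral>x. lam * V x * norm (u x) powr p \<partial>lborel)) / ?t n)
      \<longlonglongrightarrow> p * (\<integral>x. lam * V x * (norm (u x) powr (p - 2) * (u x \<bullet> v x)) \<partial>lborel)"
    by (rule integral_norm_powr_derivative[OF p];
        use iV[OF D(9)] iV[OF D'(9)] iV[OF Dn(9)] V_nonneg lam in simp)+
  have G: "integrable lborel (\<lambda>x. f x (u x) * v x)"
    "(\<lambda>n. (\<G> (\<lambda>x. u x + ?t n * v x) - \<G> u) / ?t n) \<longlonglongrightarrow> (\<integral>x. f x (u x) * v x \<partial>lborel)"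
    by (rule primitive_integral_derivative; use D(6) D'(6) Dn(6) in simp)+
  have el_eq: "el_density u g w v h z x = 1 * (norm (w x) powr (p - 2) * (w x \<bullet> z x))
      + 1 * (norm (g x) powr (p - 2) * (g x \<bullet> h x)) + lam * V x * (norm (u x) powr (p - 2) * (u x \<bullet> v x))" for x
    by (simp add: mult.assoc)
  show "integrable lborel (el_density u g w v h z)"
    unfolding el_eq by (intro Bochner_Integration.integrable_add w g u)
  show "integrable lborel (\<lambda>x. f x (u x) * v x)" by (rule G)
  have \<Phi>_split: "\<Phi> u g w = (\<integral>x. 1 * norm (w x) powr p \<partial>lborel) + (\<integral>x. 1 * norm (g x) powr p \<partial>lborel) + (\<integral>x. lam * V x * norm (u x) powr p \<partial>lborel)"
    if "fin u g w" for u g w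
    using finite_energyD(7,8)[OF that] iV[OF finite_energyD(9)[OF that]]
    by (simp add: energy_def energy_density_def)
  let ?w = "\<integral>x. 1 * (norm (w x) powr (p - 2) * (w x \<bullet> z x)) \<partial>lborel"
    and ?g = "\<integral>x. 1 * (norm (g x) powr (p - 2) * (g x \<bullet> h x)) \<partial>lborel"
    and ?u = "\<integral>x. lam * V x * (norm (u x) powr (p - 2) * (u x \<bullet> v x)) \<partial>lborel"
  have "(\<lambda>n. (((\<integral>x. 1 * norm (w x + ?t n *\<^sub>R z x) powr p \<partial>lborel) - (\<integral>x. 1 * norm (w x) powr p \<partial>lborel)) / ?t n
        + ((\<integral>x. 1 * norm (g x + ?t n *\<^sub>R h x) powr p \<partial>lborel) - (\<integral>x. 1 * norm (g x) powr p \<partial>lborel)) / ?t n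
        + ((\<integral>x. lam * V x * norm (u x + ?t n *\<^sub>R v x) powr p \<partial>lborel) - (\<integral>x. lam * V x * norm (u x) powr p \<partial>lborel)) / ?t n) / p
        - (\<G> (\<lambda>x. u x + ?t n * v x) - \<G> u) / ?t n)
      \<longlonglongrightarrow> (p * ?w + p * ?g + p * ?u) / p - (\<integral>x. f x (u x) * v x \<partial>lborel)"
    using p by (intro tendsto_intros w g u G) auto
  moreover have "(p * ?w + p * ?g + p * ?u) / p = (\<integral>x. el_density u g w v h z x \<partial>lborel)"
  proof -
    have "(\<integral>x. el_density u g w v h z x \<partial>lborel) = ?w + ?g + ?u"
      unfolding el_eq
      by (subst Bochner_Integration.integral_add; (intro Bochner_Integration.integrable_add w g u)?)
         (subst Bochner_Integration.integral_add; (intro w g u refl)?)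
    then show ?thesis using p by (simp only: flip: distrib_left) simp
  qed
  moreover have "(\<A> (\<lambda>x. 1 * u x + ?t n * v x) (\<lambda>x. 1 *\<^sub>R g x + ?t n *\<^sub>R h x) (\<lambda>x. 1 * w x + ?t n * z x) - \<A> u g w) / ?t n
      = (((\<integral>x. 1 * norm (w x + ?t n *\<^sub>R z x) powr p \<partial>lborel) - (\<integral>x. 1 * norm (w x) powr p \<partial>lborel)) / ?t n
        + ((\<integral>x. 1 * norm (g x + ?t n *\<^sub>R h x) powr p \<partial>lborel) - (\<integral>x. 1 * norm (g x) powr p \<partial>lborel)) / ?t n
        + ((\<integral>x. lam * V x * norm (u x + ?t n *\<^sub>R v x) powr p \<partial>lborel) - (\<integral>x. lam * V x * norm (u x) powr p \<partial>lborel)) / ?t n) / p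
        - (\<G> (\<lambda>x. u x + ?t n * v x) - \<G> u) / ?t n" for n
  proof -
    have ring: "((a' + b' + c') / p - d' - ((a + b + c) / p - d)) / t
        = ((a' - a) / t + (b' - b) / t + (c' - c) / t) / p - (d' - d) / t" for a b c d a' b' c' d' t :: real
      by (simp add: add_divide_distrib diff_divide_distrib mult.commute)
    show ?thesis
      unfolding action_def \<Phi>_split[OF T] \<Phi>_split[OF Tn]
      unfolding mult_1_left scaleR_one real_scaleR_def by (rule ring)
  qed
  ultimately show "(\<lambda>n. (\<A> (\<lambda>x. 1 * u x + ?t n * v x) (\<lambda>x. 1 *\<^sub>R g x + ?t n *\<^sub>R h x)
        (\<lambda>x. 1 * w x + ?t n * z x) - \<A> u g w) / ?t n)
      \<longlonglongrightarrow> (\<integral>x. el_density u g w v h z x \<partial>lborel) - (\<integral>x. f x (u x) * v x \<partial>lborel)"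
    by (simp only:)
qed

text \<open>The one-sided derivative at a minimiser is nonnegative in the direction \<open>v\<close> and in the direction \<open>-v\<close>.\<close>

lemma Euler_Lagrange:
  assumes T: "fin u g w" and min: "\<And>u' g' w'. fin u' g' w' \<Longrightarrow> \<A> u g w \<le> \<A> u' g' w'"
    and T': "fin v h z"
  shows "(\<integral>x. el_density u g w v h z x \<partial>lborel) = (\<integral>x. f x (u x) * v x \<partial>lborel)"
proof -
  have ge: "(\<integral>x. el_density u g w v h z x \<partial>lborel) - (\<integral>x. f x (u x) * v x \<partial>lborel) \<ge> 0"
    if T': "fin v h z" for v h z
  proof (rule LIMSEQ_le_const[OF action_derivative(3)[OF T T']], intro exI[of _ 0] allI impI)
    fix n :: nat
    show "0 \<le> (\<A> (\<lambda>x. 1 * u x + (1 / real (Suc n)) * v x) (\<lambda>x. 1 *\<^sub>R g x + (1 / real (Suc n)) *\<^sub>R h x)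
        (\<lambda>x. 1 * w x + (1 / real (Suc n)) * z x) - \<A> u g w) / (1 / real (Suc n))"
      by (intro divide_nonneg_nonneg) (use min[OF finite_energy_lincomb[OF T T', of 1 "1 / real (Suc n)"]] in auto)
  qed
  have neg: "fin (\<lambda>x. - v x) (\<lambda>x. - h x) (\<lambda>x. - z x)"
    using finite_energy_lincomb[OF T' T', of "-1" 0] by simp
  have "(\<integral>x. el_density u g w (\<lambda>x. - v x) (\<lambda>x. - h x) (\<lambda>x. - z x) x \<partial>lborel)
      = (\<integral>x. - el_density u g w v h z x \<partial>lborel)"
    by (intro Bochner_Integration.integral_cong) (simp_all add: algebra_simps)
  also have "\<dots> = - (\<integral>x. el_density u g w v h z x \<partial>lborel)" by (rule Bochner_Integration.integral_minus)
  finally have "(\<integral>x. el_density u g w (\<lambda>x. - v x) (\<lambda>x. - h x) (\<lambda>x. - z x) x \<partial>lborel)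
      = - (\<integral>x. el_density u g w v h z x \<partial>lborel)" .
  moreover have "(\<integral>x. f x (u x) * - v x \<partial>lborel) = - (\<integral>x. f x (u x) * v x \<partial>lborel)" by simp
  ultimately show ?thesis using ge[OF T'] ge[OF neg] by linarith
qed

end

section \<open>A competitor with negative action\<close>

lemma integrable_continuous_bounded_support:
  fixes F :: "'a::euclidean_space \<Rightarrow> real"
  assumes "continuous_on UNIV F" "\<And>x. norm x > R \<Longrightarrow> F x = 0"
  shows "integrable lborel F"
proof -
  have "integrable lborel (\<lambda>x. indicator (cball 0 R) x *\<^sub>R F x)"
    using assms(1) by (intro borel_integrable_compact) (auto intro: continuous_on_subset)
  moreover have "(\<lambda>x. indicator (cball 0 R) x *\<^sub>R F x) = F"
    using assms(2) by (auto simp: indicator_def fun_eq_iff not_le)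
  ultimately show ?thesis by (simp only:)
qed

lemma test_function_weak_derivatives:
  fixes \<phi> :: "'a::euclidean_space \<Rightarrow> real"
  assumes \<phi>: "test_function \<phi>"
  shows "weak_gradient \<phi> (\<lambda>x. \<Sum>b\<in>Basis. pderiv_dir b \<phi> x *\<^sub>R b)" "weak_laplacian \<phi> (laplacian \<phi>)"
proof -
  have c: "continuous_on UNIV \<phi>" "continuous_on UNIV (laplacian \<phi>)"
    "\<And>b. b \<in> Basis \<Longrightarrow> continuous_on UNIV (pderiv_dir b \<phi>)"
    using \<phi> test_function_laplacian[OF \<phi>] test_function_pderiv_dir[OF \<phi>]
    by (auto intro: smooth_continuous test_function_smooth)
  have cg: "continuous_on UNIV (\<lambda>x. \<Sum>b\<in>Basis. pderiv_dir b \<phi> x *\<^sub>R b)"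
    by (intro continuous_intros c) auto
  have inner: "(\<Sum>b\<in>Basis. pderiv_dir b \<phi> x *\<^sub>R b) \<bullet> e = pderiv_dir e \<phi> x" if "e \<in> Basis" for e x
    using that by (simp add: inner_sum_left inner_Basis if_distrib if_distribR cong: if_cong)
  show "weak_gradient \<phi> (\<lambda>x. \<Sum>b\<in>Basis. pderiv_dir b \<phi> x *\<^sub>R b)"
    unfolding weak_gradient_def
    by (intro conjI loc_integrable_continuous c cg allI impI ballI)
       (simp add: inner test_function_integral_by_parts[OF \<phi>])
  show "weak_laplacian \<phi> (laplacian \<phi>)"
    unfolding weak_laplacian_def
  proof (intro conjI loc_integrable_continuous c allI impI)
    fix \<psi> :: "'a \<Rightarrow> real" assume \<psi>: "test_function \<psi>"
    note d = test_function_pderiv_dir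
    have "(\<integral>x. \<phi> x * laplacian \<psi> x \<partial>lborel) = (\<integral>x. (\<Sum>b\<in>Basis. \<phi> x * pderiv_dir b (pderiv_dir b \<psi>) x) \<partial>lborel)"
      by (simp add: laplacian_def sum_distrib_left)
    also have "\<dots> = (\<Sum>b\<in>Basis. \<integral>x. \<phi> x * pderiv_dir b (pderiv_dir b \<psi>) x \<partial>lborel)"
      by (intro Bochner_Integration.integral_sum integrable_times_test loc_integrable_continuous c d \<psi>)
    also have "\<dots> = (\<Sum>b\<in>Basis. \<integral>x. pderiv_dir b (pderiv_dir b \<phi>) x * \<psi> x \<partial>lborel)"
    proof (rule sum.cong[OF refl])
      fix b :: 'a assume b: "b \<in> Basis"
      have "(\<integral>x. \<phi> x * pderiv_dir b (pderiv_dir b \<psi>) x \<partial>lborel) = - (\<integral>x. pderiv_dir b \<phi> x * pderiv_dir b \<psi> x \<partial>lborel)"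
        by (rule test_function_integral_by_parts[OF \<phi> d[OF \<psi> b] b])
      also have "\<dots> = (\<integral>x. pderiv_dir b (pderiv_dir b \<phi>) x * \<psi> x \<partial>lborel)"
        using test_function_integral_by_parts[OF d[OF \<phi> b] \<psi> b] by simp
      finally show "(\<integral>x. \<phi> x * pderiv_dir b (pderiv_dir b \<psi>) x \<partial>lborel)
          = (\<integral>x. pderiv_dir b (pderiv_dir b \<phi>) x * \<psi> x \<partial>lborel)" .
    qed
    also have "\<dots> = (\<integral>x. (\<Sum>b\<in>Basis. pderiv_dir b (pderiv_dir b \<phi>) x * \<psi> x) \<partial>lborel)"
      by (intro Bochner_Integration.integral_sum[symmetric] integrable_times_test loc_integrable_continuous
            smooth_continuous test_function_smooth d \<phi> \<psi>)
    also have "\<dots> = (\<integral>x. laplacian \<phi> x * \<psi> x \<partial>lborel)"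
      by (simp add: laplacian_def sum_distrib_right)
    finally show "(\<integral>x. \<phi> x * laplacian \<psi> x \<partial>lborel) = (\<integral>x. laplacian \<phi> x * \<psi> x \<partial>lborel)" .
  qed
qed

context energy_setting
begin

text \<open>On small multiples \<open>s \<phi>\<close> of a bump inside \<open>\<Omega>\<close> the energy is of order \<open>s\<^sup>p\<close>, as the potential
  vanishes there, while the nonlinear term is at least of order \<open>s\<close> to the smaller power \<open>\<gamma>0\<close>.\<close>

lemma negative_action:
  assumes ne: "Omega V \<noteq> {}" and F2: "cond_F2 p V f"
  obtains u g w where "fin u g w" "\<A> u g w < 0"
proof -
  obtain \<eta> \<delta> \<gamma> where \<eta>: "\<eta> > 0" and \<delta>: "\<delta> > 0" and \<gamma>: "1 < \<gamma>" "\<gamma> < p"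
    and F: "\<And>x t. x \<in> Omega V \<Longrightarrow> \<bar>t\<bar> \<le> \<delta> \<Longrightarrow> primitive f x t \<ge> \<eta> * \<bar>t\<bar> powr \<gamma>"
    using F2 by (auto simp: cond_F2_def)
  obtain x0 where x0: "x0 \<in> Omega V" using ne by blast
  have "open (Omega V)" by (simp add: Omega_def)
  then obtain a c where ac: "cbox a c \<subseteq> Omega V" "x0 \<in> box a c"
    using open_contains_cbox[of "Omega V" x0] x0 by metis
  have box: "box a c \<subseteq> Omega V" using ac(1) box_subset_cbox[of a c] by blast
  have V0: "V x = 0" if "x \<in> Omega V" for x
    using that interior_subset[of "V -` {0}"] by (auto simp: Omega_def)
  define \<phi> where "\<phi> = box_bump a c 0"
  have \<phi>: "test_function \<phi>" unfolding \<phi>_def by (rule test_function_box_bump)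
  have \<phi>b: "0 \<le> \<phi> x" "\<phi> x \<le> 1" for x unfolding \<phi>_def by (rule box_bump_bounds)+
  have \<phi>pos: "x \<in> box a c \<Longrightarrow> \<phi> x > 0" and \<phi>0: "x \<notin> box a c \<Longrightarrow> \<phi> x = 0" for x
    unfolding \<phi>_def by (rule box_bump_bounds(3), assumption) (rule box_bump_outside)
  obtain B R where R: "\<And>x. norm x > R \<Longrightarrow> \<phi> x = 0" using test_function_bounds[OF \<phi>] by metis
  note [measurable] = test_function_measurable[OF \<phi>]
  define g where "g x = (\<Sum>b\<in>Basis. pderiv_dir b \<phi> x *\<^sub>R b)" for x
  define w where "w = laplacian \<phi>"
  have c\<phi>: "continuous_on UNIV \<phi>" by (rule smooth_continuous[OF test_function_smooth[OF \<phi>]])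
  have cg: "continuous_on UNIV g" unfolding g_def
    by (intro continuous_intros smooth_continuous test_function_smooth test_function_pderiv_dir \<phi>)
  have cw: "continuous_on UNIV w" unfolding w_def
    by (rule smooth_continuous[OF test_function_smooth[OF test_function_laplacian[OF \<phi>]]])
  have g0: "g x = 0" if "norm x > R" for x unfolding g_def using pderiv_dir_outside[OF R that] by simp
  have w0: "w x = 0" if "norm x > R" for x
  proof -
    have "pderiv_dir b \<phi> y = 0" if "norm y > R" for b y using R that by (rule pderiv_dir_outside)
    then have "pderiv_dir b (pderiv_dir b \<phi>) x = 0" for b
      using pderiv_dir_outside[of R "pderiv_dir b \<phi>" x b] \<open>norm x > R\<close> by blast
    then show ?thesis by (simp add: w_def laplacian_def)
  qed
  have V\<phi>: "V x * \<bar>\<phi> x\<bar> powr p = 0" for x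
    using V0[of x] \<phi>0[of x] box by (cases "x \<in> box a c") auto
  have powr_cont: "continuous_on UNIV (\<lambda>x. norm (y x) powr q)"
    if "continuous_on UNIV y" "q > 0" for y :: "'a \<Rightarrow> 'c::real_normed_vector" and q
    using that by (intro continuous_on_powr' continuous_intros) auto
  have fin\<phi>: "fin \<phi> g w"
    unfolding finite_energy_def
  proof (intro conjI)
    show "weak_gradient \<phi> g" "weak_laplacian \<phi> w"
      using test_function_weak_derivatives[OF \<phi>] by (simp_all add: g_def[abs_def] w_def)
    show "integrable lborel (\<lambda>x. \<bar>\<phi> x\<bar> powr p)"
      by (rule integrable_continuous_bounded_support[OF powr_cont[OF c\<phi>, unfolded real_norm_def]]) (use p R in auto)
    show "integrable lborel (\<lambda>x. norm (g x) powr p)"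
      by (rule integrable_continuous_bounded_support[OF powr_cont[OF cg]]) (use p g0 in auto)
    show "integrable lborel (\<lambda>x. \<bar>w x\<bar> powr p)"
      by (rule integrable_continuous_bounded_support[OF powr_cont[OF cw, unfolded real_norm_def]]) (use p w0 in auto)
    show "integrable lborel (\<lambda>x. V x * \<bar>\<phi> x\<bar> powr p)" by (simp add: V\<phi>)
  qed
  define P where "P = (\<integral>x. \<phi> x powr \<gamma> \<partial>lborel)"
  have iP: "integrable lborel (\<lambda>x. \<phi> x powr \<gamma>)"
  proof -
    have "integrable lborel (\<lambda>x. \<bar>\<phi> x\<bar> powr \<gamma>)"
      by (rule integrable_continuous_bounded_support[OF powr_cont[OF c\<phi>, unfolded real_norm_def]]) (use \<gamma> R in auto)
    then show ?thesis using \<phi>b(1) by simp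
  qed
  have P: "P > 0"
  proof (rule ccontr)
    assume "\<not> P > 0"
    moreover have "P \<ge> 0" unfolding P_def by (intro Bochner_Integration.integral_nonneg) auto
    ultimately have "P = 0" by linarith
    then have "(\<integral>x. \<phi> x powr \<gamma> \<partial>lborel) = 0" unfolding P_def .
    then have "AE x in lborel. \<phi> x powr \<gamma> = 0"
      using integral_nonneg_eq_0_iff_AE[OF iP] by simp
    then have "AE x in lborel. x \<in> box a c \<longrightarrow> x \<in> {}"
    proof eventually_elim
      case (elim x)
      then show ?case using \<phi>pos[of x] by auto
    qed
    then have "AE x\<in>box a c in lebesgue. x \<in> {}" by (rule AE_completion)
    from mem_closed_if_AE_lebesgue_open[OF open_box closed_empty this ac(2)] show False by simp
  qed
  define E where "E = \<Phi> \<phi> g w"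
  have E: "E \<ge> 0" unfolding E_def by (rule energy_nonneg)
  define K where "K = \<eta> * P * p / (E + 1)"
  have K: "K > 0" unfolding K_def using \<eta> P p E by (intro divide_pos_pos mult_pos_pos) auto
  \<comment> \<open>With \<open>s\<close> at most this power of \<open>K\<close>, the term of order \<open>s\<^sup>p\<close> is below that of order \<open>s\<close> to the
     power \<open>\<gamma>\<close>.\<close>
  define s where "s = min \<delta> (K powr (1 / (p - \<gamma>)))"
  have s: "s > 0" "s \<le> \<delta>" using \<delta> K by (auto simp: s_def)
  have sK: "s powr (p - \<gamma>) \<le> K"
  proof -
    have "s powr (p - \<gamma>) \<le> (K powr (1 / (p - \<gamma>))) powr (p - \<gamma>)"
      using s \<gamma> by (intro powr_mono2) (auto simp: s_def)
    also have "\<dots> = K powr 1" using \<gamma> by (simp only: powr_powr) simp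
    finally show ?thesis using K by simp
  qed
  let ?u = "\<lambda>x. s * \<phi> x + 0 * \<phi> x" and ?g = "\<lambda>x. s *\<^sub>R g x + 0 *\<^sub>R g x" and ?w = "\<lambda>x. s * w x + 0 * w x"
  have fins: "fin ?u ?g ?w" by (rule finite_energy_lincomb[OF fin\<phi> fin\<phi>])
  have \<Phi>s: "\<Phi> ?u ?g ?w = s powr p * E"
  proof -
    have "dens ?u ?g ?w x = s powr p * dens \<phi> g w x" for x
      using s by (simp add: energy_density_def abs_mult powr_mult algebra_simps)
    then show ?thesis by (simp add: energy_def E_def)
  qed
  have Gs: "\<G> ?u \<ge> \<eta> * s powr \<gamma> * P"
  proof -
    have "\<eta> * s powr \<gamma> * P = (\<integral>x. \<eta> * s powr \<gamma> * \<phi> x powr \<gamma> \<partial>lborel)" by (simp add: P_def)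
    also have "\<dots> \<le> \<G> ?u"
    proof (rule integral_mono)
      show "integrable lborel (\<lambda>x. \<eta> * s powr \<gamma> * \<phi> x powr \<gamma>)" using iP by (rule integrable_mult_right)
      show "integrable lborel (\<lambda>x. primitive f x (?u x))"
        by (rule primitive_integrable[OF p F1 finite_energyD(1,6)[OF fins]])
      fix x
      show "\<eta> * s powr \<gamma> * \<phi> x powr \<gamma> \<le> primitive f x (?u x)"
      proof (cases "x \<in> box a c")
        case True
        have "s * \<phi> x \<le> \<delta>" using s \<phi>b[of x] mult_mono[of s \<delta> "\<phi> x" 1] \<delta> by simp
        then have "\<bar>?u x\<bar> \<le> \<delta>" using s \<phi>b[of x] by simp
        then have "\<eta> * \<bar>?u x\<bar> powr \<gamma> \<le> primitive f x (?u x)" using True box by (intro F) auto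
        moreover have "\<bar>?u x\<bar> powr \<gamma> = s powr \<gamma> * \<phi> x powr \<gamma>" using s \<phi>b[of x] by (simp add: powr_mult)
        ultimately show ?thesis by (simp add: mult.assoc)
      next
        case False
        then show ?thesis using \<phi>0[OF False] by (simp add: primitive_0)
      qed
    qed
    finally show ?thesis .
  qed
  have "s powr p * E / p < \<eta> * s powr \<gamma> * P"
  proof -
    have "s powr p = s powr \<gamma> * s powr (p - \<gamma>)" by (simp flip: powr_add)
    then have "s powr p * E / p = s powr \<gamma> * (s powr (p - \<gamma>) * E / p)" by simp
    also have "\<dots> \<le> s powr \<gamma> * (K * E / p)"
      using sK E p by (intro mult_left_mono divide_right_mono mult_right_mono) auto
    also have "\<dots> < s powr \<gamma> * (\<eta> * P)"
    proof (rule mult_strict_left_mono)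
      have "K * E / p = (\<eta> * P) * (E / (E + 1))" using p by (simp add: K_def)
      also have "\<dots> < (\<eta> * P) * 1" using \<eta> P E by (intro mult_strict_left_mono mult_pos_pos) auto
      finally show "K * E / p < \<eta> * P" by simp
    qed (use s in auto)
    finally show ?thesis by (simp add: mult_ac)
  qed
  with Gs have "\<A> ?u ?g ?w < 0" unfolding action_def \<Phi>s by linarith
  with fins show thesis by (rule that)
qed

end

section \<open>Lebesgue measurable functions and their Borel versions\<close>

lemma locally_integrable_lebesgue_measurable:
  fixes u :: "'a::euclidean_space \<Rightarrow> 'b::euclidean_space"
  assumes "locally_integrable u"
  shows "u \<in> borel_measurable lebesgue"
proof (rule borel_measurable_LIMSEQ_metric)
  show "(\<lambda>x. indicator (cball 0 (real n)) x *\<^sub>R u x) \<in> borel_measurable lebesgue" for n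
    using assms by (intro borel_measurable_integrable) (simp add: locally_integrable_def set_integrable_def)
  show "(\<lambda>n. indicator (cball 0 (real n)) x *\<^sub>R u x) \<longlonglongrightarrow> u x" for x
  proof (rule tendsto_eventually)
    obtain N where "norm x \<le> real N" using real_arch_simple by blast
    then have "indicator (cball 0 (real n)) x *\<^sub>R u x = u x" if "n \<ge> N" for n
      using that by (auto simp: indicator_def)
    then show "\<forall>\<^sub>F n in sequentially. indicator (cball 0 (real n)) x *\<^sub>R u x = u x"
      unfolding eventually_sequentially by blast
  qed
qed

lemma borel_version:
  fixes u :: "'a::euclidean_space \<Rightarrow> 'b::euclidean_space"
  assumes u: "u \<in> borel_measurable lebesgue"
  obtains u' where "u' \<in> borel_measurable borel" "AE x in lborel. u x = u' x"
proof -
  have "\<forall>b\<in>Basis. \<exists>v. v \<in> borel_measurable lborel \<and> (AE x in lborel. u x \<bullet> b = v x)"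
  proof
    fix b :: 'b
    have "(\<lambda>x. u x \<bullet> b) \<in> borel_measurable lebesgue" using u by auto
    then show "\<exists>v. v \<in> borel_measurable lborel \<and> (AE x in lborel. u x \<bullet> b = v x)"
      using completion_ex_borel_measurable_real by blast
  qed
  from bchoice[OF this] obtain v where v: "\<And>b. b \<in> Basis \<Longrightarrow> v b \<in> borel_measurable borel"
    "\<And>b. b \<in> Basis \<Longrightarrow> AE x in lborel. u x \<bullet> b = v b x"
    by auto
  have ae: "AE x in lborel. \<forall>b\<in>Basis. u x \<bullet> b = v b x"
    using v(2) by (subst AE_finite_all) auto
  show thesis
  proof (rule that)
    show "(\<lambda>x. \<Sum>b\<in>Basis. v b x *\<^sub>R b) \<in> borel_measurable borel"
      using v(1) by (intro borel_measurable_sum borel_measurable_scaleR) auto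
    show "AE x in lborel. u x = (\<Sum>b\<in>Basis. v b x *\<^sub>R b)"
      using ae
    proof eventually_elim
      case (elim x)
      then have "(\<Sum>b\<in>Basis. v b x *\<^sub>R b) = (\<Sum>b\<in>Basis. (u x \<bullet> b) *\<^sub>R b)" by (intro sum.cong) auto
      then show ?case by (simp add: euclidean_representation)
    qed
  qed
qed

lemma locally_integrable_borel_version:
  fixes u v :: "'a::euclidean_space \<Rightarrow> 'b::euclidean_space"
  assumes ae: "AE x in lborel. u x = v x" and v: "v \<in> borel_measurable borel"
    and u: "u \<in> borel_measurable lebesgue"
  shows "locally_integrable u \<longleftrightarrow> loc_integrable v"
proof -
  have *: "set_integrable lebesgue K u \<longleftrightarrow> integrable lborel (\<lambda>x. indicator K x *\<^sub>R v x)" if K: "compact K" for K :: "'a set"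
    unfolding set_integrable_def
  proof (rule lebesgue_borel_version(1))
    have KB[measurable]: "K \<in> sets borel" using K by (simp add: compact_imp_closed)
    show "AE x in lborel. indicat_real K x *\<^sub>R u x = indicat_real K x *\<^sub>R v x"
      using ae by eventually_elim simp
    show "(\<lambda>x. indicat_real K x *\<^sub>R v x) \<in> borel_measurable borel" using v by measurable
    show "(\<lambda>x. indicat_real K x *\<^sub>R u x) \<in> borel_measurable lebesgue"
      using u KB by (intro borel_measurable_scaleR borel_measurable_indicator) auto
  qed
  show ?thesis
  proof
    assume "locally_integrable u"
    then show "loc_integrable v"
      using * v by (auto simp: locally_integrable_def loc_integrable_def)
  next
    assume li: "loc_integrable v"
    show "locally_integrable u"
      unfolding locally_integrable_def
    proof (intro allI impI)
      fix K :: "'a set" assume K: "compact K"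
      then obtain R where R: "K \<subseteq> cball 0 R"
        by (meson ball_subset_cball bounded_subset_ballD compact_imp_bounded order_trans)
      have [measurable]: "K \<in> sets borel" using K by (simp add: compact_imp_closed)
      have "integrable lborel (\<lambda>x. indicator K x *\<^sub>R (indicator (cball 0 R) x *\<^sub>R v x))"
        by (rule integrable_mult_indicator) (use li in \<open>auto simp: loc_integrable_def\<close>)
      moreover have "(\<lambda>x. indicat_real K x *\<^sub>R (indicat_real (cball 0 R) x *\<^sub>R v x)) = (\<lambda>x. indicator K x *\<^sub>R v x)"
        using R by (auto simp: indicator_def fun_eq_iff)
      ultimately have "integrable lborel (\<lambda>x. indicator K x *\<^sub>R v x)" by (simp only:)
      then show "set_integrable lebesgue K u" using *[OF K] by blast
    qed
  qed
qed

lemma test_integral_borel_version: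
  fixes u v :: "'a::euclidean_space \<Rightarrow> real"
  assumes ae: "AE x in lborel. u x = v x" and v: "v \<in> borel_measurable borel"
    and u: "u \<in> borel_measurable lebesgue" and \<phi>: "test_function \<phi>"
  shows "(\<integral>x. u x * \<phi> x \<partial>lebesgue) = (\<integral>x. v x * \<phi> x \<partial>lborel)"
proof (rule lebesgue_borel_version(2))
  have [measurable]: "\<phi> \<in> borel_measurable borel" by (rule test_function_measurable[OF \<phi>])
  show "AE x in lborel. u x * \<phi> x = v x * \<phi> x" using ae by eventually_elim simp
  show "(\<lambda>x. v x * \<phi> x) \<in> borel_measurable borel" using v by measurable
  have "\<phi> \<in> borel_measurable lebesgue" by (intro measurable_completion) measurable
  then show "(\<lambda>x. u x * \<phi> x) \<in> borel_measurable lebesgue" using u by measurable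
qed

lemma has_weak_gradient_borel_version:
  fixes u u' :: "'a::euclidean_space \<Rightarrow> real"
  assumes u: "u \<in> borel_measurable lebesgue" "u' \<in> borel_measurable borel" "AE x in lborel. u x = u' x"
    and g: "g \<in> borel_measurable lebesgue" "g' \<in> borel_measurable borel" "AE x in lborel. g x = g' x"
  shows "has_weak_gradient u g \<longleftrightarrow> weak_gradient u' g'"
proof -
  have "(\<integral>x. u x * pderiv_dir b \<phi> x \<partial>lebesgue) = (\<integral>x. u' x * pderiv_dir b \<phi> x \<partial>lborel)"
    and "(\<integral>x. (g x \<bullet> b) * \<phi> x \<partial>lebesgue) = (\<integral>x. (g' x \<bullet> b) * \<phi> x \<partial>lborel)"
    if \<phi>: "test_function \<phi>" and b: "b \<in> Basis" for \<phi> b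
  proof -
    show "(\<integral>x. u x * pderiv_dir b \<phi> x \<partial>lebesgue) = (\<integral>x. u' x * pderiv_dir b \<phi> x \<partial>lborel)"
      by (rule test_integral_borel_version[OF u(3,2,1) test_function_pderiv_dir[OF \<phi> b]])
    have "AE x in lborel. g x \<bullet> b = g' x \<bullet> b" using g(3) by eventually_elim simp
    then show "(\<integral>x. (g x \<bullet> b) * \<phi> x \<partial>lebesgue) = (\<integral>x. (g' x \<bullet> b) * \<phi> x \<partial>lborel)"
      using g(1,2) by (intro test_integral_borel_version \<phi>) auto
  qed
  then show ?thesis
    unfolding has_weak_gradient_def weak_gradient_def
    using locally_integrable_borel_version[OF u(3,2,1)] locally_integrable_borel_version[OF g(3,2,1)] by auto
qed

lemma has_weak_laplacian_borel_version:
  fixes u u' :: "'a::euclidean_space \<Rightarrow> real"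
  assumes u: "u \<in> borel_measurable lebesgue" "u' \<in> borel_measurable borel" "AE x in lborel. u x = u' x"
    and w: "w \<in> borel_measurable lebesgue" "w' \<in> borel_measurable borel" "AE x in lborel. w x = w' x"
  shows "has_weak_laplacian u w \<longleftrightarrow> weak_laplacian u' w'"
  unfolding has_weak_laplacian_def weak_laplacian_def
  using locally_integrable_borel_version[OF u(3,2,1)] locally_integrable_borel_version[OF w(3,2,1)]
    test_integral_borel_version[OF u(3,2,1) test_function_laplacian] test_integral_borel_version[OF w(3,2,1)]
  by auto

lemma weak_gradient_unique:
  fixes u :: "'a::euclidean_space \<Rightarrow> real"
  assumes "weak_gradient u g" "weak_gradient u h"
  shows "AE x in lborel. g x = h x"
proof -
  have li: "loc_integrable g" "loc_integrable h" using assms by (auto simp: weak_gradient_def)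
  have "AE x in lborel. g x \<bullet> b - h x \<bullet> b = 0" if b: "b \<in> Basis" for b
  proof (rule fundamental_lemma)
    show "loc_integrable (\<lambda>x. g x \<bullet> b - h x \<bullet> b)"
      by (intro loc_integrable_diff loc_integrable_inner li)
    fix \<phi> :: "'a \<Rightarrow> real" assume \<phi>: "test_function \<phi>"
    have "(\<integral>x. (g x \<bullet> b) * \<phi> x \<partial>lborel) = (\<integral>x. (h x \<bullet> b) * \<phi> x \<partial>lborel)"
      using assms \<phi> b by (auto simp: weak_gradient_def)
    then show "(\<integral>x. (g x \<bullet> b - h x \<bullet> b) * \<phi> x \<partial>lborel) = 0"
      using integrable_times_test[OF loc_integrable_inner[OF li(1)] \<phi>]
        integrable_times_test[OF loc_integrable_inner[OF li(2)] \<phi>]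
      by (simp add: left_diff_distrib)
  qed
  then have "AE x in lborel. \<forall>b\<in>Basis. g x \<bullet> b - h x \<bullet> b = 0" by (subst AE_finite_all) auto
  then show ?thesis by eventually_elim (auto intro: euclidean_eqI)
qed

lemma weak_laplacian_unique:
  fixes u :: "'a::euclidean_space \<Rightarrow> real"
  assumes "weak_laplacian u w" "weak_laplacian u z"
  shows "AE x in lborel. w x = z x"
proof -
  have li: "loc_integrable w" "loc_integrable z" using assms by (auto simp: weak_laplacian_def)
  have "AE x in lborel. w x - z x = 0"
  proof (rule fundamental_lemma[OF loc_integrable_diff[OF li]])
    fix \<phi> :: "'a \<Rightarrow> real" assume \<phi>: "test_function \<phi>"
    have "(\<integral>x. w x * \<phi> x \<partial>lborel) = (\<integral>x. z x * \<phi> x \<partial>lborel)"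
      using assms \<phi> by (auto simp: weak_laplacian_def)
    then show "(\<integral>x. (w x - z x) * \<phi> x \<partial>lborel) = 0"
      using integrable_times_test[OF li(1) \<phi>] integrable_times_test[OF li(2) \<phi>]
      by (simp add: left_diff_distrib)
  qed
  then show ?thesis by eventually_elim simp
qed

text \<open>The chosen weak derivatives agree almost everywhere with any other ones.\<close>

lemma weak_grad_version:
  fixes v v' :: "'a::euclidean_space \<Rightarrow> real"
  assumes v: "v \<in> borel_measurable lebesgue" "v' \<in> borel_measurable borel" "AE x in lborel. v x = v' x"
    and ex: "has_weak_gradient v g" and h: "weak_gradient v' h"
  shows "weak_grad v \<in> borel_measurable lebesgue" "AE x in lborel. weak_grad v x = h x"
proof -
  have wg: "has_weak_gradient v (weak_grad v)" unfolding weak_grad_def by (rule someI[of _ g]) (rule ex)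
  then show m: "weak_grad v \<in> borel_measurable lebesgue"
    by (intro locally_integrable_lebesgue_measurable) (simp add: has_weak_gradient_def)
  obtain k where k: "k \<in> borel_measurable borel" "AE x in lborel. weak_grad v x = k x"
    using borel_version[OF m] by blast
  have "weak_gradient v' k" using has_weak_gradient_borel_version[OF v m k] wg by simp
  from weak_gradient_unique[OF this h] k(2)
  show "AE x in lborel. weak_grad v x = h x" by eventually_elim simp
qed

lemma weak_lap_version:
  fixes v v' :: "'a::euclidean_space \<Rightarrow> real"
  assumes v: "v \<in> borel_measurable lebesgue" "v' \<in> borel_measurable borel" "AE x in lborel. v x = v' x"
    and ex: "has_weak_laplacian v w" and z: "weak_laplacian v' z"
  shows "weak_lap v \<in> borel_measurable lebesgue" "AE x in lborel. weak_lap v x = z x"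
proof -
  have wl: "has_weak_laplacian v (weak_lap v)" unfolding weak_lap_def by (rule someI[of _ w]) (rule ex)
  then show m: "weak_lap v \<in> borel_measurable lebesgue"
    by (intro locally_integrable_lebesgue_measurable) (simp add: has_weak_laplacian_def)
  obtain k where k: "k \<in> borel_measurable borel" "AE x in lborel. weak_lap v x = k x"
    using borel_version[OF m] by blast
  have "weak_laplacian v' k" using has_weak_laplacian_borel_version[OF v m k] wl by simp
  from weak_laplacian_unique[OF this z] k(2)
  show "AE x in lborel. weak_lap v x = z x" by eventually_elim simp
qed

context energy_setting
begin

text \<open>The space of the weak formulation and the set of triples of finite energy describe the same functions;
  this lemma and the next one pass between them.\<close>

lemma E_space_borel_version:
  assumes v: "v \<in> E_space p lam V"
  obtains v' h z where "fin v' h z" "v \<in> borel_measurable lebesgue"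
    "weak_grad v \<in> borel_measurable lebesgue" "weak_lap v \<in> borel_measurable lebesgue"
    "AE x in lborel. v x = v' x" "AE x in lborel. weak_grad v x = h x" "AE x in lborel. weak_lap v x = z x"
proof -
  obtain g w where vLp: "v \<in> Lp p" and g: "has_weak_gradient v g" "g \<in> Lp p" and w: "has_weak_laplacian v w" "w \<in> Lp p"
    and int: "integrable lebesgue (\<lambda>x. \<bar>weak_lap v x\<bar> powr p + norm (weak_grad v x) powr p + lam * V x * \<bar>v x\<bar> powr p)"
    using v by (auto simp: E_space_def W2p_def)
  have m: "v \<in> borel_measurable lebesgue" "g \<in> borel_measurable lebesgue" "w \<in> borel_measurable lebesgue"
    using vLp g w by (auto simp: Lp_def)
  obtain v' where v': "v' \<in> borel_measurable borel" "AE x in lborel. v x = v' x" by (rule borel_version[OF m(1)])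
  obtain h where h: "h \<in> borel_measurable borel" "AE x in lborel. g x = h x" by (rule borel_version[OF m(2)])
  obtain z where z: "z \<in> borel_measurable borel" "AE x in lborel. w x = z x" by (rule borel_version[OF m(3)])
  note [measurable] = v'(1) h(1) z(1)
  have wg: "weak_gradient v' h" using has_weak_gradient_borel_version[OF m(1) v' m(2) h] g(1) by simp
  have wl: "weak_laplacian v' z" using has_weak_laplacian_borel_version[OF m(1) v' m(3) z] w(1) by simp
  note G = weak_grad_version[OF m(1) v' g(1) wg] and L = weak_lap_version[OF m(1) v' w(1) wl]
  have Lp_int: "integrable lborel (\<lambda>x. norm (y' x) powr p)"
    if "y \<in> Lp p" "AE x in lborel. y x = y' x" and [measurable]: "y' \<in> borel_measurable borel"
    for y y' :: "'a \<Rightarrow> 'c::euclidean_space"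
  proof -
    have "AE x in lborel. norm (y x) powr p = norm (y' x) powr p" using that(2) by eventually_elim simp
    then show ?thesis
      using that(1) by (subst lebesgue_borel_version(1)[symmetric]) (auto simp: Lp_def)
  qed
  have i: "integrable lborel (\<lambda>x. \<bar>v' x\<bar> powr p)" "integrable lborel (\<lambda>x. norm (h x) powr p)" "integrable lborel (\<lambda>x. \<bar>z x\<bar> powr p)"
    using Lp_int[OF vLp v'(2,1)] Lp_int[OF g(2) h(2,1)] Lp_int[OF w(2) z(2,1)] by simp_all
  have "integrable lborel (\<lambda>x. \<bar>z x\<bar> powr p + norm (h x) powr p + lam * V x * \<bar>v' x\<bar> powr p)"
  proof (rule lebesgue_borel_version(1)[THEN iffD1, OF _ _ _ int])
    show "AE x in lborel. \<bar>weak_lap v x\<bar> powr p + norm (weak_grad v x) powr p + lam * V x * \<bar>v x\<bar> powr p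
        = \<bar>z x\<bar> powr p + norm (h x) powr p + lam * V x * \<bar>v' x\<bar> powr p"
      using G(2) L(2) v'(2) by eventually_elim simp
    show "(\<lambda>x. \<bar>z x\<bar> powr p + norm (h x) powr p + lam * V x * \<bar>v' x\<bar> powr p) \<in> borel_measurable borel" by measurable
    show "(\<lambda>x. \<bar>weak_lap v x\<bar> powr p + norm (weak_grad v x) powr p + lam * V x * \<bar>v x\<bar> powr p) \<in> borel_measurable lebesgue"
      using int by (rule borel_measurable_integrable)
  qed
  then have "integrable lborel (\<lambda>x. (\<bar>z x\<bar> powr p + norm (h x) powr p + lam * V x * \<bar>v' x\<bar> powr p) - \<bar>z x\<bar> powr p - norm (h x) powr p)"
    using i by (intro Bochner_Integration.integrable_diff)
  then have "integrable lborel (\<lambda>x. 1 / lam * (lam * V x * \<bar>v' x\<bar> powr p))" by (intro integrable_mult_right) simp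
  then have "integrable lborel (\<lambda>x. V x * \<bar>v' x\<bar> powr p)" using lam by simp
  then have "fin v' h z" using wg wl i by (simp add: finite_energy_def)
  then show thesis by (rule that[OF _ m(1) G(1) L(1) v'(2) G(2) L(2)])
qed

lemma finite_energy_in_E_space:
  assumes T: "fin u g w"
  shows "u \<in> E_space p lam V" "weak_grad u \<in> borel_measurable lebesgue" "weak_lap u \<in> borel_measurable lebesgue"
    "AE x in lborel. weak_grad u x = g x" "AE x in lborel. weak_lap u x = w x"
proof -
  note D = finite_energyD[OF T]
  note [measurable] = D(1-3)
  have m: "u \<in> borel_measurable lebesgue" "g \<in> borel_measurable lebesgue" "w \<in> borel_measurable lebesgue"
    by (intro measurable_completion; measurable)+
  have refl: "AE x in lborel. y x = y x" for y :: "'a \<Rightarrow> 'c" by simp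
  have wg: "has_weak_gradient u g"
    by (rule has_weak_gradient_borel_version[OF m(1) D(1) refl m(2) D(2) refl, THEN iffD2, OF D(4)])
  have wl: "has_weak_laplacian u w"
    by (rule has_weak_laplacian_borel_version[OF m(1) D(1) refl m(3) D(3) refl, THEN iffD2, OF D(5)])
  show G: "weak_grad u \<in> borel_measurable lebesgue" "AE x in lborel. weak_grad u x = g x"
    by (rule weak_grad_version[OF m(1) D(1) refl wg D(4)])+
  show L: "weak_lap u \<in> borel_measurable lebesgue" "AE x in lborel. weak_lap u x = w x"
    by (rule weak_lap_version[OF m(1) D(1) refl wl D(5)])+
  have Lp: "y \<in> Lp p" if "y \<in> borel_measurable lebesgue" "y \<in> borel_measurable borel" "integrable lborel (\<lambda>x. norm (y x) powr p)"
    for y :: "'a \<Rightarrow> 'c::euclidean_space"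
  proof -
    have "integrable lebesgue (\<lambda>x. norm (y x) powr p)"
      by (rule integrable_completion[THEN iffD2]) (use that(2,3) in measurable)
    then show ?thesis using that(1) by (simp add: Lp_def)
  qed
  have uLp: "u \<in> Lp p" "g \<in> Lp p" "w \<in> Lp p"
    by (rule Lp[OF m(1) D(1)], simp add: D(6), rule Lp[OF m(2) D(2) D(7)], rule Lp[OF m(3) D(3)], simp add: D(8))
  have Vm: "V \<in> borel_measurable lebesgue" by (intro measurable_completion) measurable
  have "integrable lebesgue (\<lambda>x. \<bar>weak_lap u x\<bar> powr p + norm (weak_grad u x) powr p + lam * V x * \<bar>u x\<bar> powr p)"
  proof (rule lebesgue_borel_version(1)[THEN iffD2])
    show "integrable lborel (dens u g w)" by (rule D(10))
    show "AE x in lborel. \<bar>weak_lap u x\<bar> powr p + norm (weak_grad u x) powr p + lam * V x * \<bar>u x\<bar> powr p = dens u g w x"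
      using G(2) L(2) by eventually_elim (simp add: energy_density_def)
    show "dens u g w \<in> borel_measurable borel" unfolding energy_density_def[abs_def] by measurable
    show "(\<lambda>x. \<bar>weak_lap u x\<bar> powr p + norm (weak_grad u x) powr p + lam * V x * \<bar>u x\<bar> powr p) \<in> borel_measurable lebesgue"
    proof -
      note [measurable] = G(1) L(1) m(1) Vm
      show ?thesis by measurable
    qed
  qed
  moreover have "u \<in> W2p p" unfolding W2p_def
    by (intro CollectI conjI exI[of _ g] exI[of _ w] uLp wg wl)
  ultimately show "u \<in> E_space p lam V" unfolding E_space_def by (intro CollectI conjI)
qed

lemma minimiser_weak_solution:
  assumes T: "fin u g w" and min: "\<And>u' g' w'. fin u' g' w' \<Longrightarrow> \<A> u g w \<le> \<A> u' g' w'"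
  shows "weak_solution p lam V f u"
  unfolding weak_solution_def Let_def
proof (intro conjI ballI)
  note U = finite_energy_in_E_space[OF T] and D = finite_energyD[OF T]
  show "u \<in> E_space p lam V" by (rule U)
  fix v assume "v \<in> E_space p lam V"
  then obtain v' h z where T': "fin v' h z" and m: "v \<in> borel_measurable lebesgue"
    "weak_grad v \<in> borel_measurable lebesgue" "weak_lap v \<in> borel_measurable lebesgue"
    and ae: "AE x in lborel. v x = v' x" "AE x in lborel. weak_grad v x = h x" "AE x in lborel. weak_lap v x = z x"
    by (rule E_space_borel_version)
  note D' = finite_energyD[OF T']
  have um: "u \<in> borel_measurable lebesgue" "V \<in> borel_measurable lebesgue" using D(1)
    by (intro measurable_completion; measurable)+
  let ?l = "\<lambda>x. \<bar>weak_lap u x\<bar> powr (p - 2) * weak_lap u x * weak_lap v x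
              + norm (weak_grad u x) powr (p - 2) * (weak_grad u x \<bullet> weak_grad v x)
              + lam * V x * \<bar>u x\<bar> powr (p - 2) * u x * v x"
  note EL = action_derivative(1,2)[OF T T'] Euler_Lagrange[OF T min T']
  have ael: "AE x in lborel. ?l x = el_density u g w v' h z x"
    using U(4,5) ae by eventually_elim simp
  have ml: "?l \<in> borel_measurable lebesgue"
  proof -
    have pw: "(\<lambda>x. norm (y x) powr (p - 2)) \<in> borel_measurable lebesgue"
      if [measurable]: "y \<in> borel_measurable lebesgue" for y :: "'a \<Rightarrow> 'c::euclidean_space"
      by measurable
    have pw_real: "(\<lambda>x. \<bar>y x\<bar> powr (p - 2)) \<in> borel_measurable lebesgue"
      if "y \<in> borel_measurable lebesgue" for y :: "'a \<Rightarrow> real"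
      using pw[OF that] by simp
    show ?thesis
      by (intro borel_measurable_add borel_measurable_times borel_measurable_inner borel_measurable_const
          pw pw_real U(2,3) m um)
  qed
  have el_m: "el_density u g w v' h z \<in> borel_measurable borel"
    using borel_measurable_integrable[OF EL(1)] by simp
  note L = lebesgue_borel_version[OF ael el_m ml]
  have aer: "AE x in lborel. f x (u x) * v x = f x (u x) * v' x" using ae(1) by eventually_elim simp
  have fm: "(\<lambda>x. f x (u x)) \<in> borel_measurable borel"
  proof (rule primitive_comp_measurable(2)[OF _ D(1)])
    show "continuous_on UNIV (\<lambda>(x, t). f x t)" using F1 by (simp add: cond_F1_def)
  qed
  then have "(\<lambda>x. f x (u x)) \<in> borel_measurable lebesgue" by (intro measurable_completion) (simp only: measurable_lborel1 measurable_lborel2)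
  then have mr: "(\<lambda>x. f x (u x) * v x) \<in> borel_measurable lebesgue"
    using m(1) by (rule borel_measurable_times)
  have rm: "(\<lambda>x. f x (u x) * v' x) \<in> borel_measurable borel"
    using fm D'(1) by (rule borel_measurable_times)
  note R = lebesgue_borel_version[OF aer rm mr]
  show "integrable lebesgue ?l" "integrable lebesgue (\<lambda>x. f x (u x) * v x)"
    by (rule L(1)[THEN iffD2, OF EL(1)], rule R(1)[THEN iffD2, OF EL(2)])
  show "(\<integral>x. ?l x \<partial>lebesgue) = (\<integral>x. f x (u x) * v x \<partial>lebesgue)"
    by (rule trans[OF L(2) trans[OF EL(3) R(2)[symmetric]]])
qed

lemma nontrivial_weak_solution_exists:
  assumes ne: "Omega V \<noteq> {}" and F2: "cond_F2 p V f"
  shows "\<exists>u. weak_solution p lam V f u \<and> \<not> (AE x in lebesgue. u x = 0)"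
proof -
  obtain u g w where T: "fin u g w" and min: "\<And>u' g' w'. fin u' g' w' \<Longrightarrow> \<A> u g w \<le> \<A> u' g' w'"
    by (rule minimiser_exists) blast
  obtain u1 g1 w1 where "fin u1 g1 w1" "\<A> u1 g1 w1 < 0"
    by (rule negative_action[OF ne F2])
  with min have neg: "\<A> u g w < 0" by (blast intro: le_less_trans)
  have "\<not> (AE x in lebesgue. u x = 0)"
  proof
    assume "AE x in lebesgue. u x = 0"
    then have "AE x in lborel. u x = 0" by (simp add: AE_completion_iff)
    then have "AE x in lborel. primitive f x (u x) = 0" by eventually_elim (simp add: primitive_0)
    then have "\<G> u = 0" by (rule integral_eq_zero_AE)
    then have "\<A> u g w \<ge> 0" using energy_nonneg[of u g w] p by (simp add: action_def)
    with neg show False by simp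
  qed
  with minimiser_weak_solution[OF T min] show ?thesis by blast
qed

end

theorem theorem1p1:
  fixes p :: real
    and V :: "real ^ 'n \<Rightarrow> real"
    and f :: "real ^ 'n \<Rightarrow> real \<Rightarrow> real"
  assumes "p > 1"
    and "real CARD('n) > 2 * p"
    and "continuous_on UNIV V"
    and "cond_V1 V"
    and "cond_V2 V"
    and "cond_V3 V"
    and "cond_F1 p f"
    and "cond_F2 p V f"
  shows "\<exists>\<Lambda>0>0. \<forall>lam>\<Lambda>0. \<exists>u.
    weak_solution p lam V f u \<and> \<not> (AE x in lebesgue. u x = 0)"
  \<comment> \<open>A solution is found for every positive \<open>lam\<close>; the threshold \<open>1\<close> is one choice among many.\<close>
proof (intro exI[of _ 1] conjI allI impI)
  fix lam :: real assume "lam > 1"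
  then interpret energy_setting p lam V f
    by unfold_locales (use assms in \<open>auto simp: cond_V1_def\<close>)
  show "\<exists>u. weak_solution p lam V f u \<and> \<not> (AE x in lebesgue. u x = 0)"
    using assms by (intro nontrivial_weak_solution_exists) (simp_all add: cond_V3_def)
qed simp

end
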